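(* Let $A$ be a closed symmetric linear relation with defect numbers $n_\pm(A)=p<\infty$ in a Hilbert space $\mathfrak H$, let $\mathfrak L\subset\mathfrak H_-$ be a gauge for $A$ and $L:\mathbb C^p\to\mathfrak L$ a linear bijection, let $\Pi=(\mathbb C^p,\Gamma_0,\Gamma_1)$ be a boundary triple for $A^*$ with Weyl function $M(\cdot)$, $\gamma$-field $\gamma(\cdot)$ and $A_0=\ker\Gamma_0$, and let $\widehat R_z^0$ be the regularized extended resolvent of $A_0$. Let $$\mathfrak A(z)=(\mathfrak a_{ij}(z))_{i,j=1}^2=\begin{bmatrix} M(z) & \gamma(\bar z)^{\langle*\rangle}L \\ L^{\langle*\rangle}\gamma(z) & L^{\langle*\rangle}\widehat R_z^0L \end{bmatrix},\quad z\in\rho(A_0),$$ and, for $z\in\rho(A,\mathfrak L)\cap\rho(A_0)$, $$W(z)=\begin{bmatrix} \mathfrak a_{22}(z)\mathfrak a_{12}(z)^{-1} & \mathfrak a_{22}(z)\mathfrak a_{12}(z)^{-1}\mathfrak a_{11}(z)-\mathfrak a_{21}(z) \\ \mathfrak a_{12}(z)^{-1} & \mathfrak a_{12}(z)^{-1}\mathfrak a_{11}(z) \end{bmatrix}.$$ Then: (i) $W(z)=\begin{bmatrix} 0 & \mathfrak a_{12}(z) \\ -I_p & \mathfrak a_{22}(z) \end{bmatrix}^{-1}\begin{bmatrix} I_p & \mathfrak a_{11}(z) \\ 0 & \mathfrak a_{21}(z) \end{bmatrix}$ for $z\in\rho(A,\mathfrak L)\cap\rho(A_0)$. (ii) For $z,\zeta\in\rho(A,\mathfrak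 L)\cap\rho(A_0)$ with $z\ne\bar\zeta$, the kernels $$\mathsf K_\zeta^W(z)=\frac{\widetilde J_p-W(z)\widetilde J_pW(\zeta)^*}{-i(z-\bar\zeta)},\qquad \mathsf N_\zeta^{\mathfrak A}(z)=\frac{\mathfrak A(z)-\mathfrak A(\zeta)^*}{z-\bar\zeta}$$ are related by $$\mathsf K_\zeta^W(z)=\begin{bmatrix} 0 & \mathfrak a_{12}(z) \\ -I_p & \mathfrak a_{22}(z) \end{bmatrix}^{-1}\mathsf N_\zeta^{\mathfrak A}(z)\left(\begin{bmatrix} 0 & \mathfrak a_{12}(\zeta) \\ -I_p & \mathfrak a_{22}(\zeta) \end{bmatrix}^{-1}\right)^*.$$ (iii) $W\in\mathcal W(\widetilde J_p)$. (iv) For every $\tau\in\widetilde{\mathcal R}^{p\times p}$ the family $\widetilde\tau=T_W[\tau]$, $\widetilde\tau(z)=T_{W(z)}[\tau(z)]$, belongs to $\widetilde{\mathcal R}^{p\times p}$ (that is, on $(\rho(A,\mathfrak L)\cap\rho(A_0))\setminus\mathbb R$ it coincides with a family from $\widetilde{\mathcal R}^{p\times p}$).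
   Context: Inner products are linear in the first argument. A linear relation $T$ in $\mathfrak H$ is a linear subspace of $\mathfrak H\times\mathfrak H$; $\mathrm{mul}\,T=\{g:\mathrm{col}\{0,g\}\in T\}$; $T^*=\{\mathrm{col}\{u,f\}:(f,v)=(u,g)\ \forall\,\mathrm{col}\{v,g\}\in T\}$; $A$ symmetric means $A\subseteq A^*$. $\mathfrak N_z=\ker(A^*-zI)$, $\widehat{\mathfrak N}_z=\{\mathrm{col}\{f,zf\}:f\in\mathfrak N_z\}$; $n_\pm(A)=\dim\mathfrak N_z$, $z\in\mathbb C_\pm$; $\widehat\rho(A)$ is the set of $z$ with $\ker(A-zI)=\{0\}$ and $\mathrm{ran}(A-zI)$ closed. Boundary triple for $A^*$: linear maps $\Gamma_0,\Gamma_1:A^*\to\mathbb C^p$ with $(f',g)-(f,g')=(\Gamma_0\widehat g)^*(\Gamma_1\widehat f)-(\Gamma_1\widehat g)^*(\Gamma_0\widehat f)$ for $\widehat f=\mathrm{col}\{f,f'\},\widehat g=\mathrm{col}\{g,g'\}\in A^*$ and $\mathrm{col}\{\Gamma_0,\Gamma_1\}$ onto $\mathbb C^{2p}$. $A_0=\ker\Gamma_0$ is selfadjoint. For $z\in\rho(A_0)$, $\gamma(z)$ is the first component of $\widehat\gamma(z)=(\Gamma_0\upharpoonright\widehat{\mathfrak N}_z)^{-1}$ and $M(z)=\Gamma_1\widehat\gamma(z)$. Rigging $\mathfrak H_+\subset\mathfrak H\subset\mathfrak H_-$ associated with $A$: with $\mathfrak H_0=\overline{\mathrm{dom}\,A}$,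 $\mathfrak H_+=\mathrm{dom}\,A^*\oplus\mathrm{mul}\,A$ with norm $\|h_0+h_1\|_+^2=\|h_0\|^2+\|P_{\mathfrak H_0}h_0'\|^2+\|h_1\|^2$ for $h_0\in\mathrm{dom}\,A^*$, $h_1\in\mathrm{mul}\,A$, $\mathrm{col}\{h_0,h_0'\}\in A^*$; $\mathfrak H_-$ is the space of bounded conjugate-linear functionals on $\mathfrak H_+$, $\langle\mathfrak f,h\rangle_{-,+}:=\mathfrak f(h)$, $\langle h,\mathfrak f\rangle_{+,-}:=\overline{\mathfrak f(h)}$; $f\in\mathfrak H$ is identified with $h\mapsto(f,h)$. Adjoints: for $T\in\mathcal B(\mathfrak H,\mathfrak H_+)$, $(T^{\langle*\rangle}\mathfrak f,g)=\langle\mathfrak f,Tg\rangle_{-,+}$; $\xi^*(\gamma(\bar z)^{\langle*\rangle}\mathfrak f)=\langle\mathfrak f,\gamma(\bar z)\xi\rangle_{-,+}$; $\xi^*(L^{\langle*\rangle}h)=\langle h,L\xi\rangle_{+,-}$, $h\in\mathfrak H_+$. With $R_z^0=(A_0-zI)^{-1}$: $\widetilde R_z^0=(R^0_{\bar z})^{\langle*\rangle}$, $\mathbf R^0=\big(\tfrac12(R_i^0+R_{-i}^0)\big)^{\langle*\rangle}$, $\widehat R_z^0=\widetilde R_z^0-\mathbf R^0\in\mathcal B(\mathfrak H_-,\mathfrak H_+)$. Gauge: $\mathbf A=\{\mathrm{col}\{f,\mathfrak f'\}\in\mathfrak H\times\mathfrak H_-:\langle\mathfrak f',h\rangle_{-,+}=(f,h')\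 \forall\,\mathrm{col}\{h,h'\}\in A^*\}$. For a closed subspace $\mathfrak L\subset\mathfrak H_-$, $\rho(A,\mathfrak L)$ is the set of $z\in\widehat\rho(A)$ with $\mathfrak H_-=\mathrm{ran}(\mathbf A-zI)\dotplus\mathfrak L$; $\mathfrak L$ is a gauge if $\rho(A,\mathfrak L)\neq\emptyset$ (then $\dim\mathfrak L=p$). For $z\in\rho(A_0)$: $z\in\rho(A,\mathfrak L)$ iff $\mathfrak a_{12}(z)$ is invertible. $J_p=\begin{bmatrix} 0 & -I_p \\ I_p & 0 \end{bmatrix}$, $\widetilde J_p=iJ_p$. $W\in\mathcal W(\widetilde J_p)$ means that the kernel $\mathsf K^W_\zeta(z)$ is non-negative (positive semidefinite) on the part $\Omega$ in $\mathbb C_+$ of the domain of holomorphy of $W$, here $\Omega=\rho(A,\mathfrak L)\cap\rho(A_0)\cap\mathbb C_+$. $Q^\#(z):=Q(\bar z)^*$. $\widetilde{\mathcal R}^{p\times p}$ is the set of families of linear relations $\tau(z)=\mathrm{ran}\begin{bmatrix} \varphi(z) \\ \psi(z) \end{bmatrix}$ in $\mathbb C^p$, $z\in\mathbb C\setminus\mathbb R$, with $p\times p$ matrix functions $\varphi,\psi$ holomorphic on $\mathbb C\setminus\mathbb R$ such that $\mathrm{Im}\,z\cdot\mathrm{Im}(\varphi(z)^*\psi(z))\ge0$, $\varphi^\#\psi-\psi^\#\varphi=0$, and $\ker\varphi(z)\cap\ker\psi(z)=\{0\}$. For a block matrix $W=[w_{ij}]_{i,j=1}^2$ and a linear relation $\tau$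 in $\mathbb C^p$, $T_W[\tau]=\{\mathrm{col}\{w_{22}h+w_{21}h',\,w_{12}h+w_{11}h'\}:\mathrm{col}\{h,h'\}\in\tau\}$. *)

theory Defs
  imports "HOL-Analysis.Analysis" "HOL-Library.Function_Algebras"
begin

section \<open>Complex vector spaces and complex Hilbert spaces\<close>

class complex_vector = ab_group_add +
  fixes scaleC :: "complex \<Rightarrow> 'a \<Rightarrow> 'a"  (infixr \<open>*\<^sub>C\<close> 75)
  assumes scaleC_add_right: "a *\<^sub>C (x + y) = a *\<^sub>C x + a *\<^sub>C y"
    and scaleC_add_left: "(a + b) *\<^sub>C x = a *\<^sub>C x + b *\<^sub>C x"
    and scaleC_scaleC: "a *\<^sub>C b *\<^sub>C x = (a * b) *\<^sub>C x"
    and scaleC_one: "1 *\<^sub>C x = x"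

global_interpretation complex_vec:
  vector_space "scaleC :: complex \<Rightarrow> 'a \<Rightarrow> 'a::complex_vector"
  defines csubspace = complex_vec.subspace
    and cspan = complex_vec.span
    and cdependent = complex_vec.dependent
    and cdim = complex_vec.dim
  by unfold_locales
    (simp_all add: scaleC_add_right scaleC_add_left scaleC_scaleC scaleC_one)

text \<open>The inner product is linear in the first argument. Positive definiteness is not listed:
  it follows from the norm axioms and the last axiom, since \<open>sqrt\<close> is negative on negative reals.\<close>

class complex_inner = complex_vector + real_normed_vector +
  fixes cinner :: "'a \<Rightarrow> 'a \<Rightarrow> complex"
  assumes scaleR_scaleC: "scaleR r x = complex_of_real r *\<^sub>C x"
    and cinner_add_left: "cinner (x + y) w = cinner x w + cinner y w"
    and cinner_scaleC_left: "cinner (a *\<^sub>C x) w = a * cinner x w"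
    and cinner_commute: "cinner x w = cnj (cinner w x)"
    and norm_eq_sqrt_cinner: "norm x = sqrt (Re (cinner x x))"

class chilbert_space = complex_inner + complete_space

instantiation complex :: chilbert_space
begin
definition scaleC_complex :: "complex \<Rightarrow> complex \<Rightarrow> complex"
  where "scaleC_complex a x = a * x"
definition cinner_complex :: "complex \<Rightarrow> complex \<Rightarrow> complex"
  where "cinner_complex x y = x * cnj y"
instance
proof
  fix x :: complex
  show "norm x = sqrt (Re (cinner x x))"
    by (simp add: cinner_complex_def cmod_def power2_eq_square)
qed (simp_all add: scaleC_complex_def cinner_complex_def algebra_simps scaleR_conv_of_real)
end

instantiation prod :: (complex_vector, complex_vector) complex_vector
begin
definition scaleC_prod :: "complex \<Rightarrow> 'a \<times> 'b \<Rightarrow> 'a \<times> 'b"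
  where "scaleC_prod a x = (a *\<^sub>C fst x, a *\<^sub>C snd x)"
instance
  by standard (simp_all add: scaleC_prod_def scaleC_add_right scaleC_add_left
      scaleC_scaleC scaleC_one prod_eq_iff)
end

instantiation "fun" :: (type, complex_vector) complex_vector
begin
definition scaleC_fun :: "complex \<Rightarrow> ('a \<Rightarrow> 'b) \<Rightarrow> 'a \<Rightarrow> 'b"
  where "scaleC_fun a f = (\<lambda>x. a *\<^sub>C f x)"
instance
  by standard (simp_all add: scaleC_fun_def scaleC_add_right scaleC_add_left
      scaleC_scaleC scaleC_one fun_eq_iff)
end

instantiation vec :: (complex_vector, finite) complex_vector
begin
definition scaleC_vec :: "complex \<Rightarrow> 'a ^ 'b \<Rightarrow> 'a ^ 'b"
  where "scaleC_vec a x = (\<chi> i. a *\<^sub>C (x $ i))"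
instance
  by standard (simp_all add: scaleC_vec_def scaleC_add_right scaleC_add_left
      scaleC_scaleC scaleC_one vec_eq_iff)
end

text \<open>On \<open>complex ^ 'p\<close> this is the standard inner product: \<open>cinner v u\<close> is \<open>u\<^sup>* v\<close>.\<close>

instantiation vec :: (complex_inner, finite) complex_inner
begin
definition cinner_vec :: "'a ^ 'b \<Rightarrow> 'a ^ 'b \<Rightarrow> complex"
  where "cinner_vec x y = (\<Sum>i\<in>UNIV. cinner (x $ i) (y $ i))"
instance
proof
  fix r :: real and a :: complex and x y w :: "'a ^ 'b"
  show "scaleR r x = complex_of_real r *\<^sub>C x"
    by (simp add: scaleC_vec_def scaleR_scaleC vec_eq_iff)
  show "cinner (x + y) w = cinner x w + cinner y w"
    by (simp add: cinner_vec_def cinner_add_left sum.distrib)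
  show "cinner (a *\<^sub>C x) w = a * cinner x w"
    by (simp add: cinner_vec_def scaleC_vec_def cinner_scaleC_left sum_distrib_left)
  show "cinner x w = cnj (cinner w x)"
    unfolding cinner_vec_def cnj_sum by (rule sum.cong[OF refl], rule cinner_commute)
  have sq: "(norm v)\<^sup>2 = Re (cinner v v)" for v :: 'a
  proof -
    have "0 \<le> sqrt (Re (cinner v v))"
      using norm_ge_zero[of v] by (simp only: norm_eq_sqrt_cinner)
    then show ?thesis by (simp add: norm_eq_sqrt_cinner)
  qed
  show "norm x = sqrt (Re (cinner x x))"
    by (simp add: norm_vec_def L2_set_def cinner_vec_def sq)
qed
end

definition clinear_on :: "'a::complex_vector set \<Rightarrow> ('a \<Rightarrow> 'b::complex_vector) \<Rightarrow> bool" where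
  "clinear_on S f \<longleftrightarrow> (\<forall>x\<in>S. \<forall>y\<in>S. f (x + y) = f x + f y) \<and> (\<forall>a. \<forall>x\<in>S. f (a *\<^sub>C x) = a *\<^sub>C f x)"

definition orth_proj :: "'h::complex_inner set \<Rightarrow> 'h \<Rightarrow> 'h" where
  "orth_proj M x = (THE y. y \<in> M \<and> (\<forall>m\<in>M. cinner (x - y) m = 0))"


section \<open>Linear relations\<close>

definition rel_dom :: "('a \<times> 'b) set \<Rightarrow> 'a set" where
  "rel_dom T = {f. \<exists>f'. (f, f') \<in> T}"

definition rel_ran :: "('a \<times> 'b) set \<Rightarrow> 'b set" where
  "rel_ran T = {f'. \<exists>f. (f, f') \<in> T}"

definition rel_ker :: "('a \<times> 'b::zero) set \<Rightarrow> 'a set" where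
  "rel_ker T = {f. (f, 0) \<in> T}"

definition rel_mul :: "('a::zero \<times> 'b) set \<Rightarrow> 'b set" where
  "rel_mul T = {g. (0, g) \<in> T}"

definition rel_adj :: "('h::complex_inner \<times> 'h) set \<Rightarrow> ('h \<times> 'h) set" where
  "rel_adj T = {(u, f). \<forall>(v, g)\<in>T. cinner f v = cinner u g}"

text \<open>The relation \<open>T - zI\<close>.\<close>

definition rel_shift :: "('h::complex_vector \<times> 'h) set \<Rightarrow> complex \<Rightarrow> ('h \<times> 'h) set" where
  "rel_shift T z = {(f, f' - z *\<^sub>C f) | f f'. (f, f') \<in> T}"

definition symmetric_rel :: "('h::complex_inner \<times> 'h) set \<Rightarrow> bool" where
  "symmetric_rel A \<longleftrightarrow> A \<subseteq> rel_adj A"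

definition closed_symmetric :: "('h::complex_inner \<times> 'h) set \<Rightarrow> bool" where
  "closed_symmetric A \<longleftrightarrow> csubspace A \<and> closed A \<and> symmetric_rel A"

definition defect_space :: "('h::complex_inner \<times> 'h) set \<Rightarrow> complex \<Rightarrow> 'h set" where
  "defect_space A z = rel_ker (rel_shift (rel_adj A) z)"

definition defect_space_hat :: "('h::complex_inner \<times> 'h) set \<Rightarrow> complex \<Rightarrow> ('h \<times> 'h) set" where
  "defect_space_hat A z = {(f, z *\<^sub>C f) | f. f \<in> defect_space A z}"

text \<open>\<open>cdim\<close> of an infinite-dimensional space is \<open>0\<close>, so this expresses finite
  defect numbers only for \<open>m, n > 0\<close>.\<close>

definition defect_numbers :: "('h::complex_inner \<times> 'h) set \<Rightarrow> nat \<Rightarrow> nat \<Rightarrow> bool" where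
  "defect_numbers A m n \<longleftrightarrow>
     (\<forall>z. Im z > 0 \<longrightarrow> cdim (defect_space A z) = m) \<and>
     (\<forall>z. Im z < 0 \<longrightarrow> cdim (defect_space A z) = n)"

definition regular_points :: "('h::complex_inner \<times> 'h) set \<Rightarrow> complex set" where
  "regular_points A = {z. rel_ker (rel_shift A z) = {0} \<and> closed (rel_ran (rel_shift A z))}"

definition resolvent_set :: "('h::complex_inner \<times> 'h) set \<Rightarrow> complex set" where
  "resolvent_set T = {z. \<exists>R. clinear_on UNIV R \<and> bounded_linear R \<and>
     (rel_shift T z)\<inverse> = {(h, R h) | h. True}}"

definition resolvent :: "('h::complex_inner \<times> 'h) set \<Rightarrow> complex \<Rightarrow> 'h \<Rightarrow> 'h" where
  "resolvent T z h = (THE f. (h, f) \<in> (rel_shift T z)\<inverse>)"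


section \<open>Boundary triples\<close>

definition boundary_triple ::
  "('h::complex_inner \<times> 'h) set \<Rightarrow> ('h \<times> 'h \<Rightarrow> complex ^ 'p) \<Rightarrow> ('h \<times> 'h \<Rightarrow> complex ^ 'p) \<Rightarrow> bool"
  where
  "boundary_triple A \<Gamma>0 \<Gamma>1 \<longleftrightarrow>
     clinear_on (rel_adj A) \<Gamma>0 \<and> clinear_on (rel_adj A) \<Gamma>1 \<and>
     (\<forall>(f, f')\<in>rel_adj A. \<forall>(g, g')\<in>rel_adj A.
        cinner f' g - cinner f g' =
          cinner (\<Gamma>1 (f, f')) (\<Gamma>0 (g, g')) - cinner (\<Gamma>0 (f, f')) (\<Gamma>1 (g, g'))) \<and>
     (\<forall>a b. \<exists>x\<in>rel_adj A. \<Gamma>0 x = a \<and> \<Gamma>1 x = b)"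

definition ker_ext ::
  "('h::complex_inner \<times> 'h) set \<Rightarrow> ('h \<times> 'h \<Rightarrow> complex ^ 'p) \<Rightarrow> ('h \<times> 'h) set" where
  "ker_ext A \<Gamma>0 = {x \<in> rel_adj A. \<Gamma>0 x = 0}"

definition gamma_hat ::
  "('h::complex_inner \<times> 'h) set \<Rightarrow> ('h \<times> 'h \<Rightarrow> complex ^ 'p) \<Rightarrow> complex \<Rightarrow> complex ^ 'p \<Rightarrow> 'h \<times> 'h"
  where
  "gamma_hat A \<Gamma>0 z = inv_into (defect_space_hat A z) \<Gamma>0"

definition gamma_field ::
  "('h::complex_inner \<times> 'h) set \<Rightarrow> ('h \<times> 'h \<Rightarrow> complex ^ 'p) \<Rightarrow> complex \<Rightarrow> complex ^ 'p \<Rightarrow> 'h"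
  where
  "gamma_field A \<Gamma>0 z \<xi> = fst (gamma_hat A \<Gamma>0 z \<xi>)"

definition weyl_function ::
  "('h::complex_inner \<times> 'h) set \<Rightarrow> ('h \<times> 'h \<Rightarrow> complex ^ 'p) \<Rightarrow> ('h \<times> 'h \<Rightarrow> complex ^ 'p) \<Rightarrow>
     complex \<Rightarrow> complex ^ 'p ^ 'p" where
  "weyl_function A \<Gamma>0 \<Gamma>1 z = matrix (\<lambda>\<xi>. \<Gamma>1 (gamma_hat A \<Gamma>0 z \<xi>))"


section \<open>The rigging associated with a symmetric relation\<close>

definition H_plus :: "('h::complex_inner \<times> 'h) set \<Rightarrow> 'h set" where
  "H_plus A = {h0 + h1 | h0 h1. h0 \<in> rel_dom (rel_adj A) \<and> h1 \<in> rel_mul A}"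

text \<open>For a closed symmetric \<open>A\<close> the decomposition \<open>h = h0 + h1\<close> is unique (\<open>dom A\<^sup>*\<close> is orthogonal
  to \<open>mul A\<close>) and \<open>h0'\<close> is unique modulo \<open>mul A\<^sup>* = (dom A)\<^sup>\<bottom>\<close>, so the value does not depend on
  choices.\<close>

definition norm_plus :: "('h::complex_inner \<times> 'h) set \<Rightarrow> 'h \<Rightarrow> real" where
  "norm_plus A h = (THE r. \<exists>h0 h0' h1. (h0, h0') \<in> rel_adj A \<and> h1 \<in> rel_mul A \<and> h = h0 + h1 \<and>
     r = sqrt ((norm h0)\<^sup>2 + (norm (orth_proj (closure (rel_dom A)) h0'))\<^sup>2 + (norm h1)\<^sup>2))"

text \<open>Functionals on \<open>H_plus A\<close> are represented by functions on the whole space that vanish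
  outside \<open>H_plus A\<close>. The pairing of \<open>F\<close> in \<open>H_minus A\<close> with \<open>h\<close> in \<open>H_plus A\<close> is then \<open>F h\<close>,
  and the reversed pairing is \<open>cnj (F h)\<close>.\<close>

definition H_minus :: "('h::complex_inner \<times> 'h) set \<Rightarrow> ('h \<Rightarrow> complex) set" where
  "H_minus A = {F. (\<forall>h\<in>H_plus A. \<forall>k\<in>H_plus A. F (h + k) = F h + F k) \<and>
     (\<forall>a. \<forall>h\<in>H_plus A. F (a *\<^sub>C h) = cnj a * F h) \<and>
     (\<exists>C. \<forall>h\<in>H_plus A. cmod (F h) \<le> C * norm_plus A h) \<and>
     (\<forall>h. h \<notin> H_plus A \<longrightarrow> F h = 0)}"

definition norm_minus :: "('h::complex_inner \<times> 'h) set \<Rightarrow> ('h \<Rightarrow> complex) \<Rightarrow> real" where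
  "norm_minus A F = (SUP h\<in>{h \<in> H_plus A. norm_plus A h \<le> 1}. cmod (F h))"

definition closed_subspace_minus :: "('h::complex_inner \<times> 'h) set \<Rightarrow> ('h \<Rightarrow> complex) set \<Rightarrow> bool" where
  "closed_subspace_minus A \<LL> \<longleftrightarrow> csubspace \<LL> \<and> \<LL> \<subseteq> H_minus A \<and>
     (\<forall>X F. (\<forall>n. X n \<in> \<LL>) \<and> F \<in> H_minus A \<and> (\<lambda>n. norm_minus A (X n - F)) \<longlonglongrightarrow> 0 \<longrightarrow> F \<in> \<LL>)"

definition embed_minus :: "('h::complex_inner \<times> 'h) set \<Rightarrow> 'h \<Rightarrow> 'h \<Rightarrow> complex" where
  "embed_minus A f = (\<lambda>h. if h \<in> H_plus A then cinner f h else 0)"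

text \<open>The adjoint \<open>T\<^sup>\<langle>\<^sup>*\<^sup>\<rangle>\<close>, mapping \<open>H_minus A\<close> to \<open>'a\<close>, of an operator \<open>T\<close> from \<open>'a\<close> to
  \<open>H_plus A\<close>; here \<open>'a\<close> is the Hilbert space itself or \<open>complex ^ 'p\<close>.\<close>

definition adj_minus :: "('a::complex_inner \<Rightarrow> 'h) \<Rightarrow> ('h \<Rightarrow> complex) \<Rightarrow> 'a" where
  "adj_minus T F = (THE u. \<forall>g. cinner u g = F (T g))"

text \<open>The adjoint \<open>L\<^sup>\<langle>\<^sup>*\<^sup>\<rangle>\<close>, mapping \<open>H_plus A\<close> to \<open>complex ^ 'p\<close>, of an operator \<open>L\<close> into
  \<open>H_minus A\<close>.\<close>

definition adj_plus :: "(complex ^ 'p \<Rightarrow> 'h \<Rightarrow> complex) \<Rightarrow> 'h \<Rightarrow> complex ^ 'p" where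
  "adj_plus L h = (THE u. \<forall>\<xi>. cinner u \<xi> = cnj (L \<xi> h))"

definition ext_resolvent :: "('h::complex_inner \<times> 'h) set \<Rightarrow> complex \<Rightarrow> ('h \<Rightarrow> complex) \<Rightarrow> 'h" where
  "ext_resolvent A0 z = adj_minus (resolvent A0 (cnj z))"

definition reg_term :: "('h::complex_inner \<times> 'h) set \<Rightarrow> ('h \<Rightarrow> complex) \<Rightarrow> 'h" where
  "reg_term A0 = adj_minus (\<lambda>h. (1/2) *\<^sub>C (resolvent A0 \<i> h + resolvent A0 (- \<i>) h))"

definition reg_ext_resolvent :: "('h::complex_inner \<times> 'h) set \<Rightarrow> complex \<Rightarrow> ('h \<Rightarrow> complex) \<Rightarrow> 'h" where
  "reg_ext_resolvent A0 z F = ext_resolvent A0 z F - reg_term A0 F"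


section \<open>Gauges\<close>

definition ext_rel :: "('h::complex_inner \<times> 'h) set \<Rightarrow> ('h \<times> ('h \<Rightarrow> complex)) set" where
  "ext_rel A = {(f, F). F \<in> H_minus A \<and> (\<forall>(h, h')\<in>rel_adj A. F h = cinner f h')}"

text \<open>The range of \<open>ext_rel A - zI\<close>.\<close>

definition ext_ran :: "('h::complex_inner \<times> 'h) set \<Rightarrow> complex \<Rightarrow> ('h \<Rightarrow> complex) set" where
  "ext_ran A z = {F - z *\<^sub>C embed_minus A f | f F. (f, F) \<in> ext_rel A}"

definition gauge_points :: "('h::complex_inner \<times> 'h) set \<Rightarrow> ('h \<Rightarrow> complex) set \<Rightarrow> complex set" where
  "gauge_points A \<LL> = {z \<in> regular_points A.
     H_minus A = {F + G | F G. F \<in> ext_ran A z \<and> G \<in> \<LL>} \<and> ext_ran A z \<inter> \<LL> = {0}}"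

definition is_gauge :: "('h::complex_inner \<times> 'h) set \<Rightarrow> ('h \<Rightarrow> complex) set \<Rightarrow> bool" where
  "is_gauge A \<LL> \<longleftrightarrow> closed_subspace_minus A \<LL> \<and> gauge_points A \<LL> \<noteq> {}"


section \<open>Block matrices, kernels and Nevanlinna families\<close>

definition block :: "complex ^ 'p ^ 'p \<Rightarrow> complex ^ 'p ^ 'p \<Rightarrow> complex ^ 'p ^ 'p \<Rightarrow> complex ^ 'p ^ 'p \<Rightarrow>
    complex ^ ('p + 'p) ^ ('p + 'p)" where
  "block a b c d = (\<chi> i j. case (i, j) of
      (Inl k, Inl l) \<Rightarrow> a $ k $ l | (Inl k, Inr l) \<Rightarrow> b $ k $ l
    | (Inr k, Inl l) \<Rightarrow> c $ k $ l | (Inr k, Inr l) \<Rightarrow> d $ k $ l)"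

definition block11 :: "complex ^ ('p + 'p) ^ ('p + 'p) \<Rightarrow> complex ^ 'p ^ 'p" where
  "block11 W = (\<chi> k l. W $ Inl k $ Inl l)"

definition block12 :: "complex ^ ('p + 'p) ^ ('p + 'p) \<Rightarrow> complex ^ 'p ^ 'p" where
  "block12 W = (\<chi> k l. W $ Inl k $ Inr l)"

definition block21 :: "complex ^ ('p + 'p) ^ ('p + 'p) \<Rightarrow> complex ^ 'p ^ 'p" where
  "block21 W = (\<chi> k l. W $ Inr k $ Inl l)"

definition block22 :: "complex ^ ('p + 'p) ^ ('p + 'p) \<Rightarrow> complex ^ 'p ^ 'p" where
  "block22 W = (\<chi> k l. W $ Inr k $ Inr l)"

definition cadj :: "complex ^ 'n ^ 'm \<Rightarrow> complex ^ 'm ^ 'n" where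
  "cadj X = (\<chi> i j. cnj (X $ j $ i))"

definition psd :: "complex ^ 'n ^ 'n \<Rightarrow> bool" where
  "psd X \<longleftrightarrow> (\<forall>u. Im (cinner (X *v u) u) = 0 \<and> Re (cinner (X *v u) u) \<ge> 0)"

definition holomorphic_matrix_on :: "(complex \<Rightarrow> complex ^ 'n ^ 'm) \<Rightarrow> complex set \<Rightarrow> bool" where
  "holomorphic_matrix_on W S \<longleftrightarrow> (\<forall>i j. (\<lambda>z. W z $ i $ j) holomorphic_on S)"

definition J_tilde :: "complex ^ ('p::finite + 'p) ^ ('p + 'p)" where
  "J_tilde = \<i> *\<^sub>C block 0 (- mat 1) (mat 1) 0"

text \<open>In the kernels below the first complex argument is \<open>\<zeta>\<close> (the subscript), the second is \<open>z\<close>.\<close>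

definition K_kernel :: "(complex \<Rightarrow> complex ^ ('p::finite + 'p) ^ ('p + 'p)) \<Rightarrow> complex \<Rightarrow> complex \<Rightarrow>
    complex ^ ('p + 'p) ^ ('p + 'p)" where
  "K_kernel W \<zeta> z = (1 / (- \<i> * (z - cnj \<zeta>))) *\<^sub>C (J_tilde - W z ** J_tilde ** cadj (W \<zeta>))"

definition N_kernel :: "(complex \<Rightarrow> complex ^ 'n ^ 'n) \<Rightarrow> complex \<Rightarrow> complex \<Rightarrow> complex ^ 'n ^ 'n" where
  "N_kernel Q \<zeta> z = (1 / (z - cnj \<zeta>)) *\<^sub>C (Q z - cadj (Q \<zeta>))"

definition nonneg_kernel_on :: "complex set \<Rightarrow> (complex \<Rightarrow> complex \<Rightarrow> complex ^ 'n ^ 'n) \<Rightarrow> bool" where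
  "nonneg_kernel_on S K \<longleftrightarrow> (\<forall>(n::nat) (zs :: nat \<Rightarrow> complex) (us :: nat \<Rightarrow> complex ^ 'n).
     (\<forall>i<n. zs i \<in> S) \<longrightarrow>
       Im (\<Sum>i<n. \<Sum>j<n. cinner (K (zs j) (zs i) *v us j) (us i)) = 0 \<and>
       Re (\<Sum>i<n. \<Sum>j<n. cinner (K (zs j) (zs i) *v us j) (us i)) \<ge> 0)"

definition class_W :: "complex set \<Rightarrow> (complex \<Rightarrow> complex ^ ('p::finite + 'p) ^ ('p + 'p)) \<Rightarrow> bool" where
  "class_W \<Omega> W \<longleftrightarrow> open \<Omega> \<and> holomorphic_matrix_on W \<Omega> \<and> nonneg_kernel_on \<Omega> (K_kernel W)"

text \<open>Only the values of a family at non-real points matter.\<close>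

definition nevanlinna_family :: "(complex \<Rightarrow> ((complex ^ 'p) \<times> (complex ^ 'p)) set) \<Rightarrow> bool" where
  "nevanlinna_family \<tau> \<longleftrightarrow> (\<exists>\<phi> \<psi> :: complex \<Rightarrow> complex ^ 'p ^ 'p.
     holomorphic_matrix_on \<phi> (- \<real>) \<and> holomorphic_matrix_on \<psi> (- \<real>) \<and>
     (\<forall>z. z \<notin> \<real> \<longrightarrow>
        psd (complex_of_real (Im z) *\<^sub>C (1 / (2 * \<i>)) *\<^sub>C
          (cadj (\<phi> z) ** \<psi> z - cadj (cadj (\<phi> z) ** \<psi> z))) \<and>
        cadj (\<phi> (cnj z)) ** \<psi> z - cadj (\<psi> (cnj z)) ** \<phi> z = 0 \<and>
        {u. \<phi> z *v u = 0} \<inter> {u. \<psi> z *v u = 0} = {0} \<and>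
        \<tau> z = {(\<phi> z *v u, \<psi> z *v u) | u. True}))"

definition lft :: "complex ^ ('p + 'p) ^ ('p + 'p) \<Rightarrow> ((complex ^ 'p) \<times> (complex ^ 'p)) set \<Rightarrow>
    ((complex ^ 'p) \<times> (complex ^ 'p)) set" where
  "lft W \<tau> = {(block22 W *v h + block21 W *v h', block12 W *v h + block11 W *v h') | h h'.
     (h, h') \<in> \<tau>}"


section \<open>The resolvent matrix\<close>

definition frak_A :: "('h::complex_inner \<times> 'h) set \<Rightarrow> ('h \<times> 'h \<Rightarrow> complex ^ 'p) \<Rightarrow>
    ('h \<times> 'h \<Rightarrow> complex ^ 'p) \<Rightarrow> (complex ^ 'p \<Rightarrow> 'h \<Rightarrow> complex) \<Rightarrow> complex \<Rightarrow>
    complex ^ ('p + 'p) ^ ('p + 'p)" where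
  "frak_A A \<Gamma>0 \<Gamma>1 L z = block
     (weyl_function A \<Gamma>0 \<Gamma>1 z)
     (matrix (\<lambda>\<xi>. adj_minus (gamma_field A \<Gamma>0 (cnj z)) (L \<xi>)))
     (matrix (\<lambda>\<xi>. adj_plus L (gamma_field A \<Gamma>0 z \<xi>)))
     (matrix (\<lambda>\<xi>. adj_plus L (reg_ext_resolvent (ker_ext A \<Gamma>0) z (L \<xi>))))"

definition resolvent_matrix :: "(complex \<Rightarrow> complex ^ ('p::finite + 'p) ^ ('p + 'p)) \<Rightarrow> complex \<Rightarrow>
    complex ^ ('p + 'p) ^ ('p + 'p)" where
  "resolvent_matrix \<AA> z =
     (let a11 = block11 (\<AA> z); a12 = block12 (\<AA> z); a21 = block21 (\<AA> z); a22 = block22 (\<AA> z)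
      in block (a22 ** matrix_inv a12) (a22 ** matrix_inv a12 ** a11 - a21)
               (matrix_inv a12)        (matrix_inv a12 ** a11))"

end

theory Submission
  imports Defs
begin

text \<open>With \<open>G(z) (u, v) = \<gamma>(z) u + R\<^sub>z L v\<close> (extended resolvent) Green's formula and the resolvent
  identity give \<open>\<AA>(z) - \<AA>(\<zeta>)\<^sup>* = (z - cnj \<zeta>) G(\<zeta>)\<^sup>* G(z)\<close>. This one identity yields that \<open>\<AA>\<close> is
  holomorphic off the real line, that \<open>\<AA>(cnj z)\<^sup>* = \<AA>(z)\<close>, and that its Nevanlinna kernel is
  non-negative; the kernel of \<open>W\<close> is congruent to it by block matrix algebra. A functional \<open>L \<xi>\<close>
  lies in the range of the extended relation shifted by \<open>z\<close> iff it annihilates \<open>ran \<gamma>(cnj z)\<close>,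
  i.e. iff \<open>a12(z) \<xi> = 0\<close>, so \<open>a12(z)\<close> is invertible at gauge points.\<close>

section \<open>Complex Hilbert spaces\<close>

text \<open>The obstacle is the entry \<open>a22\<close>. The extended resolvent of a functional F
  lies only in the Hilbert space and not in \<open>H_plus A\<close>, so F'(Rt z F) is undefined.
  Differences are harmless: Rt z F - Rt w F = (z - w) R(z) Rt w F lies in the domain of A0. The
  regularized resolvent is a mean of two such differences with base points i and -i; conjugation
  permutes these points, so they cancel when \<AA>(z) is compared with the adjoint of
  \<AA>(\<zeta>). The adjoints are definite descriptions, so each entry acquires its meaning only
  through a representation theorem; hence the projection and Riesz theorems. The algebraic
  identities are kept valid on the whole resolvent set of A0, because (i) and (ii) also speak about
  real points. Holomorphy and positivity are used off the real axis, where |Im z| |f| <= |f' - z f|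
  holds for a symmetric relation.\<close>

lemma cinner_zero_left [simp]: "cinner 0 x = 0"
  using cinner_add_left[of 0 0 x] by simp

lemma cinner_zero_right [simp]: "cinner x 0 = 0"
  using cinner_commute[of x 0] by simp

lemma cinner_add_right: "cinner x (y + w) = cinner x y + cinner x w"
  by (metis cinner_add_left cinner_commute complex_cnj_add)

lemma cinner_scaleC_right: "cinner x (a *\<^sub>C y) = cnj a * cinner x y"
  by (metis cinner_scaleC_left cinner_commute complex_cnj_mult)

lemma cinner_minus_left: "cinner (- x) y = - cinner x y"
  using cinner_add_left[of x "- x" y] by (simp add: add_eq_0_iff)

lemma cinner_minus_right: "cinner x (- y) = - cinner x y"
  using cinner_add_right[of x y "- y"] by (simp add: add_eq_0_iff)

lemma cinner_diff_left: "cinner (x - y) w = cinner x w - cinner y w"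
  using cinner_add_left[of x "- y" w] by (simp add: cinner_minus_left)

lemma cinner_diff_right: "cinner x (y - w) = cinner x y - cinner x w"
  using cinner_add_right[of x y "- w"] by (simp add: cinner_minus_right)

lemmas cinner_simps = cinner_add_left cinner_add_right cinner_scaleC_left cinner_scaleC_right
  cinner_minus_left cinner_minus_right cinner_diff_left cinner_diff_right

lemma cinner_sum_left: "cinner (\<Sum>i\<in>I. f i) x = (\<Sum>i\<in>I. cinner (f i) x)"
  by (induction I rule: infinite_finite_induct) (simp_all add: cinner_add_left)

lemma cinner_sum_right: "cinner x (\<Sum>i\<in>I. f i) = (\<Sum>i\<in>I. cinner x (f i))"
  by (induction I rule: infinite_finite_induct) (simp_all add: cinner_add_right)

lemma cinner_self: "cinner x x = complex_of_real ((norm x)\<^sup>2)"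
proof -
  have "0 \<le> sqrt (Re (cinner x x))"
    using norm_ge_zero[of x] by (simp only: norm_eq_sqrt_cinner)
  moreover have "Im (cinner x x) = 0"
    using cinner_commute[of x x] by (metis complex_cnj_cancel_iff add.inverse_neutral cnj.simps(2) equal_neg_zero)
  ultimately show ?thesis
    by (simp add: complex_eq_iff norm_eq_sqrt_cinner)
qed

lemma norm_power2_cinner: "(norm x)\<^sup>2 = Re (cinner x x)"
  by (simp add: cinner_self)

lemma norm_scaleC: "norm (a *\<^sub>C (x::'a::complex_inner)) = cmod a * norm x"
proof -
  have "(norm (a *\<^sub>C x))\<^sup>2 = (cmod a * norm x)\<^sup>2"
  proof -
    have "cinner (a *\<^sub>C x) (a *\<^sub>C x) = (a * cnj a) * cinner x x"
      by (simp add: cinner_simps)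
    also have "\<dots> = complex_of_real ((cmod a * norm x)\<^sup>2)"
      by (simp add: cinner_self power_mult_distrib complex_norm_square[of a, symmetric])
    finally show ?thesis by (metis cinner_self of_real_eq_iff)
  qed
  then show ?thesis by (simp add: power2_eq_iff_nonneg)
qed

lemma cinner_eqI: "(\<And>g. cinner u g = cinner v g) \<Longrightarrow> u = v"
proof -
  assume "\<And>g. cinner u g = cinner v g"
  then have "cinner (u - v) (u - v) = 0" by (simp add: cinner_diff_left)
  then show "u = v" by (simp add: cinner_self)
qed

lemma norm_diff_power2:
  "(norm (x - y))\<^sup>2 = (norm x)\<^sup>2 - 2 * Re (cinner x y) + (norm y)\<^sup>2"
proof -
  have "Re (cinner y x) = Re (cinner x y)" by (metis cinner_commute cnj.simps(1))
  then show ?thesis by (simp add: norm_power2_cinner cinner_simps)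
qed

lemma norm_add_power2:
  "(norm (x + y))\<^sup>2 = (norm x)\<^sup>2 + 2 * Re (cinner x y) + (norm y)\<^sup>2"
  using norm_diff_power2[of x "- y"] by (simp add: cinner_simps)

text \<open>The subtracted vector is the projection of x onto the line through m, so this is
  Pythagoras. Nonnegativity of the left side is the Cauchy-Schwarz inequality; the strict decrease
  for a nonzero inner product shows that a nearest point has an orthogonal residual.\<close>

lemma norm_sub_component:
  fixes x m :: "'a::complex_inner"
  assumes "m \<noteq> 0"
  shows "(norm (x - (cinner x m / (norm m)\<^sup>2) *\<^sub>C m))\<^sup>2 = (norm x)\<^sup>2 - (cmod (cinner x m) / norm m)\<^sup>2"
proof -
  let ?c = "cinner x m / (norm m)\<^sup>2"
  have "cinner x (?c *\<^sub>C m) = of_real ((cmod (cinner x m))\<^sup>2) / of_real ((norm m)\<^sup>2)"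
    by (simp only: cinner_simps complex_norm_square) simp
  then have "Re (cinner x (?c *\<^sub>C m)) = (cmod (cinner x m) / norm m)\<^sup>2"
    by (metis Re_complex_of_real of_real_divide power_divide)
  moreover have "(norm (?c *\<^sub>C m))\<^sup>2 = (cmod (cinner x m) / norm m)\<^sup>2"
    using assms by (simp add: norm_scaleC norm_divide norm_power power_divide power_mult_distrib)
      (simp add: field_simps power2_eq_square power4_eq_xxxx)
  ultimately show ?thesis by (simp add: norm_diff_power2)
qed

lemma cauchy_schwarz: "cmod (cinner x y) \<le> norm x * norm (y::'a::complex_inner)"
proof (cases "y = 0")
  case False
  have "(cmod (cinner x y) / norm y)\<^sup>2 \<le> (norm x)\<^sup>2"
    using norm_sub_component[OF False, of x] by (metis diff_ge_0_iff_ge zero_le_power2)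
  then have "cmod (cinner x y) / norm y \<le> norm x"
    by (rule power2_le_imp_le) simp
  then show ?thesis using False by (simp add: field_simps)
qed simp

lemma bounded_linear_cinner_left: "bounded_linear (\<lambda>x. cinner x (y::'a::complex_inner))"
proof (rule bounded_linear_intro[where K = "norm y"])
  show "cinner (r *\<^sub>R x) y = r *\<^sub>R cinner x y" for r x
    by (simp add: scaleR_scaleC cinner_scaleC_left scaleC_complex_def)
  show "norm (cinner x y) \<le> norm x * norm y" for x by (rule cauchy_schwarz)
qed (simp add: cinner_add_left)

lemma bounded_linear_cinner_right: "bounded_linear (cinner (x::'a::complex_inner))"
proof (rule bounded_linear_intro[where K = "norm x"])
  show "cinner x (r *\<^sub>R y) = r *\<^sub>R cinner x y" for r y
    by (simp add: scaleR_scaleC cinner_scaleC_right scaleC_complex_def)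
  show "norm (cinner x y) \<le> norm y * norm x" for y
    using cauchy_schwarz[of x y] by (simp add: mult.commute)
qed (simp add: cinner_add_right)

lemma bounded_linear_scaleC: "bounded_linear (\<lambda>x::'a::complex_inner. a *\<^sub>C x)"
proof (rule bounded_linear_intro[where K = "cmod a"])
  show "a *\<^sub>C r *\<^sub>R x = r *\<^sub>R a *\<^sub>C x" for r and x :: 'a
    by (simp add: scaleR_scaleC scaleC_scaleC mult.commute)
qed (simp_all add: scaleC_add_right norm_scaleC mult.commute)

lemma scaleC_half_add: "(1/2) *\<^sub>C (x + x) = (x::'a::complex_vector)"
  by (simp add: scaleC_add_right scaleC_one flip: scaleC_add_left)

text \<open>A minimizing sequence is Cauchy by the parallelogram law.\<close>

theorem orthogonal_projection_exists:
  fixes M :: "'h::chilbert_space set"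
  assumes "csubspace M" and "closed M"
  shows "\<exists>y\<in>M. \<forall>m\<in>M. cinner (x - y) m = 0"
proof -
  define d where "d = (INF m\<in>M. norm (x - m))"
  have M0: "0 \<in> M" and Madd: "\<And>a b. a \<in> M \<Longrightarrow> b \<in> M \<Longrightarrow> a + b \<in> M"
    and Msc: "\<And>c a. a \<in> M \<Longrightarrow> c *\<^sub>C a \<in> M"
    using assms(1) by (auto simp: complex_vec.subspace_def)
  have bdd: "bdd_below ((\<lambda>m. norm (x - m)) ` M)"
    by (rule bdd_belowI[of _ 0]) auto
  have d_le: "d \<le> norm (x - m)" if "m \<in> M" for m
    unfolding d_def using bdd that by (rule cINF_lower)
  have d0: "0 \<le> d" unfolding d_def using M0 by (intro cINF_greatest) auto
  have "\<exists>m\<in>M. norm (x - m) < d + 1 / Suc n" for n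
    using cINF_less_iff[OF _ bdd, of "d + 1 / Suc n"] M0 unfolding d_def by fastforce
  then obtain y where y: "\<And>n. y n \<in> M" "\<And>n. norm (x - y n) < d + 1 / Suc n" by metis
  have lim: "(\<lambda>n. norm (x - y n)) \<longlonglongrightarrow> d"
  proof (rule tendsto_sandwich[where f = "\<lambda>_. d" and h = "\<lambda>n. d + 1 / Suc n"])
    show "(\<lambda>n. d + 1 / Suc n) \<longlonglongrightarrow> d"
      using LIMSEQ_inverse_real_of_nat_add[of d] by (simp add: inverse_eq_divide)
  next
    show "\<forall>\<^sub>F n in sequentially. norm (x - y n) \<le> d + 1 / Suc n"
      using y(2) by (intro always_eventually allI less_imp_le)
  qed (use d_le y(1) in auto)
  have par: "(norm (y m - y n))\<^sup>2 \<le> 2 * (norm (x - y m))\<^sup>2 + 2 * (norm (x - y n))\<^sup>2 - 4 * d\<^sup>2" for m n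
  proof -
    have eq: "(norm ((x - y m) - (x - y n)))\<^sup>2 + (norm ((x - y m) + (x - y n)))\<^sup>2
      = 2 * (norm (x - y m))\<^sup>2 + 2 * (norm (x - y n))\<^sup>2"
      by (simp only: norm_diff_power2[of "x - y m"] norm_add_power2[of "x - y m"])
    have "(x - y m) + (x - y n) = 2 *\<^sub>C (x - (1/2) *\<^sub>C (y m + y n))"
    proof -
      have "2 *\<^sub>C x = x + x" using scaleC_add_left[of 1 1 x] by (simp add: scaleC_one)
      then show ?thesis
        by (simp add: complex_vec.scale_right_diff_distrib scaleC_scaleC scaleC_one algebra_simps)
    qed
    then have "norm ((x - y m) + (x - y n)) = 2 * norm (x - (1/2) *\<^sub>C (y m + y n))"
      by (simp add: norm_scaleC)
    moreover have "d \<le> norm (x - (1/2) *\<^sub>C (y m + y n))"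
      by (rule d_le) (intro Msc Madd y)
    ultimately have "4 * d\<^sup>2 \<le> (norm ((x - y m) + (x - y n)))\<^sup>2"
      using d0 by (simp add: power_mult_distrib power_mono)
    moreover have "(x - y m) - (x - y n) = - (y m - y n)" by simp
    then have "norm ((x - y m) - (x - y n)) = norm (y m - y n)" by (metis norm_minus_cancel)
    ultimately show ?thesis using eq by simp
  qed
  have "Cauchy y"
  proof (rule metric_CauchyI)
    fix e :: real assume "e > 0"
    have "(\<lambda>n. (norm (x - y n))\<^sup>2) \<longlonglongrightarrow> d\<^sup>2" using lim by (intro tendsto_intros)
    then have "\<forall>\<^sub>F n in sequentially. (norm (x - y n))\<^sup>2 < d\<^sup>2 + e\<^sup>2 / 4"
      using \<open>e > 0\<close> by (intro order_tendstoD(2)) auto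
    then obtain N where N: "\<And>n. n \<ge> N \<Longrightarrow> (norm (x - y n))\<^sup>2 < d\<^sup>2 + e\<^sup>2 / 4"
      by (auto simp: eventually_sequentially)
    have "dist (y m) (y n) < e" if "m \<ge> N" "n \<ge> N" for m n
    proof -
      have "(norm (y m - y n))\<^sup>2 < e\<^sup>2" using par[of m n] N[OF that(1)] N[OF that(2)] by linarith
      then have "norm (y m - y n) < e" using \<open>e > 0\<close> by (meson less_imp_le power_less_imp_less_base)
      then show ?thesis by (simp add: dist_norm)
    qed
    then show "\<exists>N. \<forall>m\<ge>N. \<forall>n\<ge>N. dist (y m) (y n) < e" by blast
  qed
  then obtain l where l: "y \<longlonglongrightarrow> l" using Cauchy_convergent_iff convergent_def by blast
  then have lM: "l \<in> M" using assms(2) y(1) closed_sequentially by blast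
  have "(\<lambda>n. norm (x - y n)) \<longlonglongrightarrow> norm (x - l)" using l by (intro tendsto_intros)
  then have nd: "norm (x - l) = d" using lim LIMSEQ_unique by blast
  \<comment> \<open>Otherwise moving l along m would give a point of M closer to x than the infimum
    d.\<close>
  have "cinner (x - l) m = 0" if "m \<in> M" for m
  proof (rule ccontr)
    assume ne: "cinner (x - l) m \<noteq> 0"
    then have "m \<noteq> 0" by auto
    let ?c = "cinner (x - l) m / (norm m)\<^sup>2"
    have "d \<le> norm (x - (l + ?c *\<^sub>C m))"
      by (rule d_le) (intro Madd Msc lM that)
    then have "d\<^sup>2 \<le> (norm (x - l - ?c *\<^sub>C m))\<^sup>2"
      using d0 by (simp add: power_mono diff_diff_eq)
    also have "\<dots> = d\<^sup>2 - (cmod (cinner (x - l) m) / norm m)\<^sup>2"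
      using norm_sub_component[OF \<open>m \<noteq> 0\<close>, of "x - l"] nd by simp
    finally show False using ne \<open>m \<noteq> 0\<close> by simp
  qed
  then show ?thesis using lM by blast
qed

section \<open>Orthogonal projections and the representation of functionals\<close>

lemma orth_proj_eqI:
  assumes "csubspace M" and "y \<in> M" and "\<And>m. m \<in> M \<Longrightarrow> cinner (x - y) m = 0"
  shows "orth_proj M x = y"
  unfolding orth_proj_def
proof (rule the_equality)
  show "y \<in> M \<and> (\<forall>m\<in>M. cinner (x - y) m = 0)" using assms by blast
next
  fix w assume w: "w \<in> M \<and> (\<forall>m\<in>M. cinner (x - w) m = 0)"
  have "y - w \<in> M" using assms(1,2) w by (simp add: complex_vec.subspace_diff)
  then have "cinner (x - w) (y - w) - cinner (x - y) (y - w) = 0" using w assms(3) by simp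
  then have "cinner (y - w) (y - w) = 0" by (simp add: cinner_simps algebra_simps)
  then show "w = y" by (simp add: cinner_self)
qed

lemma
  fixes M :: "'h::chilbert_space set"
  assumes "csubspace M" and "closed M"
  shows orth_proj_in: "orth_proj M x \<in> M"
    and orth_proj_orthogonal: "m \<in> M \<Longrightarrow> cinner (x - orth_proj M x) m = 0"
  using orthogonal_projection_exists[OF assms, of x] orth_proj_eqI[OF assms(1)] by metis+

lemma norm_orth_proj_le:
  fixes M :: "'h::chilbert_space set"
  assumes "csubspace M" and "closed M"
  shows "norm (orth_proj M x) \<le> norm x"
proof -
  let ?y = "orth_proj M x"
  have "cinner (x - ?y) ?y = 0"
    using assms by (intro orth_proj_orthogonal orth_proj_in)
  then have "(norm x)\<^sup>2 = (norm (x - ?y))\<^sup>2 + (norm ?y)\<^sup>2"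
    using norm_add_power2[of "x - ?y" ?y] by simp
  then have "(norm ?y)\<^sup>2 \<le> (norm x)\<^sup>2" by simp
  then show ?thesis by (rule power2_le_imp_le) simp
qed

text \<open>The functional is conjugate-linear because the inner product is linear in its first
  slot, where the representing vector has to stand. That vector is a multiple of a normal n to the
  kernel, since every g differs from a multiple of n by an element of the kernel.\<close>

theorem riesz_representation:
  fixes f :: "'h::chilbert_space \<Rightarrow> complex"
  assumes add: "\<And>x y. f (x + y) = f x + f y" and scale: "\<And>a x. f (a *\<^sub>C x) = cnj a * f x"
    and bounded: "\<And>x. cmod (f x) \<le> C * norm x"
  shows "\<exists>u. \<forall>g. cinner u g = f g"
proof (cases "\<forall>g. f g = 0")
  case True
  then show ?thesis by (intro exI[of _ 0]) simp
next
  case False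
  then obtain g0 where g0: "f g0 \<noteq> 0" by blast
  have f0: "f 0 = 0" using add[of 0 0] by simp
  have fdiff: "f (x - y) = f x - f y" for x y
    using add[of "x - y" y] by simp
  have bl: "bounded_linear f"
  proof (rule bounded_linear_intro[where K = C])
    show "f (r *\<^sub>R x) = r *\<^sub>R f x" for r x
      by (simp add: scaleR_scaleC scale scaleC_complex_def)
    show "norm (f x) \<le> norm x * C" for x using bounded[of x] by (simp add: mult.commute)
  qed (rule add)
  define K where "K = {g. f g = 0}"
  have K: "csubspace K" by (auto simp: K_def complex_vec.subspace_def add scale f0)
  have "closed K"
    unfolding K_def using bounded_linear.continuous_on[OF bl continuous_on_id]
    by (intro closed_Collect_eq continuous_intros) simp_all
  then obtain k where k: "k \<in> K" "\<And>m. m \<in> K \<Longrightarrow> cinner (g0 - k) m = 0"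
    using orthogonal_projection_exists[OF K] by metis
  define n where "n = g0 - k"
  have fn: "f n \<noteq> 0" using g0 k(1) by (simp add: n_def fdiff K_def)
  have n0: "norm n \<noteq> 0" using fn f0 by auto
  have "cinner ((f n / (norm n)\<^sup>2) *\<^sub>C n) g = f g" for g
  proof -
    \<comment> \<open>f conjugates scalars, so the coefficient that cancels f g is the conjugate of
      the quotient.\<close>
    have "g - cnj (f g / f n) *\<^sub>C n \<in> K" using fn by (simp add: K_def fdiff scale)
    then have "cinner n (g - cnj (f g / f n) *\<^sub>C n) = 0" using k(2) by (simp add: n_def)
    then have "cinner n g = f g / f n * (norm n)\<^sup>2"
      by (simp add: cinner_simps cinner_self)
    then show ?thesis using fn n0 by (simp add: cinner_simps)
  qed
  then show ?thesis by blast
qed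

lemma csubspace_closure:
  fixes M :: "'h::complex_inner set"
  assumes "csubspace M"
  shows "csubspace (closure M)"
  unfolding complex_vec.subspace_def
proof (intro conjI ballI allI)
  show "0 \<in> closure M"
    using assms closure_subset by (auto simp: complex_vec.subspace_def)
  show "x + y \<in> closure M" if xy: "x \<in> closure M" "y \<in> closure M" for x y
  proof -
    obtain u v where u: "\<And>n. u n \<in> M" "u \<longlonglongrightarrow> x" and v: "\<And>n. v n \<in> M" "v \<longlonglongrightarrow> y"
      using xy unfolding closure_sequential by blast
    have "(\<lambda>n. u n + v n) \<longlonglongrightarrow> x + y" using u v by (intro tendsto_intros)
    moreover have "\<forall>n. u n + v n \<in> M" using u(1) v(1) assms by (simp add: complex_vec.subspace_add)
    ultimately show ?thesis unfolding closure_sequential by (intro exI conjI)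
  qed
  show "c *\<^sub>C x \<in> closure M" if x: "x \<in> closure M" for c x
  proof -
    obtain u where u: "\<And>n. u n \<in> M" "u \<longlonglongrightarrow> x"
      using x unfolding closure_sequential by blast
    have "(\<lambda>n. c *\<^sub>C u n) \<longlonglongrightarrow> c *\<^sub>C x"
      by (rule bounded_linear.tendsto[OF bounded_linear_scaleC u(2)])
    moreover have "\<forall>n. c *\<^sub>C u n \<in> M" using u(1) assms by (simp add: complex_vec.subspace_scale)
    ultimately show ?thesis unfolding closure_sequential by (intro exI conjI)
  qed
qed

lemma orthogonal_closure:
  assumes "\<And>v. v \<in> M \<Longrightarrow> cinner d v = 0" and "m \<in> closure M"
  shows "cinner (d::'h::complex_inner) m = 0"
proof -
  obtain u where u: "\<And>n. u n \<in> M" "u \<longlonglongrightarrow> m"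
    using assms(2) unfolding closure_sequential by blast
  have "(\<lambda>n. cinner d (u n)) \<longlonglongrightarrow> cinner d m"
    by (rule bounded_linear.tendsto[OF bounded_linear_cinner_right u(2)])
  then show ?thesis using assms(1)[OF u(1)] by (simp add: LIMSEQ_const_iff)
qed

section \<open>Symmetric and selfadjoint relations\<close>

lemma rel_adj_iff: "(u, f) \<in> rel_adj T \<longleftrightarrow> (\<forall>v g. (v, g) \<in> T \<longrightarrow> cinner f v = cinner u g)"
  by (auto simp: rel_adj_def)

lemma csubspace_rel_adj: "csubspace (rel_adj T)"
  by (auto simp: complex_vec.subspace_def rel_adj_iff zero_prod_def scaleC_prod_def cinner_simps)

lemma closed_rel_adj: "closed (rel_adj T)"
proof -
  have "rel_adj T = (\<Inter>(v, g)\<in>T. {p. cinner (snd p) v = cinner (fst p) g})"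
    by (auto simp: rel_adj_def)
  moreover have "closed {p. cinner (snd p) v = cinner (fst p) g}" for v g :: 'a
    by (intro closed_Collect_eq linear_continuous_on bounded_linear_compose[OF bounded_linear_cinner_left]
        bounded_linear_fst bounded_linear_snd)
  ultimately show ?thesis by (auto intro!: closed_INT)
qed

lemma csubspace_diffD:
  "csubspace T \<Longrightarrow> (a, b) \<in> T \<Longrightarrow> (c, d) \<in> T \<Longrightarrow> (a - c, b - d) \<in> T"
  using complex_vec.subspace_diff[of T "(a, b)" "(c, d)"] by simp

lemma csubspace_addD:
  "csubspace T \<Longrightarrow> (a, b) \<in> T \<Longrightarrow> (c, d) \<in> T \<Longrightarrow> (a + c, b + d) \<in> T"
  using complex_vec.subspace_add[of T "(a, b)" "(c, d)"] by simp

lemma csubspace_scaleD: "csubspace T \<Longrightarrow> (a, b) \<in> T \<Longrightarrow> (c *\<^sub>C a, c *\<^sub>C b) \<in> T"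
  using complex_vec.subspace_scale[of T "(a, b)" c] by (simp add: scaleC_prod_def)

lemma csubspace_zeroD: "csubspace T \<Longrightarrow> (0, 0) \<in> T"
  using complex_vec.subspace_0[of T] by (simp add: zero_prod_def)

lemma symmetric_rel_cinner:
  "symmetric_rel T \<Longrightarrow> (f, f') \<in> T \<Longrightarrow> (g, g') \<in> T \<Longrightarrow> cinner f' g = cinner f g'"
  unfolding symmetric_rel_def by (auto simp: rel_adj_iff subset_iff)

text \<open>For a symmetric relation (f', f) is real, so the imaginary part of (f' - z f, f) is -Im
  z |f|^2, and Cauchy-Schwarz gives the bound. Trivial kernels, closed ranges and the resolvent
  estimate off the real axis all come from it.\<close>

lemma symmetric_rel_norm_le:
  assumes "symmetric_rel T" and "(f, f') \<in> T"
  shows "\<bar>Im z\<bar> * norm f \<le> norm (f' - z *\<^sub>C f)"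
proof (cases "f = 0")
  case False
  have "cinner f' f = cinner f f'" using symmetric_rel_cinner assms by blast
  then have "cinner f' f = cnj (cinner f' f)" by (metis cinner_commute)
  then have "Im (cinner f' f) = 0" by (metis cnj.sel(2) equal_neg_zero)
  then have "\<bar>Im (cinner (f' - z *\<^sub>C f) f)\<bar> = \<bar>Im z\<bar> * (norm f)\<^sup>2"
    by (simp add: cinner_simps cinner_self abs_mult flip: of_real_power)
  then have "\<bar>Im z\<bar> * (norm f)\<^sup>2 \<le> norm (f' - z *\<^sub>C f) * norm f"
    using abs_Im_le_cmod[of "cinner (f' - z *\<^sub>C f) f"] cauchy_schwarz[of "f' - z *\<^sub>C f" f] by linarith
  then show ?thesis using False by (simp add: power2_eq_square)
qed simp

section \<open>Kernels and ranges of T - z\<close>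

lemma rel_ran_shift_iff: "g \<in> rel_ran (rel_shift T z) \<longleftrightarrow> (\<exists>f f'. (f, f') \<in> T \<and> g = f' - z *\<^sub>C f)"
  by (auto simp: rel_ran_def rel_shift_def)

lemma rel_ker_shift_iff: "f \<in> rel_ker (rel_shift T z) \<longleftrightarrow> (f, z *\<^sub>C f) \<in> T"
  by (auto simp: rel_ker_def rel_shift_def)

text \<open>Division by |Im z| turns a convergent sequence of images into a Cauchy sequence of first
  components; the second components then converge as well, and closedness of T captures the limit
  pair.\<close>

lemma closed_rel_ran_shift:
  fixes T :: "('h::chilbert_space \<times> 'h) set"
  assumes "csubspace T" and "closed T" and "symmetric_rel T" and "Im z \<noteq> 0"
  shows "closed (rel_ran (rel_shift T z))"
  unfolding closed_sequential_limits
proof (intro allI impI, elim conjE)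
  fix x l assume x: "\<forall>n. x n \<in> rel_ran (rel_shift T z)" and l: "x \<longlonglongrightarrow> l"
  from x obtain f f' where f: "\<And>n. (f n, f' n) \<in> T" "\<And>n. x n = f' n - z *\<^sub>C f n"
    unfolding rel_ran_shift_iff by metis
  have le: "\<bar>Im z\<bar> * norm (f m - f n) \<le> norm (x m - x n)" for m n
    using symmetric_rel_norm_le[OF assms(3) csubspace_diffD[OF assms(1) f(1) f(1)], of z m n]
    by (simp add: f(2) complex_vec.scale_right_diff_distrib algebra_simps)
  have "Cauchy f"
  proof (rule metric_CauchyI)
    fix e :: real assume "e > 0"
    then have "\<bar>Im z\<bar> * e > 0" using assms(4) by simp
    moreover have "Cauchy x" using l LIMSEQ_imp_Cauchy by blast
    ultimately obtain N where N: "\<And>m n. m \<ge> N \<Longrightarrow> n \<ge> N \<Longrightarrow> dist (x m) (x n) < \<bar>Im z\<bar> * e"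
      using metric_CauchyD by metis
    have "dist (f m) (f n) < e" if "m \<ge> N" "n \<ge> N" for m n
    proof -
      have "\<bar>Im z\<bar> * norm (f m - f n) < \<bar>Im z\<bar> * e" using le[of m n] N[OF that] by (simp add: dist_norm)
      then show ?thesis using assms(4) by (simp add: dist_norm)
    qed
    then show "\<exists>N. \<forall>m\<ge>N. \<forall>n\<ge>N. dist (f m) (f n) < e" by blast
  qed
  then obtain k where k: "f \<longlonglongrightarrow> k" using Cauchy_convergent_iff convergent_def by blast
  have "(\<lambda>n. x n + z *\<^sub>C f n) \<longlonglongrightarrow> l + z *\<^sub>C k"
    by (intro tendsto_intros l bounded_linear.tendsto[OF bounded_linear_scaleC k])
  then have "f' \<longlonglongrightarrow> l + z *\<^sub>C k" by (simp add: f(2))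
  then have "(\<lambda>n. (f n, f' n)) \<longlonglongrightarrow> (k, l + z *\<^sub>C k)" by (intro tendsto_Pair k)
  then have "(k, l + z *\<^sub>C k) \<in> T" by (rule closed_sequentially[OF assms(2) f(1)])
  then show "l \<in> rel_ran (rel_shift T z)" unfolding rel_ran_shift_iff by force
qed

lemma nonreal_in_regular_points:
  fixes T :: "('h::chilbert_space \<times> 'h) set"
  assumes "csubspace T" and "closed T" and "symmetric_rel T" and "Im z \<noteq> 0"
  shows "z \<in> regular_points T"
proof -
  have "f = 0" if "(f, z *\<^sub>C f) \<in> T" for f
    using symmetric_rel_norm_le[OF assms(3) that, of z] assms(4) by (simp add: mult_le_0_iff)
  then show ?thesis
    using closed_rel_ran_shift[OF assms] csubspace_zeroD[OF assms(1)]
    by (auto simp: regular_points_def rel_ker_shift_iff)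
qed

lemma csubspace_rel_ran_shift:
  assumes "csubspace T"
  shows "csubspace (rel_ran (rel_shift T z))"
  unfolding complex_vec.subspace_def
proof (intro conjI ballI allI)
  show "0 \<in> rel_ran (rel_shift T z)"
    unfolding rel_ran_shift_iff using csubspace_zeroD[OF assms] by (intro exI[of _ 0]) simp
  fix x assume "x \<in> rel_ran (rel_shift T z)"
  then obtain f f' where f: "(f, f') \<in> T" "x = f' - z *\<^sub>C f" unfolding rel_ran_shift_iff by blast
  show "c *\<^sub>C x \<in> rel_ran (rel_shift T z)" for c
    unfolding rel_ran_shift_iff
    by (intro exI conjI, rule csubspace_scaleD[OF assms f(1), of c])
      (simp add: f(2) complex_vec.scale_right_diff_distrib scaleC_scaleC mult.commute)
  fix y assume "y \<in> rel_ran (rel_shift T z)"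
  then obtain g g' where g: "(g, g') \<in> T" "y = g' - z *\<^sub>C g" unfolding rel_ran_shift_iff by blast
  show "x + y \<in> rel_ran (rel_shift T z)"
    unfolding rel_ran_shift_iff
    by (intro exI conjI, rule csubspace_addD[OF assms f(1) g(1)])
      (simp add: f(2) g(2) scaleC_add_right)
qed

section \<open>Resolvents of linear relations\<close>

lemma resolvent_setI:
  assumes T: "csubspace T" and ran: "rel_ran (rel_shift T z) = UNIV"
    and bound: "\<And>f f'. (f, f') \<in> T \<Longrightarrow> norm f \<le> C * norm (f' - z *\<^sub>C f)"
  shows "z \<in> resolvent_set (T :: ('h::complex_inner \<times> 'h) set)"
proof -
  have "\<exists>f. (f, g + z *\<^sub>C f) \<in> T" for g
  proof -
    have "g \<in> rel_ran (rel_shift T z)" using ran by simp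
    then obtain f f' where "(f, f') \<in> T" "g = f' - z *\<^sub>C f" unfolding rel_ran_shift_iff by blast
    then show ?thesis by (intro exI[of _ f]) simp
  qed
  then obtain R where R: "\<And>g. (R g, g + z *\<^sub>C R g) \<in> T" by metis
  \<comment> \<open>Two pairs of T with the same image under T - z differ by a pair whose image is
    0, and \<open>bound\<close> forces equal first components. Linearity of the chosen R follows
    from this uniqueness.\<close>
  have uniq: "f = R (f' - z *\<^sub>C f)" if f: "(f, f') \<in> T" for f f'
  proof -
    let ?k = "R (f' - z *\<^sub>C f)"
    have "norm (f - ?k) \<le> C * norm (f' - (f' - z *\<^sub>C f + z *\<^sub>C ?k) - z *\<^sub>C (f - ?k))"
      by (rule bound) (rule csubspace_diffD[OF T f R])
    also have "f' - (f' - z *\<^sub>C f + z *\<^sub>C ?k) - z *\<^sub>C (f - ?k) = 0"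
      by (simp add: complex_vec.scale_right_diff_distrib)
    finally show ?thesis by simp
  qed
  have add: "R (g + h) = R g + R h" for g h
    using uniq[OF csubspace_addD[OF T R[of g] R[of h]]] by (simp add: scaleC_add_right)
  have sc: "R (c *\<^sub>C g) = c *\<^sub>C R g" for c g
    using uniq[OF csubspace_scaleD[OF T R[of g], of c]]
    by (simp add: scaleC_add_right scaleC_scaleC mult.commute)
  have "bounded_linear R"
  proof (rule bounded_linear_intro[where K = C])
    show "norm (R g) \<le> norm g * C" for g using bound[OF R[of g]] by (simp add: mult.commute)
  qed (simp_all add: add scaleR_scaleC sc)
  moreover have "(rel_shift T z)\<inverse> = {(h, R h) | h. True}"
  proof (intro set_eqI iffI)
    fix x assume "x \<in> (rel_shift T z)\<inverse>"
    then show "x \<in> {(h, R h) | h. True}" using uniq by (auto simp: rel_shift_def)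
  next
    fix x assume "x \<in> {(h, R h) | h. True}"
    then obtain h where "x = (h, R h)" by blast
    then show "x \<in> (rel_shift T z)\<inverse>" using R[of h] by (force simp: rel_shift_def)
  qed
  ultimately show ?thesis
    unfolding resolvent_set_def clinear_on_def using add sc by blast
qed

text \<open>The orthogonal complement of the range of T - z is the kernel of T - cnj z because T is
  its own adjoint. This kernel is trivial, so the closed range is everything.\<close>

lemma selfadjoint_nonreal_in_resolvent_set:
  fixes T :: "('h::chilbert_space \<times> 'h) set"
  assumes sa: "rel_adj T = T" and z: "Im z \<noteq> 0"
  shows "z \<in> resolvent_set T"
proof -
  have T: "csubspace T" "closed T" "symmetric_rel T"
    using csubspace_rel_adj[of T] closed_rel_adj[of T] sa by (simp_all add: symmetric_rel_def)
  let ?M = "rel_ran (rel_shift T z)"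
  have "x \<in> ?M" for x
  proof -
    obtain y where y: "y \<in> ?M" "\<And>m. m \<in> ?M \<Longrightarrow> cinner (x - y) m = 0"
      using orthogonal_projection_exists[OF csubspace_rel_ran_shift[OF T(1)]
          closed_rel_ran_shift[OF T z], of x] by blast
    have "(x - y, cnj z *\<^sub>C (x - y)) \<in> rel_adj T"
      unfolding rel_adj_iff
    proof (intro allI impI)
      fix v g assume "(v, g) \<in> T"
      then have "g - z *\<^sub>C v \<in> ?M" unfolding rel_ran_shift_iff by blast
      then have "cinner (x - y) (g - z *\<^sub>C v) = 0" by (rule y(2))
      then show "cinner (cnj z *\<^sub>C (x - y)) v = cinner (x - y) g" by (simp add: cinner_simps)
    qed
    then have "x - y = 0"
      using symmetric_rel_norm_le[OF T(3), of "x - y" "cnj z *\<^sub>C (x - y)" "cnj z"] sa z by (simp add: mult_le_0_iff)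
    then show ?thesis using y(1) by simp
  qed
  then have "?M = UNIV" by blast
  moreover have "norm f \<le> 1 / \<bar>Im z\<bar> * norm (f' - z *\<^sub>C f)" if "(f, f') \<in> T" for f f'
    using symmetric_rel_norm_le[OF T(3) that, of z] z by (simp add: field_simps)
  ultimately show ?thesis using resolvent_setI[OF T(1)] by blast
qed

lemma
  assumes "z \<in> resolvent_set T"
  shows resolvent_in: "(resolvent T z g, g + z *\<^sub>C resolvent T z g) \<in> T"
    and resolvent_eqI: "(f, f') \<in> T \<Longrightarrow> resolvent T z (f' - z *\<^sub>C f) = f"
    and bounded_linear_resolvent: "bounded_linear (resolvent T z)"
    and resolvent_add: "resolvent T z (g + h) = resolvent T z g + resolvent T z h"
    and resolvent_scaleC: "resolvent T z (c *\<^sub>C g) = c *\<^sub>C resolvent T z g"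
proof -
  from assms obtain R where R: "clinear_on UNIV R" "bounded_linear R"
    "(rel_shift T z)\<inverse> = {(h, R h) | h. True}"
    unfolding resolvent_set_def by blast
  have eq: "resolvent T z = R" unfolding resolvent_def R(3) by (rule ext) auto
  have iff: "(f, f') \<in> T \<longleftrightarrow> f = R (f' - z *\<^sub>C f)" for f f'
  proof -
    have "(f, f') \<in> T \<longleftrightarrow> (f' - z *\<^sub>C f, f) \<in> (rel_shift T z)\<inverse>" by (auto simp: rel_shift_def)
    then show ?thesis unfolding R(3) by auto
  qed
  show "(resolvent T z g, g + z *\<^sub>C resolvent T z g) \<in> T" by (simp add: eq iff)
  show "(f, f') \<in> T \<Longrightarrow> resolvent T z (f' - z *\<^sub>C f) = f" by (simp add: eq iff)
  show "bounded_linear (resolvent T z)" by (simp add: eq R(2))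
  show "resolvent T z (g + h) = resolvent T z g + resolvent T z h"
    "resolvent T z (c *\<^sub>C g) = c *\<^sub>C resolvent T z g"
    using R(1) by (auto simp: eq clinear_on_def)
qed

text \<open>T may be multivalued, so instead of multiplying operators one subtracts the two pairs of
  T that define the resolvents at z and w and applies the resolvent at z to the difference.\<close>

lemma resolvent_identity:
  assumes "csubspace T" and z: "z \<in> resolvent_set T" and w: "w \<in> resolvent_set T"
  shows "resolvent T z g - resolvent T w g = (z - w) *\<^sub>C resolvent T z (resolvent T w g)"
proof -
  let ?f = "resolvent T z g" and ?k = "resolvent T w g"
  have "(?f - ?k, (g + z *\<^sub>C ?f) - (g + w *\<^sub>C ?k)) \<in> T"
    by (intro csubspace_diffD assms resolvent_in)
  from resolvent_eqI[OF z this]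
  have "?f - ?k = resolvent T z ((z - w) *\<^sub>C ?k)"
    by (simp add: complex_vec.scale_right_diff_distrib complex_vec.scale_left_diff_distrib)
  then show ?thesis by (simp add: resolvent_scaleC[OF z])
qed

lemma resolvent_adjoint:
  assumes "symmetric_rel T" and z: "z \<in> resolvent_set T" and z': "cnj z \<in> resolvent_set T"
  shows "cinner (resolvent T z g) h = cinner g (resolvent T (cnj z) h)"
  using symmetric_rel_cinner[OF assms(1) resolvent_in[OF z, of g] resolvent_in[OF z', of h]]
  by (simp add: cinner_simps)

lemma norm_resolvent_le:
  assumes "symmetric_rel T" and z: "z \<in> resolvent_set T"
  shows "\<bar>Im z\<bar> * norm (resolvent T z g) \<le> norm g"
  using symmetric_rel_norm_le[OF assms(1) resolvent_in[OF z, of g], of z] by simp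

section \<open>The rigging\<close>

context
  fixes A :: "('h::chilbert_space \<times> 'h) set"
  assumes A: "csubspace A" "symmetric_rel A"
begin

lemma csubspace_rel_dom: "csubspace (rel_dom A)"
  unfolding complex_vec.subspace_def rel_dom_def
  using csubspace_zeroD[OF A(1)] csubspace_addD[OF A(1)] csubspace_scaleD[OF A(1)] by blast

lemma dom_adj_orthogonal_mul: "(f, f') \<in> rel_adj A \<Longrightarrow> h \<in> rel_mul A \<Longrightarrow> cinner f h = 0"
  using rel_adj_iff[of f f' A] by (force simp: rel_mul_def)

text \<open>This discharges the definite description. The first parts of two decompositions differ
  by a vector that lies in the domain of the adjoint and in \<open>rel_mul A\<close> at once, hence
  is orthogonal to itself.\<close>

lemma norm_plus_eq:
  assumes h0: "(h0, h0') \<in> rel_adj A" and h1: "h1 \<in> rel_mul A"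
  shows "norm_plus A (h0 + h1) =
    sqrt ((norm h0)\<^sup>2 + (norm (orth_proj (closure (rel_dom A)) h0'))\<^sup>2 + (norm h1)\<^sup>2)"
  unfolding norm_plus_def
proof (rule the_equality)
  show "\<exists>k0 k0' k1. (k0, k0') \<in> rel_adj A \<and> k1 \<in> rel_mul A \<and> h0 + h1 = k0 + k1 \<and>
     sqrt ((norm h0)\<^sup>2 + (norm (orth_proj (closure (rel_dom A)) h0'))\<^sup>2 + (norm h1)\<^sup>2) =
     sqrt ((norm k0)\<^sup>2 + (norm (orth_proj (closure (rel_dom A)) k0'))\<^sup>2 + (norm k1)\<^sup>2)"
    using assms by blast
next
  let ?M = "closure (rel_dom A)"
  have M: "csubspace ?M" "closed ?M" using csubspace_closure[OF csubspace_rel_dom] by auto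
  fix r assume "\<exists>k0 k0' k1. (k0, k0') \<in> rel_adj A \<and> k1 \<in> rel_mul A \<and> h0 + h1 = k0 + k1 \<and>
     r = sqrt ((norm k0)\<^sup>2 + (norm (orth_proj ?M k0'))\<^sup>2 + (norm k1)\<^sup>2)"
  then obtain k0 k0' k1 where k: "(k0, k0') \<in> rel_adj A" "k1 \<in> rel_mul A" "h0 + h1 = k0 + k1"
    "r = sqrt ((norm k0)\<^sup>2 + (norm (orth_proj ?M k0'))\<^sup>2 + (norm k1)\<^sup>2)" by blast
  have d: "(h0 - k0, h0' - k0') \<in> rel_adj A" using csubspace_diffD[OF csubspace_rel_adj h0 k(1)] .
  have "h0 - k0 = k1 - h1" using k(3) by (simp add: algebra_simps)
  then have "cinner (h0 - k0) (h0 - k0) = cinner (h0 - k0) k1 - cinner (h0 - k0) h1"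
    by (metis cinner_diff_right)
  then have "cinner (h0 - k0) (h0 - k0) = 0"
    using dom_adj_orthogonal_mul[OF d k(2)] dom_adj_orthogonal_mul[OF d h1] by simp
  then have e0: "h0 = k0" by (simp add: cinner_self)
  then have e1: "h1 = k1" using k(3) by simp
  \<comment> \<open>With equal first components the second ones differ by an element of the
    multivalued part of the adjoint, which is orthogonal to dom A and so invisible to the
    projection.\<close>
  have "orth_proj ?M h0' = orth_proj ?M k0'"
  proof (rule orth_proj_eqI[OF M(1)])
    show "orth_proj ?M k0' \<in> ?M" by (rule orth_proj_in[OF M])
    fix m assume m: "m \<in> ?M"
    have "cinner (h0' - k0') v = 0" if "v \<in> rel_dom A" for v
      using d e0 that by (auto simp: rel_adj_iff rel_dom_def)
    then have "cinner (h0' - k0') m = 0" using m by (rule orthogonal_closure)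
    then show "cinner (h0' - orth_proj ?M k0') m = 0"
      using orth_proj_orthogonal[OF M m, of k0'] by (simp add: cinner_simps)
  qed
  then show "r = sqrt ((norm h0)\<^sup>2 + (norm (orth_proj ?M h0'))\<^sup>2 + (norm h1)\<^sup>2)"
    by (simp add: k(4) e0 e1)
qed

lemma dom_adj_in_H_plus:
  assumes "(h, h') \<in> rel_adj A"
  shows "h \<in> H_plus A"
proof -
  have "h = h + 0" by simp
  then show ?thesis
    using assms csubspace_zeroD[OF A(1)] unfolding H_plus_def rel_dom_def rel_mul_def by blast
qed

text \<open>The graph norm dominates the norm of \<open>H_plus A\<close>; this makes the resolvent
  of A0 bounded as a map from the Hilbert space into \<open>H_plus A\<close>.\<close>

lemma norm_plus_dom_adj_le:
  assumes "(h, h') \<in> rel_adj A"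
  shows "norm_plus A h \<le> norm h + norm h'"
proof -
  let ?M = "closure (rel_dom A)"
  have "0 \<in> rel_mul A" using csubspace_zeroD[OF A(1)] by (simp add: rel_mul_def)
  then have "norm_plus A h = sqrt ((norm h)\<^sup>2 + (norm (orth_proj ?M h'))\<^sup>2)"
    using norm_plus_eq[OF assms, of 0] by simp
  also have "\<dots> \<le> norm h + norm (orth_proj ?M h')" by (rule sqrt_sum_squares_le_sum) auto
  also have "norm (orth_proj ?M h') \<le> norm h'"
    by (rule norm_orth_proj_le) (simp_all add: csubspace_closure[OF csubspace_rel_dom])
  finally show ?thesis by simp
qed

lemma norm_le_norm_plus:
  assumes "h \<in> H_plus A"
  shows "norm h \<le> norm_plus A h"
proof -
  obtain h0 h0' h1 where h: "h = h0 + h1" "(h0, h0') \<in> rel_adj A" "h1 \<in> rel_mul A"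
    using assms by (auto simp: H_plus_def rel_dom_def)
  have "(norm h)\<^sup>2 = (norm h0)\<^sup>2 + (norm h1)\<^sup>2"
    using dom_adj_orthogonal_mul[OF h(2,3)] by (simp add: h(1) norm_add_power2)
  then have "norm h = sqrt ((norm h0)\<^sup>2 + (norm h1)\<^sup>2)"
    by (metis norm_ge_zero real_sqrt_abs abs_of_nonneg)
  also have "\<dots> \<le> norm_plus A h" unfolding h(1) norm_plus_eq[OF h(2,3)] by simp
  finally show ?thesis .
qed

lemma H_plus_add:
  assumes "h \<in> H_plus A" and "k \<in> H_plus A"
  shows "h + k \<in> H_plus A"
proof -
  obtain h0 h0' h1 where h: "h = h0 + h1" "(h0, h0') \<in> rel_adj A" "(0, h1) \<in> A"
    using assms(1) by (auto simp: H_plus_def rel_dom_def rel_mul_def)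
  obtain k0 k0' k1 where k: "k = k0 + k1" "(k0, k0') \<in> rel_adj A" "(0, k1) \<in> A"
    using assms(2) by (auto simp: H_plus_def rel_dom_def rel_mul_def)
  have "h + k = (h0 + k0) + (h1 + k1)" by (simp add: h(1) k(1))
  moreover have "(h0 + k0, h0' + k0') \<in> rel_adj A" using csubspace_addD[OF csubspace_rel_adj h(2) k(2)] .
  moreover have "(0, h1 + k1) \<in> A" using csubspace_addD[OF A(1) h(3) k(3)] by simp
  ultimately show ?thesis unfolding H_plus_def rel_dom_def rel_mul_def by blast
qed

lemma H_plus_scaleC:
  assumes "h \<in> H_plus A"
  shows "c *\<^sub>C h \<in> H_plus A"
proof -
  obtain h0 h0' h1 where h: "h = h0 + h1" "(h0, h0') \<in> rel_adj A" "(0, h1) \<in> A"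
    using assms(1) by (auto simp: H_plus_def rel_dom_def rel_mul_def)
  have "c *\<^sub>C h = c *\<^sub>C h0 + c *\<^sub>C h1" by (simp add: h(1) scaleC_add_right)
  moreover have "(c *\<^sub>C h0, c *\<^sub>C h0') \<in> rel_adj A" using csubspace_scaleD[OF csubspace_rel_adj h(2)] .
  moreover have "(0, c *\<^sub>C h1) \<in> A" using csubspace_scaleD[OF A(1) h(3), of c] by simp
  ultimately show ?thesis unfolding H_plus_def rel_dom_def rel_mul_def by blast
qed

section \<open>The space of functionals on \<open>H_plus A\<close>\<close>

lemma embed_minus_in_H_minus: "embed_minus A f \<in> H_minus A"
  unfolding H_minus_def
proof (intro CollectI conjI ballI allI impI exI[of _ "norm f"])
  fix h assume h: "h \<in> H_plus A"
  have "cmod (cinner f h) \<le> norm f * norm_plus A h"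
    using cauchy_schwarz[of f h] norm_le_norm_plus[OF h]
    by (meson mult_left_mono norm_ge_zero order_trans)
  then show "cmod (embed_minus A f h) \<le> norm f * norm_plus A h"
    using h by (simp add: embed_minus_def)
qed (simp_all add: embed_minus_def H_plus_add H_plus_scaleC cinner_simps)

lemma H_minus_add:
  assumes "F \<in> H_minus A" and "F' \<in> H_minus A"
  shows "F + F' \<in> H_minus A"
proof -
  from assms obtain C C' where C: "\<forall>h\<in>H_plus A. cmod (F h) \<le> C * norm_plus A h"
    and C': "\<forall>h\<in>H_plus A. cmod (F' h) \<le> C' * norm_plus A h"
    unfolding H_minus_def by blast
  have "cmod ((F + F') h) \<le> (C + C') * norm_plus A h" if "h \<in> H_plus A" for h
    using norm_triangle_ineq[of "F h" "F' h"] bspec[OF C that] bspec[OF C' that]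
    by (simp add: distrib_right)
  then have "\<exists>C. \<forall>h\<in>H_plus A. cmod ((F + F') h) \<le> C * norm_plus A h" by blast
  then show ?thesis
    using assms unfolding H_minus_def by (simp add: distrib_left)
qed

lemma H_minus_scaleC:
  assumes "F \<in> H_minus A"
  shows "c *\<^sub>C F \<in> H_minus A"
proof -
  from assms obtain C where C: "\<forall>h\<in>H_plus A. cmod (F h) \<le> C * norm_plus A h"
    unfolding H_minus_def by blast
  have "cmod ((c *\<^sub>C F) h) \<le> (cmod c * C) * norm_plus A h" if "h \<in> H_plus A" for h
    using mult_left_mono[OF bspec[OF C that], of "cmod c"]
    by (simp add: scaleC_fun_def scaleC_complex_def norm_mult mult.assoc)
  then have "\<exists>C. \<forall>h\<in>H_plus A. cmod ((c *\<^sub>C F) h) \<le> C * norm_plus A h" by blast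
  then show ?thesis
    using assms unfolding H_minus_def
    by (simp add: scaleC_fun_def scaleC_complex_def algebra_simps)
qed

lemma H_minus_diff: "F \<in> H_minus A \<Longrightarrow> F' \<in> H_minus A \<Longrightarrow> F - F' \<in> H_minus A"
  using H_minus_add[of F "(-1) *\<^sub>C F'"] H_minus_scaleC[of F' "-1"]
  by (simp add: complex_vec.scale_minus_left scaleC_one)

end

lemma H_minus_addD: "F \<in> H_minus A \<Longrightarrow> h \<in> H_plus A \<Longrightarrow> k \<in> H_plus A \<Longrightarrow> F (h + k) = F h + F k"
  by (simp add: H_minus_def)

lemma H_minus_scaleD: "F \<in> H_minus A \<Longrightarrow> h \<in> H_plus A \<Longrightarrow> F (c *\<^sub>C h) = cnj c * F h"
  by (simp add: H_minus_def)

text \<open>Only existence has to be supplied, because a vector is determined by its inner products.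
  Each adjoint thus gets its defining property from a representation theorem.\<close>

lemma cinner_adj_minus:
  assumes "\<exists>u. \<forall>g. cinner u g = F (T g)"
  shows "cinner (adj_minus T F) g = F (T g)"
proof -
  have "\<exists>!u. \<forall>g. cinner u g = F (T g)" using assms cinner_eqI by metis
  from theI'[OF this] show ?thesis unfolding adj_minus_def by blast
qed

lemma adj_minus_eqI: "(\<And>g. cinner u g = F (T g)) \<Longrightarrow> adj_minus T F = u"
  using cinner_adj_minus[of F T] cinner_eqI[of "adj_minus T F" u] by metis

section \<open>Boundary triples\<close>

locale boundary_triplet =
  fixes A :: "('h::chilbert_space \<times> 'h) set"
    and \<Gamma>0 \<Gamma>1 :: "'h \<times> 'h \<Rightarrow> complex ^ 'p"
  assumes csubspace_A: "csubspace A" and closed_A: "closed A" and symmetric_A: "symmetric_rel A"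
    and triple: "boundary_triple A \<Gamma>0 \<Gamma>1"
begin

abbreviation "As \<equiv> rel_adj A"
abbreviation "A0 \<equiv> ker_ext A \<Gamma>0"
abbreviation "\<rho> \<equiv> resolvent_set A0"
abbreviation "R \<equiv> resolvent A0"
abbreviation "\<gamma> \<equiv> gamma_field A \<Gamma>0"
abbreviation "Rt \<equiv> ext_resolvent A0"

lemma
  shows \<Gamma>0_add: "x \<in> As \<Longrightarrow> y \<in> As \<Longrightarrow> \<Gamma>0 (x + y) = \<Gamma>0 x + \<Gamma>0 y"
    and \<Gamma>1_add: "x \<in> As \<Longrightarrow> y \<in> As \<Longrightarrow> \<Gamma>1 (x + y) = \<Gamma>1 x + \<Gamma>1 y"
    and \<Gamma>0_scaleC: "x \<in> As \<Longrightarrow> \<Gamma>0 (c *\<^sub>C x) = c *\<^sub>C \<Gamma>0 x"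
    and \<Gamma>1_scaleC: "x \<in> As \<Longrightarrow> \<Gamma>1 (c *\<^sub>C x) = c *\<^sub>C \<Gamma>1 x"
  using triple by (simp_all add: boundary_triple_def clinear_on_def)

lemma \<Gamma>0_diff: "(a, b) \<in> As \<Longrightarrow> (c, d) \<in> As \<Longrightarrow> \<Gamma>0 (a - c, b - d) = \<Gamma>0 (a, b) - \<Gamma>0 (c, d)"
  using \<Gamma>0_add[of "(a - c, b - d)" "(c, d)"] csubspace_diffD[OF csubspace_rel_adj, of a b A c d]
  by simp

lemma green: "(f, f') \<in> As \<Longrightarrow> (g, g') \<in> As \<Longrightarrow>
  cinner f' g - cinner f g' = cinner (\<Gamma>1 (f, f')) (\<Gamma>0 (g, g')) - cinner (\<Gamma>0 (f, f')) (\<Gamma>1 (g, g'))"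
  using triple unfolding boundary_triple_def by fast

lemma triple_surj: "\<exists>f f'. (f, f') \<in> As \<and> \<Gamma>0 (f, f') = a \<and> \<Gamma>1 (f, f') = b"
  using triple unfolding boundary_triple_def by fast

lemma A0_subset: "A0 \<subseteq> As"
  by (auto simp: ker_ext_def)

text \<open>Surjectivity provides an element of the adjoint with \<open>\<Gamma>0\<close> equal to
  zero and \<open>\<Gamma>1\<close> equal to the \<open>\<Gamma>0\<close>-value under test. Green's
  form between A and its adjoint vanishes, and against this element it equals minus the squared norm
  of that value.\<close>

lemma A_subset_A0: "A \<subseteq> A0"
proof
  fix x assume "x \<in> A"
  moreover obtain f f' where x: "x = (f, f')" by fastforce
  ultimately have fA: "(f, f') \<in> A" by simp
  then have fAs: "(f, f') \<in> As" using symmetric_A by (auto simp: symmetric_rel_def)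
  obtain g g' where g: "(g, g') \<in> As" "\<Gamma>0 (g, g') = 0" "\<Gamma>1 (g, g') = \<Gamma>0 (f, f')"
    using triple_surj by blast
  have "cinner g' f = cinner g f'" using g(1) fA by (simp add: rel_adj_iff)
  then have "cinner f' g - cinner f g' = 0" by (metis cinner_commute right_minus_eq)
  then have "cinner (\<Gamma>0 (f, f')) (\<Gamma>0 (f, f')) = 0"
    using green[OF fAs g(1)] g by simp
  then show "x \<in> A0" using fAs x by (simp add: ker_ext_def cinner_self)
qed

text \<open>One inclusion is Green's formula with both \<open>\<Gamma>0\<close>-values zero. For the
  other, A inside A0 places the adjoint of A0 inside that of A, where the boundary maps are defined,
  and a test element as before shows that \<open>\<Gamma>0\<close> vanishes.\<close>

lemma A0_selfadjoint: "rel_adj A0 = A0"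
proof (intro equalityI subsetI)
  fix x assume "x \<in> A0"
  moreover obtain f f' where x: "x = (f, f')" by fastforce
  ultimately have f: "(f, f') \<in> As" "\<Gamma>0 (f, f') = 0" by (auto simp: ker_ext_def)
  have "(f, f') \<in> rel_adj A0" unfolding rel_adj_iff
  proof (intro allI impI)
    fix g g' assume "(g, g') \<in> A0"
    then show "cinner f' g = cinner f g'" using green[OF f(1), of g g'] f(2) by (auto simp: ker_ext_def)
  qed
  then show "x \<in> rel_adj A0" by (simp add: x)
next
  fix x assume "x \<in> rel_adj A0"
  moreover obtain f f' where x: "x = (f, f')" by fastforce
  ultimately have f: "(f, f') \<in> rel_adj A0" by simp
  then have fAs: "(f, f') \<in> As" using A_subset_A0 by (auto simp: rel_adj_iff)
  obtain g g' where g: "(g, g') \<in> As" "\<Gamma>0 (g, g') = 0" "\<Gamma>1 (g, g') = \<Gamma>0 (f, f')"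
    using triple_surj by blast
  then have "(g, g') \<in> A0" by (simp add: ker_ext_def)
  then have "cinner f' g - cinner f g' = 0" using f by (simp add: rel_adj_iff)
  then have "cinner (\<Gamma>0 (f, f')) (\<Gamma>0 (f, f')) = 0"
    using green[OF fAs g(1)] g by simp
  then show "x \<in> A0" using fAs x by (simp add: ker_ext_def cinner_self)
qed

lemma csubspace_A0: "csubspace A0" and symmetric_A0: "symmetric_rel A0"
  using csubspace_rel_adj[of A0] A0_selfadjoint by (simp_all add: symmetric_rel_def)

lemma nonreal_in_\<rho>: "Im z \<noteq> 0 \<Longrightarrow> z \<in> \<rho>"
  by (rule selfadjoint_nonreal_in_resolvent_set[OF A0_selfadjoint])

text \<open>Selfadjointness enters through the nonreal points, all of which are in the resolvent
  set; a real point is its own conjugate.\<close>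

lemma cnj_in_\<rho>: "z \<in> \<rho> \<Longrightarrow> cnj z \<in> \<rho>"
proof (cases "Im z = 0")
  case True
  then have "cnj z = z" by (simp add: complex_eq_iff)
  then show "z \<in> \<rho> \<Longrightarrow> cnj z \<in> \<rho>" by simp
qed (simp add: nonreal_in_\<rho>)

lemma R_adjoint: "z \<in> \<rho> \<Longrightarrow> cinner (R z g) h = cinner g (R (cnj z) h)"
  by (rule resolvent_adjoint[OF symmetric_A0 _ cnj_in_\<rho>])

lemma R_in_As: "z \<in> \<rho> \<Longrightarrow> (R z g, g + z *\<^sub>C R z g) \<in> As"
  using resolvent_in A0_subset by blast

lemma R_in_H_plus: "z \<in> \<rho> \<Longrightarrow> R z g \<in> H_plus A"
  using dom_adj_in_H_plus[OF csubspace_A symmetric_A R_in_As] .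

section \<open>Defect spaces and the \<gamma>-field\<close>

lemma gamma_hat_exists:
  assumes z: "z \<in> \<rho>"
  shows "\<exists>f. (f, z *\<^sub>C f) \<in> As \<and> \<Gamma>0 (f, z *\<^sub>C f) = \<xi>"
proof -
  obtain f f' where f: "(f, f') \<in> As" "\<Gamma>0 (f, f') = \<xi>" using triple_surj by blast
  \<comment> \<open>Subtracting the pair of A0 with the same image under the shift by z leaves a
    pair (k, z k) and does not change the value of \<open>\<Gamma>0\<close>.\<close>
  define g where "g = R z (f' - z *\<^sub>C f)"
  have g: "(g, f' - z *\<^sub>C f + z *\<^sub>C g) \<in> A0" unfolding g_def by (rule resolvent_in[OF z])
  have "(f - g, z *\<^sub>C (f - g)) = (f - g, f' - (f' - z *\<^sub>C f + z *\<^sub>C g))"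
    by (simp add: complex_vec.scale_right_diff_distrib)
  moreover have "(f - g, f' - (f' - z *\<^sub>C f + z *\<^sub>C g)) \<in> As"
    using csubspace_diffD[OF csubspace_rel_adj f(1)] g A0_subset by blast
  moreover have "\<Gamma>0 (f - g, f' - (f' - z *\<^sub>C f + z *\<^sub>C g)) = \<xi>"
    using \<Gamma>0_diff[OF f(1), of g "f' - z *\<^sub>C f + z *\<^sub>C g"] g
    by (simp only: ker_ext_def f(2) mem_Collect_eq simp_thms diff_0_right)
  ultimately have "(f - g, z *\<^sub>C (f - g)) \<in> As" "\<Gamma>0 (f - g, z *\<^sub>C (f - g)) = \<xi>" by simp_all
  then show ?thesis by blast
qed

lemma defect_unique:
  assumes z: "z \<in> \<rho>" and "(f, z *\<^sub>C f) \<in> As" "(g, z *\<^sub>C g) \<in> As" "\<Gamma>0 (f, z *\<^sub>C f) = \<Gamma>0 (g, z *\<^sub>C g)"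
  shows "f = g"
proof -
  have "(f - g, z *\<^sub>C f - z *\<^sub>C g) \<in> A0"
    using assms csubspace_diffD[OF csubspace_rel_adj] by (simp add: ker_ext_def \<Gamma>0_diff)
  from resolvent_eqI[OF z this] have "R z 0 = f - g"
    by (simp add: complex_vec.scale_right_diff_distrib)
  moreover have "R z 0 = 0" using resolvent_scaleC[OF z, of 0 0] by simp
  ultimately show ?thesis by simp
qed

lemma defect_space_hat_iff: "x \<in> defect_space_hat A z \<longleftrightarrow> (\<exists>f. x = (f, z *\<^sub>C f) \<and> (f, z *\<^sub>C f) \<in> As)"
  by (auto simp: defect_space_hat_def defect_space_def rel_ker_shift_iff)

lemma
  assumes z: "z \<in> \<rho>"
  shows gamma_hat_eq: "gamma_hat A \<Gamma>0 z \<xi> = (\<gamma> z \<xi>, z *\<^sub>C \<gamma> z \<xi>)"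
    and gamma_in_As: "(\<gamma> z \<xi>, z *\<^sub>C \<gamma> z \<xi>) \<in> As"
    and \<Gamma>0_gamma: "\<Gamma>0 (\<gamma> z \<xi>, z *\<^sub>C \<gamma> z \<xi>) = \<xi>"
proof -
  have "\<xi> \<in> \<Gamma>0 ` defect_space_hat A z"
    using gamma_hat_exists[OF z, of \<xi>] by (auto simp: image_iff defect_space_hat_iff)
  then have in_hat: "gamma_hat A \<Gamma>0 z \<xi> \<in> defect_space_hat A z"
    and G0: "\<Gamma>0 (gamma_hat A \<Gamma>0 z \<xi>) = \<xi>"
    unfolding gamma_hat_def by (rule inv_into_into, rule f_inv_into_f)
  obtain f where f: "gamma_hat A \<Gamma>0 z \<xi> = (f, z *\<^sub>C f)" "(f, z *\<^sub>C f) \<in> As"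
    using in_hat unfolding defect_space_hat_iff by blast
  have "\<gamma> z \<xi> = f" by (simp add: gamma_field_def f(1))
  then show "gamma_hat A \<Gamma>0 z \<xi> = (\<gamma> z \<xi>, z *\<^sub>C \<gamma> z \<xi>)" "(\<gamma> z \<xi>, z *\<^sub>C \<gamma> z \<xi>) \<in> As"
    "\<Gamma>0 (\<gamma> z \<xi>, z *\<^sub>C \<gamma> z \<xi>) = \<xi>"
    using f G0 by auto
qed

lemma gamma_\<Gamma>0: "z \<in> \<rho> \<Longrightarrow> (f, z *\<^sub>C f) \<in> As \<Longrightarrow> \<gamma> z (\<Gamma>0 (f, z *\<^sub>C f)) = f"
  using defect_unique gamma_in_As \<Gamma>0_gamma by blast

lemma gamma_eqI: "z \<in> \<rho> \<Longrightarrow> (f, z *\<^sub>C f) \<in> As \<Longrightarrow> \<Gamma>0 (f, z *\<^sub>C f) = \<xi> \<Longrightarrow> \<gamma> z \<xi> = f"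
  using gamma_\<Gamma>0 by blast

lemma gamma_add:
  assumes z: "z \<in> \<rho>"
  shows "\<gamma> z (\<xi> + \<eta>) = \<gamma> z \<xi> + \<gamma> z \<eta>"
proof (rule gamma_eqI[OF z])
  show "(\<gamma> z \<xi> + \<gamma> z \<eta>, z *\<^sub>C (\<gamma> z \<xi> + \<gamma> z \<eta>)) \<in> As"
    using csubspace_addD[OF csubspace_rel_adj gamma_in_As[OF z] gamma_in_As[OF z]]
    by (simp add: scaleC_add_right)
  show "\<Gamma>0 (\<gamma> z \<xi> + \<gamma> z \<eta>, z *\<^sub>C (\<gamma> z \<xi> + \<gamma> z \<eta>)) = \<xi> + \<eta>"
    using \<Gamma>0_add[OF gamma_in_As[OF z] gamma_in_As[OF z], of \<xi> \<eta>]
    by (simp add: scaleC_add_right \<Gamma>0_gamma[OF z])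
qed

lemma gamma_scaleC:
  assumes z: "z \<in> \<rho>"
  shows "\<gamma> z (c *\<^sub>C \<xi>) = c *\<^sub>C \<gamma> z \<xi>"
proof (rule gamma_eqI[OF z])
  have eq: "z *\<^sub>C c *\<^sub>C \<gamma> z \<xi> = c *\<^sub>C z *\<^sub>C \<gamma> z \<xi>" by (simp add: scaleC_scaleC mult.commute)
  show "(c *\<^sub>C \<gamma> z \<xi>, z *\<^sub>C c *\<^sub>C \<gamma> z \<xi>) \<in> As"
    unfolding eq by (rule csubspace_scaleD[OF csubspace_rel_adj gamma_in_As[OF z]])
  show "\<Gamma>0 (c *\<^sub>C \<gamma> z \<xi>, z *\<^sub>C c *\<^sub>C \<gamma> z \<xi>) = c *\<^sub>C \<xi>"
    unfolding eq using \<Gamma>0_scaleC[OF gamma_in_As[OF z], of c \<xi>] by (simp add: scaleC_prod_def \<Gamma>0_gamma[OF z])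
qed

lemma gamma_in_H_plus: "z \<in> \<rho> \<Longrightarrow> \<gamma> z \<xi> \<in> H_plus A"
  using dom_adj_in_H_plus[OF csubspace_A symmetric_A gamma_in_As] .

text \<open>Both defect elements have the same \<open>\<Gamma>0\<close>-value, so their difference
  lies in A0, and the resolvent recovers its first component.\<close>

lemma gamma_diff:
  assumes z: "z \<in> \<rho>" and w: "w \<in> \<rho>"
  shows "\<gamma> z \<xi> - \<gamma> w \<xi> = (z - w) *\<^sub>C R z (\<gamma> w \<xi>)"
proof -
  have "(\<gamma> z \<xi> - \<gamma> w \<xi>, z *\<^sub>C \<gamma> z \<xi> - w *\<^sub>C \<gamma> w \<xi>) \<in> A0"
    using csubspace_diffD[OF csubspace_rel_adj gamma_in_As[OF z] gamma_in_As[OF w]]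
      \<Gamma>0_diff[OF gamma_in_As[OF z] gamma_in_As[OF w]]
    by (simp add: ker_ext_def \<Gamma>0_gamma[OF z] \<Gamma>0_gamma[OF w])
  from resolvent_eqI[OF z this] have "\<gamma> z \<xi> - \<gamma> w \<xi> = R z ((z - w) *\<^sub>C \<gamma> w \<xi>)"
    by (simp add: complex_vec.scale_right_diff_distrib complex_vec.scale_left_diff_distrib)
  then show ?thesis by (simp add: resolvent_scaleC[OF z])
qed

text \<open>This splits the domain of the adjoint into the range of the resolvent, where a
  functional is governed by the extended resolvent, and the defect space. The range of the extended
  relation is identified in this way.\<close>

lemma dom_adj_decomposition:
  assumes z: "z \<in> \<rho>" and h: "(h, h') \<in> As"
  shows "\<exists>\<xi>. h = R z (h' - z *\<^sub>C h) + \<gamma> z \<xi>"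
proof -
  let ?g = "R z (h' - z *\<^sub>C h)"
  have "(h - ?g, h' - (h' - z *\<^sub>C h + z *\<^sub>C ?g)) \<in> As"
    by (rule csubspace_diffD[OF csubspace_rel_adj h R_in_As[OF z]])
  moreover have "h' - (h' - z *\<^sub>C h + z *\<^sub>C ?g) = z *\<^sub>C (h - ?g)"
    by (simp add: complex_vec.scale_right_diff_distrib)
  ultimately have "\<gamma> z (\<Gamma>0 (h - ?g, z *\<^sub>C (h - ?g))) = h - ?g" using gamma_\<Gamma>0[OF z] by simp
  then show ?thesis by (metis add.commute diff_add_cancel)
qed

lemma weyl_identity:
  assumes z: "z \<in> \<rho>" and w: "w \<in> \<rho>"
  shows "cinner (\<Gamma>1 (gamma_hat A \<Gamma>0 z \<xi>)) \<eta> - cinner \<xi> (\<Gamma>1 (gamma_hat A \<Gamma>0 w \<eta>)) =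
    (z - cnj w) * cinner (\<gamma> z \<xi>) (\<gamma> w \<eta>)"
  using green[OF gamma_in_As[OF z, of \<xi>] gamma_in_As[OF w, of \<eta>]]
  by (simp add: gamma_hat_eq[OF z] gamma_hat_eq[OF w] \<Gamma>0_gamma[OF z] \<Gamma>0_gamma[OF w] cinner_simps
      left_diff_distrib)

subsection \<open>The extended resolvent\<close>

text \<open>The resolvent at cnj z is bounded into \<open>H_plus A\<close>, so composing it with F
  gives a bounded conjugate-linear functional on the Hilbert space, which has a representing
  vector.\<close>

lemma cinner_Rt:
  assumes z: "z \<in> \<rho>" and F: "F \<in> H_minus A"
  shows "cinner (Rt z F) g = F (R (cnj z) g)"
  unfolding ext_resolvent_def
proof (rule cinner_adj_minus)
  note z' = cnj_in_\<rho>[OF z]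
  obtain C where C: "\<And>h. h \<in> H_plus A \<Longrightarrow> cmod (F h) \<le> C * norm_plus A h"
    using F unfolding H_minus_def by blast
  obtain K where K: "\<And>g. norm (R (cnj z) g) \<le> norm g * K"
    using bounded_linear.bounded[OF bounded_linear_resolvent[OF z']] by blast
  show "\<exists>u. \<forall>g. cinner u g = F (R (cnj z) g)"
  proof (rule riesz_representation)
    \<comment> \<open>K bounds the resolvent, hence the first component, and 1 + |z| K bounds the
      second. The bound C of the functional might be negative, hence its absolute value.\<close>
    show "cmod (F (R (cnj z) g)) \<le> \<bar>C\<bar> * (K + (1 + cmod z * K)) * norm g" for g
    proof -
      let ?r = "R (cnj z) g"
      have "norm_plus A ?r \<le> norm ?r + norm (g + cnj z *\<^sub>C ?r)"
        by (rule norm_plus_dom_adj_le[OF csubspace_A symmetric_A R_in_As[OF z']])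
      also have "\<dots> \<le> norm ?r + (norm g + cmod z * norm ?r)"
        using norm_triangle_ineq[of g "cnj z *\<^sub>C ?r"] by (simp add: norm_scaleC)
      also have "\<dots> \<le> norm g * K + (norm g + cmod z * (norm g * K))"
        by (intro add_mono mult_left_mono K) auto
      finally have np: "norm_plus A ?r \<le> (K + (1 + cmod z * K)) * norm g" by (simp add: algebra_simps)
      have hp: "?r \<in> H_plus A" by (rule R_in_H_plus[OF z'])
      have "0 \<le> norm_plus A ?r"
        using norm_le_norm_plus[OF csubspace_A symmetric_A hp] norm_ge_zero order_trans by blast
      then have "C * norm_plus A ?r \<le> \<bar>C\<bar> * norm_plus A ?r" by (intro mult_right_mono) auto
      also have "\<dots> \<le> \<bar>C\<bar> * ((K + (1 + cmod z * K)) * norm g)" using np by (intro mult_left_mono) auto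
      finally show ?thesis using C[OF hp] by (simp add: mult.assoc)
    qed
  qed (simp_all add: resolvent_add[OF z'] resolvent_scaleC[OF z'] R_in_H_plus[OF z']
      H_minus_addD[OF F] H_minus_scaleD[OF F])
qed

text \<open>The resolvent identity survives the extension, with the ordinary resolvent at z acting
  on a vector of the Hilbert space. This is why differences of extended resolvents lie in
  \<open>H_plus A\<close> although single values need not.\<close>

lemma Rt_diff:
  assumes z: "z \<in> \<rho>" and w: "w \<in> \<rho>" and F: "F \<in> H_minus A"
  shows "Rt z F - Rt w F = (z - w) *\<^sub>C R z (Rt w F)"
proof (rule cinner_eqI)
  fix g
  note z' = cnj_in_\<rho>[OF z] and w' = cnj_in_\<rho>[OF w]
  \<comment> \<open>The factor at cnj w has to stand outside: F meets it there and turns it into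
    \<open>Rt w F\<close>, while the inner factor at cnj z moves to the other side as the resolvent
    at z.\<close>
  have "R (cnj z) g = R (cnj w) g + (-(cnj w - cnj z)) *\<^sub>C R (cnj w) (R (cnj z) g)"
    using resolvent_identity[OF csubspace_A0 w' z', of g]
    by (simp add: complex_vec.scale_minus_left algebra_simps)
  then have "F (R (cnj z) g) = F (R (cnj w) g) + (z - w) * F (R (cnj w) (R (cnj z) g))"
    using H_minus_addD[OF F R_in_H_plus[OF w'] H_plus_scaleC[OF csubspace_A symmetric_A R_in_H_plus[OF w']]]
      H_minus_scaleD[OF F R_in_H_plus[OF w']]
    by (metis complex_cnj_cnj complex_cnj_diff minus_diff_eq)
  then show "cinner (Rt z F - Rt w F) g = cinner ((z - w) *\<^sub>C R z (Rt w F)) g"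
    by (simp add: cinner_simps cinner_Rt z w F R_adjoint)
qed

lemma Rt_add: "z \<in> \<rho> \<Longrightarrow> F \<in> H_minus A \<Longrightarrow> F' \<in> H_minus A \<Longrightarrow> Rt z (F + F') = Rt z F + Rt z F'"
  by (rule cinner_eqI) (simp add: cinner_Rt H_minus_add[OF csubspace_A symmetric_A] cinner_simps)

lemma Rt_scaleC: "z \<in> \<rho> \<Longrightarrow> F \<in> H_minus A \<Longrightarrow> Rt z (c *\<^sub>C F) = c *\<^sub>C Rt z F"
  by (rule cinner_eqI)
    (simp add: cinner_Rt H_minus_scaleC[OF csubspace_A symmetric_A] cinner_simps,
      simp add: scaleC_fun_def scaleC_complex_def)

lemma Rt_diff_in_H_plus: "z \<in> \<rho> \<Longrightarrow> w \<in> \<rho> \<Longrightarrow> F \<in> H_minus A \<Longrightarrow> Rt z F - Rt w F \<in> H_plus A"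
  by (simp add: Rt_diff H_plus_scaleC[OF csubspace_A symmetric_A] R_in_H_plus)

lemma i_in_\<rho>: "\<i> \<in> \<rho>" "- \<i> \<in> \<rho>"
  by (simp_all add: nonreal_in_\<rho>)

text \<open>Taking adjoints interchanges i and -i, which leaves their mean unchanged. Splitting the
  value at z into two halves exhibits a mean of differences, each of them in
  \<open>H_plus A\<close>.\<close>

lemma reg_ext_resolvent_eq:
  assumes z: "z \<in> \<rho>" and F: "F \<in> H_minus A"
  shows "reg_ext_resolvent A0 z F = (1/2) *\<^sub>C ((Rt z F - Rt \<i> F) + (Rt z F - Rt (- \<i>) F))"
proof -
  have "reg_term A0 F = (1/2) *\<^sub>C (Rt \<i> F + Rt (- \<i>) F)"
    unfolding reg_term_def
  proof (rule adj_minus_eqI)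
    fix g
    have "F ((1/2) *\<^sub>C (R \<i> g + R (- \<i>) g)) = 1/2 * (F (R \<i> g) + F (R (- \<i>) g))"
      using H_minus_scaleD[OF F H_plus_add[OF csubspace_A symmetric_A R_in_H_plus[OF i_in_\<rho>(1)] R_in_H_plus[OF i_in_\<rho>(2)]]]
        H_minus_addD[OF F R_in_H_plus[OF i_in_\<rho>(1)] R_in_H_plus[OF i_in_\<rho>(2)]]
      by simp
    then show "cinner ((1/2) *\<^sub>C (Rt \<i> F + Rt (- \<i>) F)) g = F ((1/2) *\<^sub>C (R \<i> g + R (- \<i>) g))"
      using cinner_Rt[OF i_in_\<rho>(1) F, of g] cinner_Rt[OF i_in_\<rho>(2) F, of g]
      by (simp add: cinner_simps algebra_simps)
  qed
  then have "reg_ext_resolvent A0 z F = (1/2) *\<^sub>C (Rt z F + Rt z F) - (1/2) *\<^sub>C (Rt \<i> F + Rt (- \<i>) F)"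
    by (simp only: reg_ext_resolvent_def scaleC_half_add)
  also have "\<dots> = (1/2) *\<^sub>C ((Rt z F + Rt z F) - (Rt \<i> F + Rt (- \<i>) F))"
    by (rule complex_vec.scale_right_diff_distrib[symmetric])
  also have "(Rt z F + Rt z F) - (Rt \<i> F + Rt (- \<i>) F) = (Rt z F - Rt \<i> F) + (Rt z F - Rt (- \<i>) F)"
    by simp
  finally show ?thesis .
qed

text \<open>\<open>\<langle>F', Rt z F - Rt w F\<rangle>\<close> plays the role of a difference of values of the
  (undefined) form \<open>\<langle>F', Rt z F\<rangle>\<close>.\<close>

lemma
  assumes z: "z \<in> \<rho>" and w: "w \<in> \<rho>" and F: "F \<in> H_minus A" and F': "F' \<in> H_minus A"
  shows pairing_Rt_diff: "cnj (F' (Rt z F - Rt w F)) = (z - w) * cinner (Rt w F) (Rt (cnj z) F')"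
    and pairing_Rt_diff_swap: "F (Rt (cnj z) F' - Rt (cnj w) F') = cnj (F' (Rt z F - Rt w F))"
proof -
  have pr: "cnj (F' (Rt z F - Rt w F)) = (z - w) * cinner (Rt w F) (Rt (cnj z) F')"
    if "z \<in> \<rho>" "w \<in> \<rho>" "F \<in> H_minus A" "F' \<in> H_minus A" for z w F F'
  proof -
    have "F' (Rt z F - Rt w F) = cnj (z - w) * F' (R z (Rt w F))"
      using that by (simp add: Rt_diff H_minus_scaleD R_in_H_plus)
    also have "F' (R z (Rt w F)) = cinner (Rt (cnj z) F') (Rt w F)"
      using that by (simp add: cinner_Rt cnj_in_\<rho>)
    finally show ?thesis by (simp flip: cinner_commute)
  qed
  show "cnj (F' (Rt z F - Rt w F)) = (z - w) * cinner (Rt w F) (Rt (cnj z) F')"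
    using pr assms .
  have "F (Rt (cnj z) F' - Rt (cnj w) F') = F ((-1) *\<^sub>C (Rt (cnj w) F' - Rt (cnj z) F'))"
    by (simp add: complex_vec.scale_minus_left scaleC_one)
  also have "\<dots> = - F (Rt (cnj w) F' - Rt (cnj z) F')"
    using assms by (simp only: H_minus_scaleD Rt_diff_in_H_plus cnj_in_\<rho>) simp
  \<comment> \<open>The first identity, used at (cnj w, cnj z) with the functionals exchanged, leads
    to the same inner product up to conjugation and sign.\<close>
  also have "F (Rt (cnj w) F' - Rt (cnj z) F') = cnj ((cnj w - cnj z) * cinner (Rt (cnj z) F') (Rt w F))"
    using pr[OF cnj_in_\<rho>[OF w] cnj_in_\<rho>[OF z] F' F] by (metis complex_cnj_cnj)
  also have "\<dots> = (w - z) * cinner (Rt w F) (Rt (cnj z) F')"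
    by (simp flip: cinner_commute)
  finally show "F (Rt (cnj z) F' - Rt (cnj w) F') = cnj (F' (Rt z F - Rt w F))"
    using pr[OF assms] by (simp only:) (simp add: algebra_simps)
qed

lemma pairing_Rt_diff_trans:
  assumes "z \<in> \<rho>" "w \<in> \<rho>" "v \<in> \<rho>" and F: "F \<in> H_minus A" "F' \<in> H_minus A"
  shows "F' (Rt z F - Rt w F) + F' (Rt w F - Rt v F) = F' (Rt z F - Rt v F)"
  using H_minus_addD[OF F(2) Rt_diff_in_H_plus Rt_diff_in_H_plus, of z w F w v F] assms by simp

lemma reg_ext_resolvent_pairing:
  assumes z: "z \<in> \<rho>" and F: "F \<in> H_minus A" "F' \<in> H_minus A"
  shows "F' (reg_ext_resolvent A0 z F) = 1/2 * (F' (Rt z F - Rt \<i> F) + F' (Rt z F - Rt (- \<i>) F))"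
proof -
  have "Rt z F - Rt \<i> F \<in> H_plus A" "Rt z F - Rt (- \<i>) F \<in> H_plus A"
    using Rt_diff_in_H_plus z i_in_\<rho> F(1) by blast+
  then show ?thesis
    unfolding reg_ext_resolvent_eq[OF z F(1)]
    by (simp only: H_minus_scaleD[OF F(2)] H_minus_addD[OF F(2)] H_plus_add[OF csubspace_A symmetric_A]) simp
qed

text \<open>\<open>q a b\<close> behaves like s(a) - s(b) for a form s that does not exist by
  itself. The base points i and -i for z become -i and i for w, so they cancel and leave
  \<open>q z (cnj w)\<close>.\<close>

lemma reg_ext_resolvent_identity:
  assumes z: "z \<in> \<rho>" and w: "w \<in> \<rho>" and F: "F \<in> H_minus A" "F' \<in> H_minus A"
  shows "cnj (F' (reg_ext_resolvent A0 z F)) - F (reg_ext_resolvent A0 w F') =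
    (z - cnj w) * cinner (Rt z F) (Rt w F')"
proof -
  note w' = cnj_in_\<rho>[OF w]
  define q where "q a b = cnj (F' (Rt a F - Rt b F))" for a b
  have tr: "q a b + q b c = q a c" if "a \<in> \<rho>" "b \<in> \<rho>" "c \<in> \<rho>" for a b c
    unfolding q_def using pairing_Rt_diff_trans[OF that F] by (metis complex_cnj_add)
  have sw: "F (Rt w F' - Rt b F') = q (cnj w) (cnj b)" if "b \<in> \<rho>" for b
    using pairing_Rt_diff_swap[OF w' cnj_in_\<rho>[OF that] F] by (simp add: q_def)
  have "cnj (F' (reg_ext_resolvent A0 z F)) = 1/2 * (q z \<i> + q z (- \<i>))"
    by (simp add: reg_ext_resolvent_pairing[OF z F] q_def)
  moreover have "F (reg_ext_resolvent A0 w F') = 1/2 * (q (cnj w) (- \<i>) + q (cnj w) \<i>)"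
    using sw[OF i_in_\<rho>(1)] sw[OF i_in_\<rho>(2)]
    by (simp add: reg_ext_resolvent_pairing[OF w F(2,1)])
  moreover have "q z \<i> = q z (cnj w) + q (cnj w) \<i>" "q z (- \<i>) = q z (cnj w) + q (cnj w) (- \<i>)"
    using tr[OF z w'] i_in_\<rho> by simp_all
  ultimately have "cnj (F' (reg_ext_resolvent A0 z F)) - F (reg_ext_resolvent A0 w F') = q z (cnj w)"
    by (simp only:) (simp add: field_simps)
  \<comment> \<open>With cnj w in the first place, the factorization of the pairing produces the
    extended resolvents at z and w.\<close>
  moreover have "q z (cnj w) = - q (cnj w) z"
    using tr[OF z w' z] H_minus_scaleD[OF F(2), of "Rt z F - Rt z F" 0] Rt_diff_in_H_plus[OF z z F(1)]
    by (simp add: q_def eq_neg_iff_add_eq_0)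
  moreover have "q (cnj w) z = (cnj w - z) * cinner (Rt z F) (Rt w F')"
    using pairing_Rt_diff[OF w' z F] by (simp add: q_def)
  ultimately show ?thesis by (simp add: algebra_simps)
qed

lemma pairing_gamma_diff:
  assumes z: "z \<in> \<rho>" and w: "w \<in> \<rho>" and F: "F \<in> H_minus A"
  shows "F (\<gamma> (cnj z) \<xi>) - F (\<gamma> w \<xi>) = (z - cnj w) * cinner (Rt z F) (\<gamma> w \<xi>)"
proof -
  note z' = cnj_in_\<rho>[OF z]
  have "F (\<gamma> (cnj z) \<xi>) = F (\<gamma> w \<xi> + (cnj z - w) *\<^sub>C R (cnj z) (\<gamma> w \<xi>))"
    using gamma_diff[OF z' w, of \<xi>] by (metis add.commute diff_add_cancel)
  also have "\<dots> = F (\<gamma> w \<xi>) + (z - cnj w) * F (R (cnj z) (\<gamma> w \<xi>))"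
    using H_minus_addD[OF F gamma_in_H_plus[OF w] H_plus_scaleC[OF csubspace_A symmetric_A R_in_H_plus[OF z']]]
      H_minus_scaleD[OF F R_in_H_plus[OF z']] by simp
  finally show ?thesis by (simp add: cinner_Rt[OF z F])
qed

text \<open>A functional that vanishes on the defect space at cnj z is determined on the domain of
  the adjoint by its values on the range of the resolvent, that is, by \<open>Rt z F\<close>. This
  vector serves as the first component of the required pair.\<close>

lemma ext_ran_iff:
  assumes z: "z \<in> \<rho>"
  shows "F \<in> ext_ran A z \<longleftrightarrow> F \<in> H_minus A \<and> (\<forall>\<xi>. F (\<gamma> (cnj z) \<xi>) = 0)"
proof (intro iffI conjI allI)
  note z' = cnj_in_\<rho>[OF z]
  {
    assume "F \<in> ext_ran A z"
    then obtain f G where G: "F = G - z *\<^sub>C embed_minus A f" "G \<in> H_minus A"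
      "\<And>h h'. (h, h') \<in> As \<Longrightarrow> G h = cinner f h'"
      unfolding ext_ran_def ext_rel_def by blast
    show "F \<in> H_minus A"
      unfolding G(1) by (intro H_minus_diff H_minus_scaleC embed_minus_in_H_minus G csubspace_A symmetric_A)
    fix \<xi>
    show "F (\<gamma> (cnj z) \<xi>) = 0"
      using G(3)[OF gamma_in_As[OF z', of \<xi>]] gamma_in_H_plus[OF z', of \<xi>]
      by (simp add: G(1) embed_minus_def scaleC_fun_def scaleC_complex_def cinner_simps)
  }
  assume "F \<in> H_minus A \<and> (\<forall>\<xi>. F (\<gamma> (cnj z) \<xi>) = 0)"
  then have F: "F \<in> H_minus A" and F0: "\<And>\<xi>. F (\<gamma> (cnj z) \<xi>) = 0" by auto
  define f where "f = Rt z F"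
  \<comment> \<open>\<open>G\<close> is forced by F = G - z f. Since F(h) turns out to be (f, h' -
    cnj z h) = (f, h') - z (f, h), adding z f leaves the condition that defines
    \<open>ext_rel A\<close>.\<close>
  define G where "G = F + z *\<^sub>C embed_minus A f"
  have "(f, G) \<in> ext_rel A"
    unfolding ext_rel_def
  proof (intro CollectI case_prodI conjI ballI case_prodI2)
    show "G \<in> H_minus A"
      unfolding G_def by (intro H_minus_add H_minus_scaleC embed_minus_in_H_minus F csubspace_A symmetric_A)
    fix x h h' assume "x \<in> As" "x = (h, h')"
    then have h: "(h, h') \<in> As" by simp
    obtain \<xi> where \<xi>: "h = R (cnj z) (h' - cnj z *\<^sub>C h) + \<gamma> (cnj z) \<xi>"
      using dom_adj_decomposition[OF z' h] by blast
    have "F h = F (R (cnj z) (h' - cnj z *\<^sub>C h))"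
      using H_minus_addD[OF F R_in_H_plus[OF z'] gamma_in_H_plus[OF z']] F0 \<xi> by (metis add.right_neutral)
    also have "\<dots> = cinner f h' - z * cinner f h"
      using cinner_Rt[OF z F, symmetric] by (simp add: f_def cinner_simps)
    finally show "G h = cinner f h'"
      using dom_adj_in_H_plus[OF csubspace_A symmetric_A h]
      by (simp add: G_def embed_minus_def scaleC_fun_def scaleC_complex_def)
  qed
  then show "F \<in> ext_ran A z"
    unfolding ext_ran_def G_def by force
qed

end

section \<open>Complex matrices\<close>

lemma scaleC_vec_eq: "c *\<^sub>C (x :: complex ^ 'n) = c *s x"
  by (simp add: vec_eq_iff scaleC_vec_def scaleC_complex_def)

lemma cinner_vec_complex: "cinner (x :: complex ^ 'n) y = (\<Sum>i\<in>UNIV. x $ i * cnj (y $ i))"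
  by (simp add: cinner_vec_def cinner_complex_def)

lemma matrix_scaleC_vector: "(c *\<^sub>C (X :: complex ^ 'n ^ 'm)) *v x = c *\<^sub>C (X *v x)"
  by (simp add: vec_eq_iff matrix_vector_mult_def scaleC_vec_def scaleC_complex_def sum_distrib_left mult.assoc)

lemma scaleC_matrix_mult_left: "(c *\<^sub>C (X :: complex ^ 'n ^ 'm)) ** Y = c *\<^sub>C (X ** Y)"
  by (simp add: vec_eq_iff matrix_matrix_mult_def scaleC_vec_def scaleC_complex_def sum_distrib_left mult.assoc)

lemma scaleC_matrix_mult_right: "(X :: complex ^ 'n ^ 'm) ** (c *\<^sub>C Y) = c *\<^sub>C (X ** Y)"
  by (simp add: vec_eq_iff matrix_matrix_mult_def scaleC_vec_def scaleC_complex_def sum_distrib_left mult_ac)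

lemma matrix_vector_mult_axis: "((X :: complex ^ 'n ^ 'm) *v axis j 1) $ i = X $ i $ j"
  by (simp add: matrix_vector_mult_def axis_def if_distrib cong: if_cong)

lemma matrix_add_mult: "((X :: complex ^ 'n ^ 'm) + X') ** Y = X ** Y + X' ** Y"
  by (simp add: vec_eq_iff matrix_matrix_mult_def distrib_right sum.distrib)

lemma matrix_minus_mult: "(- (X :: complex ^ 'n ^ 'm)) ** Y = - (X ** Y)"
  by (simp add: vec_eq_iff matrix_matrix_mult_def sum_negf)

lemma matrix_mult_minus: "(X :: complex ^ 'n ^ 'm) ** (- Y) = - (X ** Y)"
  by (simp add: vec_eq_iff matrix_matrix_mult_def sum_negf)

lemma matrix_diff_mult: "((X :: complex ^ 'n ^ 'm) - X') ** Y = X ** Y - X' ** Y"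
  by (simp add: vec_eq_iff matrix_matrix_mult_def left_diff_distrib sum_subtractf)

lemma matrix_mult_diff: "(X :: complex ^ 'n ^ 'm) ** (Y - Y') = X ** Y - X ** Y'"
  by (simp add: vec_eq_iff matrix_matrix_mult_def right_diff_distrib sum_subtractf)

lemma matrix_clinear:
  fixes f :: "complex ^ 'n \<Rightarrow> complex ^ 'm"
  assumes "\<And>x y. f (x + y) = f x + f y" and "\<And>c x. f (c *\<^sub>C x) = c *\<^sub>C f x"
  shows "matrix f *v x = f x"
proof -
  have "Vector_Spaces.linear (*s) (*s) f"
    using assms by unfold_locales (simp_all add: scaleC_vec_eq)
  then show ?thesis by (rule matrix_works)
qed

lemma cinner_matrix_left: "cinner ((X :: complex ^ 'n ^ 'm) *v x) y = cinner x (cadj X *v y)"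
  unfolding cinner_vec_complex matrix_vector_mult_def cadj_def
  by (simp add: sum_distrib_left sum_distrib_right mult_ac) (rule sum.swap)

lemma cadj_cadj [simp]: "cadj (cadj X) = X"
  by (simp add: cadj_def vec_eq_iff)

lemma cinner_cadj_left: "cinner (cadj (X :: complex ^ 'n ^ 'm) *v x) y = cinner x (X *v y)"
  by (simp add: cinner_matrix_left)

lemma cadj_mult: "cadj ((X :: complex ^ 'n ^ 'm) ** Y) = cadj Y ** cadj X"
  by (simp add: cadj_def vec_eq_iff matrix_matrix_mult_def mult.commute)

lemma cadj_add: "cadj (X + Y) = cadj X + cadj Y"
  by (simp add: cadj_def vec_eq_iff)

lemma cadj_diff: "cadj (X - Y) = cadj X - cadj Y"
  by (simp add: cadj_def vec_eq_iff)

lemma cadj_minus: "cadj (- X) = - cadj X"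
  by (simp add: cadj_def vec_eq_iff)

lemma cadj_0 [simp]: "cadj 0 = 0"
  by (simp add: cadj_def vec_eq_iff)

lemma cadj_mat_1 [simp]: "cadj (mat 1) = mat 1"
  by (auto simp: cadj_def vec_eq_iff mat_def)

lemma matrix_eq_cinnerI:
  fixes X Y :: "complex ^ 'n ^ 'm"
  assumes "\<And>x y. cinner (X *v x) y = cinner (Y *v x) y"
  shows "X = Y"
  using assms cinner_eqI by (metis matrix_eq)

lemma riesz_representation_vec:
  fixes f :: "complex ^ 'n \<Rightarrow> complex"
  assumes add: "\<And>x y. f (x + y) = f x + f y" and scale: "\<And>c x. f (c *\<^sub>C x) = cnj c * f x"
  shows "\<exists>u. \<forall>g. cinner u g = f g"
proof (intro exI allI)
  fix g
  have f0: "f 0 = 0" using add[of 0 0] by simp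
  have fsum: "f (\<Sum>i\<in>I. h i) = (\<Sum>i\<in>I. f (h i))" for I :: "'n set" and h
    by (induction I rule: infinite_finite_induct) (simp_all add: add f0)
  have "f g = f (\<Sum>i\<in>UNIV. g $ i *s axis i 1)" by (simp add: basis_expansion)
  also have "\<dots> = (\<Sum>i\<in>UNIV. cnj (g $ i) * f (axis i 1))"
    by (simp add: fsum scale flip: scaleC_vec_eq)
  finally show "cinner (\<chi> i. f (axis i 1)) g = f g"
    by (simp add: cinner_vec_complex mult.commute)
qed

lemma
  fixes X :: "complex ^ 'n ^ 'n"
  assumes "invertible X"
  shows matrix_inv_right: "X ** matrix_inv X = mat 1"
    and matrix_inv_left: "matrix_inv X ** X = mat 1"
  using someI_ex[of "\<lambda>Y. X ** Y = mat 1 \<and> Y ** X = mat 1"] assms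
  by (auto simp: invertible_def matrix_inv_def)

lemma
  fixes X :: "complex ^ 'n ^ 'n"
  assumes "invertible X"
  shows matrix_inv_vector_right: "X *v (matrix_inv X *v x) = x"
    and matrix_inv_vector_left: "matrix_inv X *v (X *v x) = x"
  using assms by (simp_all add: matrix_vector_mul_assoc matrix_inv_left matrix_inv_right)

lemma matrix_inv_eqI:
  fixes X :: "complex ^ 'n ^ 'n"
  assumes "X ** Y = mat 1"
  shows "invertible X" and "matrix_inv X = Y"
proof -
  show inv: "invertible X" using assms by (metis invertible_def matrix_left_right_inverse)
  have "matrix_inv X = matrix_inv X ** (X ** Y)" by (simp add: assms)
  also have "\<dots> = Y" by (simp add: matrix_mul_assoc matrix_inv_left[OF inv])
  finally show "matrix_inv X = Y" .
qed

lemma invertible_iff_ker: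
  fixes X :: "complex ^ 'n ^ 'n"
  shows "invertible X \<longleftrightarrow> (\<forall>x. X *v x = 0 \<longrightarrow> x = 0)"
  unfolding invertible_left_inverse matrix_left_invertible_ker ..

text \<open>B minus its adjoint, divided by 2i, has the imaginary part of the form of B as its
  quadratic form. The matrix condition on a family thus becomes a scalar inequality to be tested on
  vectors.\<close>

lemma psd_imaginary_part:
  "psd (complex_of_real t *\<^sub>C (1 / (2 * \<i>)) *\<^sub>C (B - cadj B)) \<longleftrightarrow> (\<forall>u. 0 \<le> t * Im (cinner (B *v u) u))"
proof -
  have "cinner ((complex_of_real t *\<^sub>C (1 / (2 * \<i>)) *\<^sub>C (B - cadj B)) *v u) u
      = of_real (t * Im (cinner (B *v u) u))" for u
  proof -
    have "cinner (cadj B *v u) u = cnj (cinner (B *v u) u)"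
      by (metis cinner_cadj_left cinner_commute)
    then have "cinner ((B - cadj B) *v u) u = 2 * \<i> * of_real (Im (cinner (B *v u) u))"
      by (simp add: matrix_vector_mult_diff_rdistrib cinner_diff_left complex_diff_cnj mult.commute)
    then show ?thesis
      by (simp only: matrix_scaleC_vector cinner_scaleC_left) simp
  qed
  then show ?thesis by (simp add: psd_def)
qed

subsection \<open>Block matrices\<close>

definition vec_join :: "complex ^ 'p \<Rightarrow> complex ^ 'p \<Rightarrow> complex ^ ('p + 'p)" where
  "vec_join u v = (\<chi> i. case i of Inl k \<Rightarrow> u $ k | Inr k \<Rightarrow> v $ k)"

lemma vec_join_exhaust: obtains u v where "x = vec_join u v"
proof
  show "x = vec_join (\<chi> k. x $ Inl k) (\<chi> k. x $ Inr k)"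
    by (simp add: vec_eq_iff vec_join_def split: sum.split)
qed

lemma sum_UNIV_Plus:
  fixes f :: "'p :: finite + 'q :: finite \<Rightarrow> 'a :: comm_monoid_add"
  shows "(\<Sum>i\<in>UNIV. f i) = (\<Sum>k\<in>UNIV. f (Inl k)) + (\<Sum>k\<in>UNIV. f (Inr k))"
  by (simp add: sum.Plus flip: UNIV_Plus_UNIV)

lemma forall_Plus: "(\<forall>i. P i) \<longleftrightarrow> (\<forall>k. P (Inl k)) \<and> (\<forall>k. P (Inr k))"
  by (metis sum.exhaust)

lemma vec_join_nth [simp]: "vec_join u v $ Inl k = u $ k" "vec_join u v $ Inr k = v $ k"
  by (simp_all add: vec_join_def)

lemma block_nth [simp]:
  "block a b c d $ Inl k $ Inl l = a $ k $ l" "block a b c d $ Inl k $ Inr l = b $ k $ l"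
  "block a b c d $ Inr k $ Inl l = c $ k $ l" "block a b c d $ Inr k $ Inr l = d $ k $ l"
  by (simp_all add: block_def)

lemma block_mult_vec_join:
  "block a b c d *v vec_join u v = vec_join (a *v u + b *v v) (c *v u + d *v v)"
  by (simp add: vec_eq_iff forall_Plus matrix_vector_mult_def sum_UNIV_Plus)

lemma cinner_vec_join: "cinner (vec_join u v) (vec_join u' v') = cinner u u' + cinner v v'"
  by (simp add: cinner_vec_complex sum_UNIV_Plus)

lemma block_mult:
  "block a b c d ** block a' b' c' d' =
    block (a ** a' + b ** c') (a ** b' + b ** d') (c ** a' + d ** c') (c ** b' + d ** d')"
  by (simp add: vec_eq_iff forall_Plus matrix_matrix_mult_def sum_UNIV_Plus)

lemma block_diff: "block a b c d - block a' b' c' d' = block (a - a') (b - b') (c - c') (d - d')"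
  by (simp add: vec_eq_iff forall_Plus)

lemma block_minus: "- block a b c d = block (- a) (- b) (- c) (- d)"
  by (simp add: vec_eq_iff forall_Plus)

lemma cadj_block: "cadj (block a b c d) = block (cadj a) (cadj c) (cadj b) (cadj d)"
  by (simp add: vec_eq_iff forall_Plus cadj_def)

lemma block_mat_1: "block (mat 1) 0 0 (mat 1) = (mat 1 :: complex ^ ('p :: finite + 'p) ^ ('p + 'p))"
  by (simp add: vec_eq_iff forall_Plus mat_def)

lemma block_components [simp]:
  "block11 (block a b c d) = a" "block12 (block a b c d) = b"
  "block21 (block a b c d) = c" "block22 (block a b c d) = d"
  by (simp_all add: vec_eq_iff block11_def block12_def block21_def block22_def)

lemma block_eta: "block (block11 X) (block12 X) (block21 X) (block22 X) = X"
  by (simp add: vec_eq_iff forall_Plus block11_def block12_def block21_def block22_def)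

lemma block_components_cadj:
  "block11 (cadj X) = cadj (block11 X)" "block12 (cadj X) = cadj (block21 X)"
  "block21 (cadj X) = cadj (block12 X)" "block22 (cadj X) = cadj (block22 X)"
  by (simp_all add: vec_eq_iff cadj_def block11_def block12_def block21_def block22_def)

subsection \<open>Holomorphic matrix functions\<close>

lemma holomorphic_matrix_on_const [intro]: "holomorphic_matrix_on (\<lambda>_. X) S"
  by (simp add: holomorphic_matrix_on_def)

lemma holomorphic_matrix_on_subset:
  "holomorphic_matrix_on X S \<Longrightarrow> T \<subseteq> S \<Longrightarrow> holomorphic_matrix_on X T"
  unfolding holomorphic_matrix_on_def using holomorphic_on_subset by blast

lemma holomorphic_matrix_on_add [intro]:
  "holomorphic_matrix_on X S \<Longrightarrow> holomorphic_matrix_on Y S \<Longrightarrow> holomorphic_matrix_on (\<lambda>z. X z + Y z) S"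
  by (simp add: holomorphic_matrix_on_def holomorphic_on_add)

lemma holomorphic_matrix_on_diff [intro]:
  "holomorphic_matrix_on X S \<Longrightarrow> holomorphic_matrix_on Y S \<Longrightarrow> holomorphic_matrix_on (\<lambda>z. X z - Y z) S"
  by (simp add: holomorphic_matrix_on_def holomorphic_on_diff)

lemma holomorphic_matrix_on_mult [intro]:
  "holomorphic_matrix_on X S \<Longrightarrow> holomorphic_matrix_on Y S \<Longrightarrow> holomorphic_matrix_on (\<lambda>z. X z ** Y z) S"
  unfolding holomorphic_matrix_on_def matrix_matrix_mult_def
  by (auto intro!: holomorphic_on_sum holomorphic_on_mult)

lemma holomorphic_matrix_on_block [intro]:
  assumes "holomorphic_matrix_on a S" "holomorphic_matrix_on b S"
    "holomorphic_matrix_on c S" "holomorphic_matrix_on d S"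
  shows "holomorphic_matrix_on (\<lambda>z. block (a z) (b z) (c z) (d z)) S"
  using assms unfolding holomorphic_matrix_on_def forall_Plus by simp

lemma holomorphic_matrix_on_block_components [intro]:
  assumes "holomorphic_matrix_on X S"
  shows "holomorphic_matrix_on (\<lambda>z. block11 (X z)) S" "holomorphic_matrix_on (\<lambda>z. block12 (X z)) S"
    "holomorphic_matrix_on (\<lambda>z. block21 (X z)) S" "holomorphic_matrix_on (\<lambda>z. block22 (X z)) S"
  using assms
  by (simp_all add: holomorphic_matrix_on_def block11_def block12_def block21_def block22_def)

lemma holomorphic_on_det:
  fixes X :: "complex \<Rightarrow> complex ^ 'n ^ 'n"
  assumes "holomorphic_matrix_on X S"
  shows "(\<lambda>z. det (X z)) holomorphic_on S"
  using assms unfolding det_def holomorphic_matrix_on_def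
  by (intro holomorphic_on_sum holomorphic_on_mult holomorphic_on_prod holomorphic_on_const) auto

text \<open>Cramer's rule writes each entry of the inverse as a quotient of determinants, which are
  polynomials in the entries.\<close>

lemma holomorphic_matrix_on_inv [intro]:
  fixes X :: "complex \<Rightarrow> complex ^ 'n ^ 'n"
  assumes X: "holomorphic_matrix_on X S" and inv: "\<And>z. z \<in> S \<Longrightarrow> invertible (X z)"
  shows "holomorphic_matrix_on (\<lambda>z. matrix_inv (X z)) S"
  unfolding holomorphic_matrix_on_def
proof (intro allI)
  fix i j
  \<comment> \<open>Column i is replaced by the j-th unit vector, so that the quotient of
    determinants is the entry (i, j) of the inverse.\<close>
  let ?C = "\<lambda>z. (\<chi> k l. if l = i then (axis j 1 :: complex ^ 'n) $ k else X z $ k $ l)"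
  have "holomorphic_matrix_on ?C S"
    unfolding holomorphic_matrix_on_def
  proof (intro allI)
    show "(\<lambda>z. ?C z $ k $ l) holomorphic_on S" for k l
      using X by (cases "l = i") (simp_all add: holomorphic_matrix_on_def)
  qed
  then have hol: "(\<lambda>z. det (?C z) / det (X z)) holomorphic_on S"
    using inv by (intro holomorphic_on_divide holomorphic_on_det X) (auto simp: invertible_det_nz)
  have "matrix_inv (X z) $ i $ j = det (?C z) / det (X z)" if "z \<in> S" for z
  proof -
    have "X z *v (matrix_inv (X z) *v axis j 1) = axis j 1"
      by (rule matrix_inv_vector_right[OF inv[OF that]])
    then have "matrix_inv (X z) *v axis j 1 = (\<chi> m. det (\<chi> k l. if l = m then (axis j 1 :: complex ^ 'n) $ k
        else X z $ k $ l) / det (X z))"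
      using inv[OF that] by (subst (asm) cramer) (simp_all add: invertible_det_nz)
    then show ?thesis by (simp add: vec_eq_iff matrix_vector_mult_axis)
  qed
  then show "(\<lambda>z. matrix_inv (X z) $ i $ j) holomorphic_on S"
    by (intro holomorphic_transform[OF hol]) simp
qed

section \<open>The transform of a Nevanlinna function\<close>

lemma resolvent_matrix_factorization:
  fixes Q :: "complex \<Rightarrow> complex ^ ('p :: finite + 'p) ^ ('p + 'p)"
  assumes "invertible (block12 (Q z))"
  defines "X \<equiv> block 0 (block12 (Q z)) (- mat 1) (block22 (Q z))"
  shows "invertible X"
    and "resolvent_matrix Q z = matrix_inv X ** block (mat 1) (block11 (Q z)) 0 (block21 (Q z))"
proof -
  let ?i = "matrix_inv (block12 (Q z))"
  \<comment> \<open>The right inverse comes from solving a12 v = x, -u + a22 v = y for (u,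
    v).\<close>
  have "X ** block (block22 (Q z) ** ?i) (- mat 1) ?i 0 = mat 1"
    unfolding X_def block_mult
    by (simp add: matrix_inv_right[OF assms(1)] matrix_minus_mult matrix_mult_minus flip: block_mat_1)
  note X = matrix_inv_eqI[OF this]
  show "invertible X" by (rule X)
  show "resolvent_matrix Q z = matrix_inv X ** block (mat 1) (block11 (Q z)) 0 (block21 (Q z))"
    by (simp add: X(2) block_mult resolvent_matrix_def Let_def matrix_minus_mult)
qed

text \<open>With W = inverse of X times Y, the difference of X J X* and Y J Y*, starred factors
  taken at \<zeta>, is minus the numerator of the Nevanlinna kernel. This is pure block algebra;
  congruence with the inverse of X turns the first term into J.\<close>

lemma K_kernel_resolvent_matrix:
  fixes Q :: "complex \<Rightarrow> complex ^ ('p :: finite + 'p) ^ ('p + 'p)"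
  assumes inv: "invertible (block12 (Q z))" "invertible (block12 (Q \<zeta>))"
  defines "X \<equiv> (\<lambda>z. block 0 (block12 (Q z)) (- mat 1) (block22 (Q z)))"
  shows "K_kernel (resolvent_matrix Q) \<zeta> z =
    matrix_inv (X z) ** N_kernel Q \<zeta> z ** cadj (matrix_inv (X \<zeta>))"
proof -
  define Y where "Y = (\<lambda>z. block (mat 1) (block11 (Q z)) 0 (block21 (Q z)))"
  define J :: "complex ^ ('p + 'p) ^ ('p + 'p)" where "J = block 0 (- mat 1) (mat 1) 0"
  have Xi: "invertible (X z)" "invertible (X \<zeta>)"
    and W: "resolvent_matrix Q z = matrix_inv (X z) ** Y z"
      "resolvent_matrix Q \<zeta> = matrix_inv (X \<zeta>) ** Y \<zeta>"
    using resolvent_matrix_factorization inv unfolding X_def Y_def by blast+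
  have J': "J_tilde = \<i> *\<^sub>C J" by (simp add: J_tilde_def J_def)
  have XY: "X z ** J ** cadj (X \<zeta>) - Y z ** J ** cadj (Y \<zeta>) = - (Q z - cadj (Q \<zeta>))"
  proof -
    have "X z ** J ** cadj (X \<zeta>) - Y z ** J ** cadj (Y \<zeta>) =
      - (block (block11 (Q z)) (block12 (Q z)) (block21 (Q z)) (block22 (Q z)) -
        cadj (block (block11 (Q \<zeta>)) (block12 (Q \<zeta>)) (block21 (Q \<zeta>)) (block22 (Q \<zeta>))))"
      unfolding X_def Y_def J_def
      by (simp add: block_mult block_diff block_minus cadj_block matrix_minus_mult matrix_mult_minus cadj_minus)
    then show ?thesis by (simp only: block_eta)
  qed
  have cX: "cadj (X \<zeta>) ** cadj (matrix_inv (X \<zeta>)) = mat 1"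
    using matrix_inv_left[OF Xi(2)] by (metis cadj_mult cadj_mat_1)
  have "matrix_inv (X z) ** (X z ** J ** cadj (X \<zeta>)) ** cadj (matrix_inv (X \<zeta>)) =
    (matrix_inv (X z) ** X z) ** J ** (cadj (X \<zeta>) ** cadj (matrix_inv (X \<zeta>)))"
    by (simp only: matrix_mul_assoc)
  then have "J = matrix_inv (X z) ** (X z ** J ** cadj (X \<zeta>)) ** cadj (matrix_inv (X \<zeta>))"
    by (simp add: cX matrix_inv_left[OF Xi(1)])
  moreover have "resolvent_matrix Q z ** J ** cadj (resolvent_matrix Q \<zeta>) =
    matrix_inv (X z) ** (Y z ** J ** cadj (Y \<zeta>)) ** cadj (matrix_inv (X \<zeta>))"
    by (simp add: W cadj_mult matrix_mul_assoc)
  ultimately have "J - resolvent_matrix Q z ** J ** cadj (resolvent_matrix Q \<zeta>) =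
    matrix_inv (X z) ** (X z ** J ** cadj (X \<zeta>) - Y z ** J ** cadj (Y \<zeta>)) ** cadj (matrix_inv (X \<zeta>))"
    by (simp add: matrix_mult_diff matrix_diff_mult)
  also have "\<dots> = (-1) *\<^sub>C (matrix_inv (X z) ** (Q z - cadj (Q \<zeta>)) ** cadj (matrix_inv (X \<zeta>)))"
    unfolding XY by (simp only: matrix_minus_mult matrix_mult_minus complex_vec.scale_minus_left scaleC_one)
  finally have JW: "J - resolvent_matrix Q z ** J ** cadj (resolvent_matrix Q \<zeta>) = \<dots>" .
  have "K_kernel (resolvent_matrix Q) \<zeta> z =
    (1 / (- \<i> * (z - cnj \<zeta>)) * \<i>) *\<^sub>C (J - resolvent_matrix Q z ** J ** cadj (resolvent_matrix Q \<zeta>))"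
    by (simp add: K_kernel_def J' scaleC_matrix_mult_left scaleC_matrix_mult_right
        complex_vec.scale_right_diff_distrib scaleC_scaleC)
  \<comment> \<open>The scalar i / (-i) = -1 cancels the -1 of the block identity. For z = cnj
    \<zeta> both sides are 0 by the convention for division by zero.\<close>
  also have "\<dots> = (1 / (z - cnj \<zeta>)) *\<^sub>C (matrix_inv (X z) ** (Q z - cadj (Q \<zeta>)) ** cadj (matrix_inv (X \<zeta>)))"
    unfolding JW scaleC_scaleC by (simp add: divide_simps)
  finally show ?thesis
    by (simp add: N_kernel_def scaleC_matrix_mult_left scaleC_matrix_mult_right)
qed

text \<open>Solving for the parameter in the first component represents the transformed family as the
  graph of \<open>a22 - a21 \<phi> (a11 \<phi> + \<psi>)\<^sup>-\<^sup>1 a12\<close>, which is holomorphic off the real line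
  even where \<open>a12\<close> is singular.\<close>

theorem nevanlinna_family_transform:
  fixes Q :: "complex \<Rightarrow> complex ^ ('p :: finite + 'p) ^ ('p + 'p)"
  assumes hol: "holomorphic_matrix_on Q (- \<real>)"
    and sym: "\<And>z. z \<notin> \<real> \<Longrightarrow> cadj (Q (cnj z)) = Q z"
    and pos: "\<And>z x. z \<notin> \<real> \<Longrightarrow> 0 \<le> Im z * Im (cinner (Q z *v x) x)"
    and strict: "\<And>z u. z \<notin> \<real> \<Longrightarrow> Im (cinner (block11 (Q z) *v u) u) = 0 \<Longrightarrow> u = 0"
    and \<tau>: "nevanlinna_family \<tau>"
  shows "\<exists>\<tau>'. nevanlinna_family \<tau>' \<and>
    (\<forall>z. z \<notin> \<real> \<and> invertible (block12 (Q z)) \<longrightarrow> lft (resolvent_matrix Q z) (\<tau> z) = \<tau>' z)"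
proof -
  obtain \<phi> \<psi> :: "complex \<Rightarrow> complex ^ 'p ^ 'p" where
    h\<phi>: "holomorphic_matrix_on \<phi> (- \<real>)" and h\<psi>: "holomorphic_matrix_on \<psi> (- \<real>)"
    and nev: "\<forall>z. z \<notin> \<real> \<longrightarrow>
        psd (complex_of_real (Im z) *\<^sub>C (1 / (2 * \<i>)) *\<^sub>C
          (cadj (\<phi> z) ** \<psi> z - cadj (cadj (\<phi> z) ** \<psi> z))) \<and>
        cadj (\<phi> (cnj z)) ** \<psi> z - cadj (\<psi> (cnj z)) ** \<phi> z = 0 \<and>
        {u. \<phi> z *v u = 0} \<inter> {u. \<psi> z *v u = 0} = {0} \<and>
        \<tau> z = {(\<phi> z *v u, \<psi> z *v u) | u. True}"
    using \<tau> unfolding nevanlinna_family_def by (elim exE conjE)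
  have psd: "\<And>z. z \<notin> \<real> \<Longrightarrow> psd (complex_of_real (Im z) *\<^sub>C (1 / (2 * \<i>)) *\<^sub>C
          (cadj (\<phi> z) ** \<psi> z - cadj (cadj (\<phi> z) ** \<psi> z)))"
    and sym\<tau>: "\<And>z. z \<notin> \<real> \<Longrightarrow> cadj (\<phi> (cnj z)) ** \<psi> z - cadj (\<psi> (cnj z)) ** \<phi> z = 0"
    and ker: "\<And>z. z \<notin> \<real> \<Longrightarrow> {u. \<phi> z *v u = 0} \<inter> {u. \<psi> z *v u = 0} = {0}"
    and \<tau>eq: "\<And>z. z \<notin> \<real> \<Longrightarrow> \<tau> z = {(\<phi> z *v u, \<psi> z *v u) | u. True}"
    using nev by simp_all
  define a11 a12 a21 a22 where a_def: "a11 = (\<lambda>z. block11 (Q z))" "a12 = (\<lambda>z. block12 (Q z))"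
    "a21 = (\<lambda>z. block21 (Q z))" "a22 = (\<lambda>z. block22 (Q z))"
  define E where "E z = a11 z ** \<phi> z + \<psi> z" for z
  define r where "r z = a22 z - a21 z ** \<phi> z ** matrix_inv (E z) ** a12 z" for z
  have hola: "holomorphic_matrix_on a11 (- \<real>)" "holomorphic_matrix_on a12 (- \<real>)"
    "holomorphic_matrix_on a21 (- \<real>)" "holomorphic_matrix_on a22 (- \<real>)"
    unfolding a_def using hol by blast+
  have E_vec: "E z *v u = a11 z *v (\<phi> z *v u) + \<psi> z *v u" for z u
    by (simp add: E_def matrix_vector_mult_add_rdistrib matrix_vector_mul_assoc)
  have pos\<tau>: "0 \<le> Im z * Im (cinner (\<psi> z *v u) (\<phi> z *v u))" if "z \<notin> \<real>" for z u
  proof -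
    have "0 \<le> Im z * Im (cinner ((cadj (\<phi> z) ** \<psi> z) *v u) u)"
      using psd[OF that] unfolding psd_imaginary_part by blast
    then show ?thesis by (simp add: cinner_cadj_left flip: matrix_vector_mul_assoc)
  qed
  have Q_join: "Q z *v vec_join u v = vec_join (a11 z *v u + a12 z *v v) (a21 z *v u + a22 z *v v)" for z u v
    using block_mult_vec_join[of "a11 z" "a12 z" "a21 z" "a22 z"] by (simp add: a_def block_eta)
  have pos11: "0 \<le> Im z * Im (cinner (a11 z *v u) u)" if "z \<notin> \<real>" for z u
    using pos[OF that, of "vec_join u 0"] by (simp add: Q_join cinner_vec_join)
  \<comment> \<open>On the kernel of \<open>E z\<close> the sign conditions of the family and of
    \<open>a11\<close> are opposed, so the form of \<open>a11\<close> vanishes at \<phi> u.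
    Strictness gives \<phi> u = 0, then \<psi> u = 0, and the common kernel is trivial.\<close>
  have E_inv: "invertible (E z)" if z: "z \<notin> \<real>" for z
    unfolding invertible_iff_ker
  proof (intro allI impI)
    fix u assume "E z *v u = 0"
    then have eq: "\<psi> z *v u = - (a11 z *v (\<phi> z *v u))"
      by (simp add: E_vec eq_neg_iff_add_eq_0 add.commute)
    have "Im z * Im (cinner (a11 z *v (\<phi> z *v u)) (\<phi> z *v u)) \<le> 0"
      using pos\<tau>[OF z, of u] by (simp add: eq cinner_minus_left)
    then have "Im z * Im (cinner (a11 z *v (\<phi> z *v u)) (\<phi> z *v u)) = 0"
      using pos11[OF z, of "\<phi> z *v u"] by linarith
    moreover have "Im z \<noteq> 0" using z complex_is_Real_iff by blast
    ultimately have \<phi>0: "\<phi> z *v u = 0" using strict[OF z] by (simp add: a_def)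
    then have "\<psi> z *v u = 0" using eq by simp
    then show "u = 0" using ker[OF z] \<phi>0 by blast
  qed
  have hr: "holomorphic_matrix_on r (- \<real>)"
    unfolding r_def[abs_def] using hola h\<phi> h\<psi> E_inv
    by (intro holomorphic_matrix_on_diff holomorphic_matrix_on_mult holomorphic_matrix_on_inv)
      (auto simp: E_def[abs_def])
  have r_vec: "r z *v v = a22 z *v v - a21 z *v (\<phi> z *v (matrix_inv (E z) *v (a12 z *v v)))" for z v
    by (simp add: r_def matrix_vector_mult_diff_rdistrib matrix_vector_mul_assoc matrix_mul_assoc)
  have r_pos: "0 \<le> Im z * Im (cinner (r z *v v) v)" if z: "z \<notin> \<real>" for z v
  proof -
    \<comment> \<open>For this u, Q(z) maps (-\<phi> u, v) to (\<psi> u, r v). Hence the form of r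
      at v is the form of Q at that vector plus that of the family at u, both with the right
      sign.\<close>
    define u where "u = matrix_inv (E z) *v (a12 z *v v)"
    have "E z *v u = a12 z *v v" unfolding u_def by (rule matrix_inv_vector_right[OF E_inv[OF z]])
    then have \<psi>u: "\<psi> z *v u = a12 z *v v - a11 z *v (\<phi> z *v u)" by (simp add: E_vec algebra_simps)
    have rv: "r z *v v = a22 z *v v - a21 z *v (\<phi> z *v u)" by (simp add: r_vec u_def)
    have neg: "X *v (- x) = - (X *v x)" for X :: "complex ^ 'p ^ 'p" and x
      using matrix_vector_mult_diff_distrib[of X 0 x] by simp
    have "Q z *v vec_join (- (\<phi> z *v u)) v = vec_join (\<psi> z *v u) (r z *v v)"
      by (simp add: Q_join \<psi>u rv neg)
    then have "cinner (Q z *v vec_join (- (\<phi> z *v u)) v) (vec_join (- (\<phi> z *v u)) v) =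
      - cinner (\<psi> z *v u) (\<phi> z *v u) + cinner (r z *v v) v"
      by (simp add: cinner_vec_join cinner_minus_right)
    then have "0 \<le> Im z * (Im (cinner (r z *v v) v) - Im (cinner (\<psi> z *v u) (\<phi> z *v u)))"
      using pos[OF z, of "vec_join (- (\<phi> z *v u)) v"] by simp
    then show ?thesis using pos\<tau>[OF z, of u] by (simp add: right_diff_distrib)
  qed
  have r_sym: "cadj (r (cnj z)) = r z" if z: "z \<notin> \<real>" for z
  proof -
    have z': "cnj z \<notin> \<real>" using z by (simp add: complex_is_Real_iff)
    have asym: "cadj (a11 (cnj z)) = a11 z" "cadj (a12 (cnj z)) = a21 z"
      "cadj (a21 (cnj z)) = a12 z" "cadj (a22 (cnj z)) = a22 z"
      using sym[OF z] block_components_cadj[of "Q (cnj z)"] by (simp_all add: a_def)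
    let ?iE = "matrix_inv (E z)" and ?iE' = "cadj (matrix_inv (E (cnj z)))"
    let ?E' = "cadj (E (cnj z))" and ?\<phi>' = "cadj (\<phi> (cnj z))"
    have E': "?E' = ?\<phi>' ** a11 z + cadj (\<psi> (cnj z))"
      by (simp add: E_def cadj_add cadj_mult asym)
    \<comment> \<open>This combines the symmetry of the family with that of \<open>a11\<close>.
      Multiplied by both inverses it says that \<phi> times the inverse of E is invariant under the
      reflection X(z) -> X(cnj z)*, and so is r.\<close>
    have "?E' ** \<phi> z = ?\<phi>' ** E z"
      unfolding E' using sym\<tau>[OF z] by (simp add: E_def matrix_add_ldistrib matrix_add_mult matrix_mul_assoc)
    then have "?iE' ** (?E' ** \<phi> z) ** ?iE = ?iE' ** (?\<phi>' ** E z) ** ?iE" by simp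
    then have "(?iE' ** ?E') ** \<phi> z ** ?iE = ?iE' ** ?\<phi>' ** (E z ** ?iE)"
      by (simp add: matrix_mul_assoc)
    moreover have "?iE' ** ?E' = mat 1"
      using matrix_inv_right[OF E_inv[OF z']] by (metis cadj_mult cadj_mat_1)
    ultimately have key: "\<phi> z ** ?iE = ?iE' ** ?\<phi>'"
      by (simp add: matrix_inv_right[OF E_inv[OF z]])
    have "cadj (r (cnj z)) = a22 z - a21 z ** (?iE' ** ?\<phi>') ** a12 z"
      by (simp add: r_def cadj_diff cadj_mult asym matrix_mul_assoc)
    also have "\<dots> = r z" unfolding key[symmetric] by (simp add: r_def matrix_mul_assoc)
    finally show ?thesis .
  qed
  define \<tau>' where "\<tau>' z = {(mat 1 *v u, r z *v u) | u. True}" for z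
  have "nevanlinna_family \<tau>'"
    unfolding nevanlinna_family_def
  proof (intro exI conjI allI impI)
    show "holomorphic_matrix_on (\<lambda>_. mat 1) (- \<real>)" "holomorphic_matrix_on r (- \<real>)"
      using hr by blast+
    fix z :: complex assume z: "z \<notin> \<real>"
    show "psd (complex_of_real (Im z) *\<^sub>C (1 / (2 * \<i>)) *\<^sub>C
          (cadj (mat 1) ** r z - cadj (cadj (mat 1) ** r z)))"
      unfolding psd_imaginary_part using r_pos[OF z] by simp
    show "cadj (mat 1) ** r z - cadj (r (cnj z)) ** mat 1 = 0"
      by (simp add: r_sym[OF z])
    show "{u. mat 1 *v u = 0} \<inter> {u. r z *v u = 0} = {0}" by auto
    show "\<tau>' z = {(mat 1 *v u, r z *v u) | u. True}" by (rule \<tau>'_def)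
  qed
  moreover have "lft (resolvent_matrix Q z) (\<tau> z) = \<tau>' z"
    if z: "z \<notin> \<real>" and inv: "invertible (block12 (Q z))" for z
  proof -
    let ?i = "matrix_inv (a12 z)" and ?w = "resolvent_matrix Q z"
    have inv: "invertible (a12 z)" using inv by (simp add: a_def)
    have w: "block22 ?w *v h + block21 ?w *v h' = ?i *v (a11 z *v h + h')"
      "block12 ?w *v h + block11 ?w *v h' = a22 z *v (?i *v (a11 z *v h + h')) - a21 z *v h" for h h'
      by (simp_all add: resolvent_matrix_def Let_def a_def matrix_vector_mult_add_rdistrib
          matrix_vector_mult_diff_rdistrib matrix_vector_right_distrib matrix_vector_mul_assoc matrix_mul_assoc)
    have comp: "a22 z *v (?i *v (E z *v u)) - a21 z *v (\<phi> z *v u) = r z *v (?i *v (E z *v u))" for u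
      by (simp add: r_vec matrix_inv_vector_right[OF inv] matrix_inv_vector_left[OF E_inv[OF z]])
    have "lft ?w (\<tau> z) = {(?i *v (E z *v u), a22 z *v (?i *v (E z *v u)) - a21 z *v (\<phi> z *v u)) | u. True}"
      unfolding lft_def \<tau>eq[OF z] w E_vec by blast
    also have "\<dots> = {(?i *v (E z *v u), r z *v (?i *v (E z *v u))) | u. True}"
      unfolding comp ..
    \<comment> \<open>\<open>a12 z\<close> and \<open>E z\<close> are both invertible, so the first
      component runs through the whole space and the relation is the full graph of
      \<open>r z\<close>.\<close>
    also have "\<dots> = \<tau>' z"
    proof (intro equalityI subsetI)
      fix x assume "x \<in> \<tau>' z"
      then obtain v where x: "x = (v, r z *v v)" by (auto simp: \<tau>'_def)
      have "?i *v (E z *v (matrix_inv (E z) *v (a12 z *v v))) = v"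
        by (simp only: matrix_inv_vector_right[OF E_inv[OF z]] matrix_inv_vector_left[OF inv])
      then show "x \<in> {(?i *v (E z *v u), r z *v (?i *v (E z *v u))) | u. True}"
        unfolding x by (intro CollectI exI[of _ "matrix_inv (E z) *v (a12 z *v v)"]) simp
    qed (auto simp: \<tau>'_def)
    finally show ?thesis .
  qed
  ultimately show ?thesis by blast
qed

section \<open>The function \<open>\<AA>\<close>\<close>

locale boundary_triplet_operator = boundary_triplet A \<Gamma>0 \<Gamma>1
  for A :: "('h::chilbert_space \<times> 'h) set" and \<Gamma>0 \<Gamma>1 :: "'h \<times> 'h \<Rightarrow> complex ^ 'p" +
  fixes L :: "complex ^ 'p \<Rightarrow> 'h \<Rightarrow> complex"
  assumes L_clinear: "clinear_on UNIV L" and L_in_H_minus: "L \<xi> \<in> H_minus A"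
begin

abbreviation "Q \<equiv> frak_A A \<Gamma>0 \<Gamma>1 L"

lemma L_add: "L (\<xi> + \<eta>) = L \<xi> + L \<eta>" and L_scaleC: "L (c *\<^sub>C \<xi>) = c *\<^sub>C L \<xi>"
  using L_clinear by (simp_all add: clinear_on_def)

lemma cinner_adj_plus: "cinner (adj_plus L h) \<xi> = cnj (L \<xi> h)"
proof -
  have "\<exists>u. \<forall>\<xi>. cinner u \<xi> = cnj (L \<xi> h)"
    by (rule riesz_representation_vec) (simp_all add: L_add L_scaleC scaleC_fun_def scaleC_complex_def)
  then have "\<exists>!u. \<forall>\<xi>. cinner u \<xi> = cnj (L \<xi> h)" using cinner_eqI by metis
  from theI'[OF this] show ?thesis unfolding adj_plus_def by blast
qed

lemma adj_plus_add: "h \<in> H_plus A \<Longrightarrow> k \<in> H_plus A \<Longrightarrow> adj_plus L (h + k) = adj_plus L h + adj_plus L k"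
  by (rule cinner_eqI) (simp add: cinner_adj_plus cinner_add_left H_minus_addD[OF L_in_H_minus])

lemma adj_plus_scaleC: "h \<in> H_plus A \<Longrightarrow> adj_plus L (c *\<^sub>C h) = c *\<^sub>C adj_plus L h"
  by (rule cinner_eqI) (simp add: cinner_adj_plus cinner_scaleC_left H_minus_scaleD[OF L_in_H_minus])

lemma cinner_adj_minus_gamma:
  assumes z: "z \<in> \<rho>" and F: "F \<in> H_minus A"
  shows "cinner (adj_minus (\<gamma> z) F) \<xi> = F (\<gamma> z \<xi>)"
  by (intro cinner_adj_minus riesz_representation_vec)
    (simp_all add: gamma_add[OF z] gamma_scaleC[OF z] gamma_in_H_plus[OF z] H_minus_addD[OF F] H_minus_scaleD[OF F])

text \<open>\<open>matrix\<close> reproduces a map only when that map is linear, so linearity is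
  first derived from that of the \<gamma>-field and of \<open>\<Gamma>1\<close>. The other three
  blocks follow the same scheme.\<close>

lemma block11_frak_A:
  assumes z: "z \<in> \<rho>"
  shows "block11 (Q z) *v \<xi> = \<Gamma>1 (gamma_hat A \<Gamma>0 z \<xi>)"
proof -
  note in_As = gamma_in_As[OF z]
  have "weyl_function A \<Gamma>0 \<Gamma>1 z *v \<xi> = \<Gamma>1 (gamma_hat A \<Gamma>0 z \<xi>)"
    unfolding weyl_function_def
  proof (rule matrix_clinear)
    fix \<xi> \<eta> :: "complex ^ 'p" and c
    have "gamma_hat A \<Gamma>0 z (\<xi> + \<eta>) = (\<gamma> z \<xi>, z *\<^sub>C \<gamma> z \<xi>) + (\<gamma> z \<eta>, z *\<^sub>C \<gamma> z \<eta>)"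
      by (simp add: gamma_hat_eq[OF z] gamma_add[OF z] scaleC_add_right)
    then show "\<Gamma>1 (gamma_hat A \<Gamma>0 z (\<xi> + \<eta>)) = \<Gamma>1 (gamma_hat A \<Gamma>0 z \<xi>) + \<Gamma>1 (gamma_hat A \<Gamma>0 z \<eta>)"
      by (simp only: \<Gamma>1_add[OF in_As in_As] gamma_hat_eq[OF z])
    have "gamma_hat A \<Gamma>0 z (c *\<^sub>C \<xi>) = c *\<^sub>C (\<gamma> z \<xi>, z *\<^sub>C \<gamma> z \<xi>)"
      by (simp add: gamma_hat_eq[OF z] gamma_scaleC[OF z] scaleC_prod_def scaleC_scaleC mult.commute)
    then show "\<Gamma>1 (gamma_hat A \<Gamma>0 z (c *\<^sub>C \<xi>)) = c *\<^sub>C \<Gamma>1 (gamma_hat A \<Gamma>0 z \<xi>)"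
      by (simp only: \<Gamma>1_scaleC[OF in_As] gamma_hat_eq[OF z])
  qed
  then show ?thesis by (simp add: frak_A_def)
qed

lemma cinner_block12_frak_A:
  assumes z: "z \<in> \<rho>"
  shows "cinner (block12 (Q z) *v \<xi>) \<eta> = L \<xi> (\<gamma> (cnj z) \<eta>)"
proof -
  note adj = cinner_adj_minus_gamma[OF cnj_in_\<rho>[OF z] L_in_H_minus]
  have "matrix (\<lambda>\<xi>. adj_minus (\<gamma> (cnj z)) (L \<xi>)) *v \<xi> = adj_minus (\<gamma> (cnj z)) (L \<xi>)"
    by (rule matrix_clinear; rule cinner_eqI)
      (simp_all only: adj cinner_add_left cinner_scaleC_left, simp_all add: L_add L_scaleC scaleC_fun_def scaleC_complex_def)
  then show ?thesis by (simp add: frak_A_def adj)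
qed

lemma cinner_block21_frak_A:
  assumes z: "z \<in> \<rho>"
  shows "cinner (block21 (Q z) *v \<xi>) \<eta> = cnj (L \<eta> (\<gamma> z \<xi>))"
proof -
  have "matrix (\<lambda>\<xi>. adj_plus L (\<gamma> z \<xi>)) *v \<xi> = adj_plus L (\<gamma> z \<xi>)"
    by (rule matrix_clinear)
      (simp_all add: gamma_add[OF z] gamma_scaleC[OF z] adj_plus_add adj_plus_scaleC gamma_in_H_plus[OF z])
  then show ?thesis by (simp add: frak_A_def cinner_adj_plus)
qed

lemma cinner_block22_frak_A:
  assumes z: "z \<in> \<rho>"
  shows "cinner (block22 (Q z) *v \<xi>) \<eta> = cnj (L \<eta> (reg_ext_resolvent A0 z (L \<xi>)))"
proof -
  let ?S = "reg_ext_resolvent A0 z"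
  \<comment> \<open>Additivity and homogeneity of \<open>adj_plus L\<close> are available on
    \<open>H_plus A\<close>; the regularization is what brings the values there.\<close>
  have in_H_plus: "?S F \<in> H_plus A" if "F \<in> H_minus A" for F
    unfolding reg_ext_resolvent_eq[OF z that]
    by (intro H_plus_scaleC H_plus_add Rt_diff_in_H_plus csubspace_A symmetric_A z i_in_\<rho> that)
  have add: "?S (L \<xi> + L \<eta>) = ?S (L \<xi>) + ?S (L \<eta>)" for \<xi> \<eta>
    using z i_in_\<rho> L_in_H_minus H_minus_add[OF csubspace_A symmetric_A L_in_H_minus L_in_H_minus]
    by (simp add: reg_ext_resolvent_eq Rt_add algebra_simps flip: scaleC_add_right)
  have scale: "?S (c *\<^sub>C L \<xi>) = c *\<^sub>C ?S (L \<xi>)" for c \<xi>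
  proof -
    have "?S (c *\<^sub>C L \<xi>) = (1/2) *\<^sub>C c *\<^sub>C ((Rt z (L \<xi>) - Rt \<i> (L \<xi>)) + (Rt z (L \<xi>) - Rt (- \<i>) (L \<xi>)))"
      using z i_in_\<rho> L_in_H_minus H_minus_scaleC[OF csubspace_A symmetric_A L_in_H_minus]
      by (simp only: reg_ext_resolvent_eq Rt_scaleC complex_vec.scale_right_diff_distrib scaleC_add_right)
    then show ?thesis using z L_in_H_minus by (simp only: reg_ext_resolvent_eq scaleC_scaleC mult.commute)
  qed
  have "matrix (\<lambda>\<xi>. adj_plus L (?S (L \<xi>))) *v \<xi> = adj_plus L (?S (L \<xi>))"
    by (rule matrix_clinear)
      (simp_all only: L_add L_scaleC add scale adj_plus_add adj_plus_scaleC in_H_plus[OF L_in_H_minus])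
  then show ?thesis by (simp add: frak_A_def cinner_adj_plus)
qed

section \<open>Gram factorization of the Nevanlinna kernel and holomorphy\<close>

definition G :: "complex \<Rightarrow> complex ^ ('p + 'p) \<Rightarrow> 'h" where
  "G z x = \<gamma> z (\<chi> k. x $ Inl k) + Rt z (L (\<chi> k. x $ Inr k))"

lemma G_vec_join: "G z (vec_join u v) = \<gamma> z u + Rt z (L v)"
  by (simp add: G_def)

text \<open>The \<gamma>-field and the extended resolvent obey the same difference relation, hence
  so does their sum. Continuity of G in z rests on it.\<close>

lemma G_diff:
  assumes "z \<in> \<rho>" and "w \<in> \<rho>"
  shows "G z x - G w x = (z - w) *\<^sub>C R z (G w x)"
proof -
  obtain u v where x: "x = vec_join u v" by (rule vec_join_exhaust)
  have "G z x - G w x = (\<gamma> z u - \<gamma> w u) + (Rt z (L v) - Rt w (L v))" by (simp add: x G_vec_join)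
  also have "\<dots> = (z - w) *\<^sub>C R z (G w x)"
    by (simp only: gamma_diff[OF assms] Rt_diff[OF assms L_in_H_minus] x G_vec_join
        resolvent_add[OF assms(1)] scaleC_add_right)
  finally show ?thesis .
qed

text \<open>Passing to the adjoint of Q(w) exchanges the off-diagonal positions, so a12(z) is
  compared with a21(w) and a21(z) with a12(w). Each of the four differences contributes one of the
  four inner products contained in (G z x, G w y).\<close>

lemma frak_A_identity:
  assumes z: "z \<in> \<rho>" and w: "w \<in> \<rho>"
  shows "cinner (Q z *v x) y - cinner x (Q w *v y) = (z - cnj w) * cinner (G z x) (G w y)"
proof -
  obtain u v where x: "x = vec_join u v" by (rule vec_join_exhaust)
  obtain u' v' where y: "y = vec_join u' v'" by (rule vec_join_exhaust)
  have Q_join: "Q z *v vec_join u v = vec_join (block11 (Q z) *v u + block12 (Q z) *v v)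
      (block21 (Q z) *v u + block22 (Q z) *v v)" for z u v
    by (metis block_eta block_mult_vec_join)
  have e11: "cinner (block11 (Q z) *v u) u' - cinner u (block11 (Q w) *v u') =
      (z - cnj w) * cinner (\<gamma> z u) (\<gamma> w u')"
    by (simp only: block11_frak_A z w weyl_identity)
  have "cinner v (block21 (Q w) *v u') = L v (\<gamma> w u')"
    by (subst cinner_commute) (simp add: cinner_block21_frak_A[OF w])
  then have e12: "cinner (block12 (Q z) *v v) u' - cinner v (block21 (Q w) *v u') =
      (z - cnj w) * cinner (Rt z (L v)) (\<gamma> w u')"
    by (simp only: cinner_block12_frak_A[OF z] pairing_gamma_diff[OF z w L_in_H_minus])
  \<comment> \<open>The remaining mixed comparison is the conjugate of the previous one with z and w
    interchanged.\<close>
  have "cinner u (block12 (Q w) *v v') = cnj (L v' (\<gamma> (cnj w) u))"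
    by (subst cinner_commute) (simp add: cinner_block12_frak_A[OF w])
  then have "cinner (block21 (Q z) *v u) v' - cinner u (block12 (Q w) *v v') =
      - cnj ((w - cnj z) * cinner (Rt w (L v')) (\<gamma> z u))"
    by (simp add: cinner_block21_frak_A[OF z] flip: pairing_gamma_diff[OF w z L_in_H_minus])
  also have "\<dots> = (z - cnj w) * cinner (\<gamma> z u) (Rt w (L v'))"
    by (simp add: algebra_simps flip: cinner_commute)
  finally have e21: "cinner (block21 (Q z) *v u) v' - cinner u (block12 (Q w) *v v') = \<dots>" .
  have "cinner v (block22 (Q w) *v v') = L v (reg_ext_resolvent A0 w (L v'))"
    by (subst cinner_commute) (simp add: cinner_block22_frak_A[OF w])
  then have e22: "cinner (block22 (Q z) *v v) v' - cinner v (block22 (Q w) *v v') =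
      (z - cnj w) * cinner (Rt z (L v)) (Rt w (L v'))"
    by (simp only: cinner_block22_frak_A[OF z] reg_ext_resolvent_identity[OF z w L_in_H_minus L_in_H_minus])
  have "cinner (Q z *v x) y - cinner x (Q w *v y) =
    (cinner (block11 (Q z) *v u) u' - cinner u (block11 (Q w) *v u')) +
    (cinner (block12 (Q z) *v v) u' - cinner v (block21 (Q w) *v u')) +
    (cinner (block21 (Q z) *v u) v' - cinner u (block12 (Q w) *v v')) +
    (cinner (block22 (Q z) *v v) v' - cinner v (block22 (Q w) *v v'))"
    by (simp add: x y Q_join cinner_vec_join cinner_add_left cinner_add_right)
  also have "\<dots> = (z - cnj w) * cinner (G z x) (G w y)"
    unfolding e11 e12 e21 e22 by (simp add: x y G_vec_join cinner_add_left cinner_add_right distrib_left)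
  finally show ?thesis .
qed

text \<open>At w = cnj z the factor z - cnj w of the basic identity vanishes.\<close>

lemma frak_A_cnj: "z \<in> \<rho> \<Longrightarrow> cadj (Q (cnj z)) = Q z"
  by (rule matrix_eq_cinnerI)
    (use frak_A_identity[of z "cnj z"] cnj_in_\<rho> in \<open>simp add: cinner_cadj_left\<close>)

lemma Im_cinner_frak_A: "z \<in> \<rho> \<Longrightarrow> Im (cinner (Q z *v x) x) = Im z * (norm (G z x))\<^sup>2"
proof -
  assume "z \<in> \<rho>"
  then have "cinner (Q z *v x) x - cnj (cinner (Q z *v x) x) = (z - cnj z) * cinner (G z x) (G z x)"
    using frak_A_identity by (metis cinner_commute)
  then have "2 * \<i> * of_real (Im (cinner (Q z *v x) x)) = 2 * \<i> * of_real (Im z * (norm (G z x))\<^sup>2)"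
    by (simp add: complex_diff_cnj cinner_self mult_ac)
  then show ?thesis by (simp add: complex_eq_iff)
qed

text \<open>The imaginary part of the form is Im z times the squared norm of
  \<open>\<gamma> z u\<close>, and \<open>\<Gamma>0\<close> recovers u from that defect vector. This
  strictness makes a11 \<phi> + \<psi> invertible in the transform of families.\<close>

lemma Im_block11_frak_A_eq_0:
  assumes z: "Im z \<noteq> 0" and 0: "Im (cinner (block11 (Q z) *v u) u) = 0"
  shows "u = 0"
proof -
  note z' = nonreal_in_\<rho>[OF z]
  let ?m = "cinner (block11 (Q z) *v u) u"
  have "?m - cnj ?m = (z - cnj z) * cinner (\<gamma> z u) (\<gamma> z u)"
    using weyl_identity[OF z' z'] by (metis block11_frak_A[OF z'] cinner_commute)
  then have "(z - cnj z) * cinner (\<gamma> z u) (\<gamma> z u) = 0"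
    using 0 by (simp add: complex_diff_cnj)
  then have "\<gamma> z u = 0" using z by (simp add: complex_diff_cnj cinner_self)
  moreover have "\<Gamma>0 (0, 0) = 0"
    using \<Gamma>0_diff[OF csubspace_zeroD[OF csubspace_rel_adj] csubspace_zeroD[OF csubspace_rel_adj]] by simp
  ultimately show ?thesis using \<Gamma>0_gamma[OF z', of u] by simp
qed

text \<open>The basic identity at z and w would attach x to z. In the positivity sum, x carries the
  index of w; therefore the identity is taken at cnj w and cnj z and combined with the reflection
  symmetry of Q, so that each vector meets its own point.\<close>

lemma N_kernel_frak_A:
  assumes z: "z \<in> \<rho>" and w: "w \<in> \<rho>" and "z \<noteq> cnj w"
  shows "cinner (N_kernel Q w z *v x) y = cinner (G (cnj w) x) (G (cnj z) y)"
proof -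
  have "cinner ((Q z - cadj (Q w)) *v x) y = cinner (cadj (Q (cnj z)) *v x) y - cinner (Q (cnj w) *v x) y"
    using frak_A_cnj[OF z] frak_A_cnj[OF cnj_in_\<rho>[OF w]]
    by (simp add: matrix_vector_mult_diff_rdistrib cinner_diff_left)
  also have "\<dots> = (z - cnj w) * cinner (G (cnj w) x) (G (cnj z) y)"
    using frak_A_identity[OF cnj_in_\<rho>[OF w] cnj_in_\<rho>[OF z], of x y]
    by (simp add: cinner_cadj_left algebra_simps)
  finally show ?thesis
    using assms(3) by (simp add: N_kernel_def matrix_scaleC_vector cinner_scaleC_left)
qed

text \<open>The difference quotient of an entry at w is an inner product of G z x with a fixed
  vector, so holomorphy reduces to norm continuity of z -> G z x.\<close>

lemma holomorphic_frak_A: "holomorphic_matrix_on Q (- \<real>)"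
  unfolding holomorphic_matrix_on_def
proof (intro allI)
  fix i j
  let ?x = "axis j 1 :: complex ^ ('p + 'p)" and ?y = "axis i 1 :: complex ^ ('p + 'p)"
  have entry: "Q z $ i $ j = cinner (Q z *v ?x) ?y" for z
    by (simp add: cinner_vec_complex matrix_vector_mult_axis)
      (simp add: axis_def if_distrib cong: if_cong)
  have "(\<lambda>z. Q z $ i $ j) field_differentiable (at w within - \<real>)" if w: "w \<in> - \<real>" for w
  proof -
    have Imw: "Im w \<noteq> 0" using w by (simp add: complex_is_Real_iff)
    note w\<rho> = nonreal_in_\<rho>[OF Imw]
    have nonreal: "\<forall>\<^sub>F z in at w within - \<real>. Im z \<noteq> 0 \<and> z \<noteq> w"
      by (simp add: eventually_at_filter complex_is_Real_iff)
    have "((\<lambda>z. G z ?x - G w ?x) \<longlongrightarrow> 0) (at w within - \<real>)"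
    proof (rule Lim_null_comparison)
      \<comment> \<open>This majorant combines the difference relation for G with the resolvent
        bound 1 / |Im z|; it tends to 0 because Im w is nonzero.\<close>
      show "((\<lambda>z. cmod (z - w) * norm (G w ?x) / \<bar>Im z\<bar>) \<longlongrightarrow> 0) (at w within - \<real>)"
        using Imw by (auto intro!: tendsto_eq_intros)
      show "\<forall>\<^sub>F z in at w within - \<real>. norm (G z ?x - G w ?x) \<le> cmod (z - w) * norm (G w ?x) / \<bar>Im z\<bar>"
      proof (rule eventually_mono[OF nonreal])
        fix z assume z: "Im z \<noteq> 0 \<and> z \<noteq> w"
        then have z\<rho>: "z \<in> \<rho>" by (simp add: nonreal_in_\<rho>)
        have "\<bar>Im z\<bar> * norm (R z (G w ?x)) \<le> norm (G w ?x)"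
          by (rule norm_resolvent_le[OF symmetric_A0 z\<rho>])
        then have "cmod (z - w) * (\<bar>Im z\<bar> * norm (R z (G w ?x))) \<le> cmod (z - w) * norm (G w ?x)"
          by (intro mult_left_mono) auto
        then show "norm (G z ?x - G w ?x) \<le> cmod (z - w) * norm (G w ?x) / \<bar>Im z\<bar>"
          using z by (simp add: G_diff[OF z\<rho> w\<rho>] norm_scaleC pos_le_divide_eq mult_ac)
      qed
    qed
    then have "((\<lambda>z. G z ?x) \<longlongrightarrow> G w ?x) (at w within - \<real>)" by (simp add: LIM_zero_iff)
    then have "((\<lambda>z. cinner (G z ?x) (G (cnj w) ?y)) \<longlongrightarrow> cinner (G w ?x) (G (cnj w) ?y)) (at w within - \<real>)"
      by (rule bounded_linear.tendsto[OF bounded_linear_cinner_left])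
    moreover have "\<forall>\<^sub>F z in at w within - \<real>.
        cinner (G z ?x) (G (cnj w) ?y) = (Q z $ i $ j - Q w $ i $ j) / (z - w)"
    proof (rule eventually_mono[OF nonreal])
      fix z assume z: "Im z \<noteq> 0 \<and> z \<noteq> w"
      then have z\<rho>: "z \<in> \<rho>" by (simp add: nonreal_in_\<rho>)
      have "Q w $ i $ j = cinner ?x (Q (cnj w) *v ?y)"
        unfolding entry using frak_A_cnj[OF w\<rho>] by (metis cinner_cadj_left)
      then have "Q z $ i $ j - Q w $ i $ j = (z - w) * cinner (G z ?x) (G (cnj w) ?y)"
        using frak_A_identity[OF z\<rho> cnj_in_\<rho>[OF w\<rho>], of ?x ?y] by (simp add: entry[of z])
      then show "cinner (G z ?x) (G (cnj w) ?y) = (Q z $ i $ j - Q w $ i $ j) / (z - w)"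
        using z by simp
    qed
    ultimately have "((\<lambda>z. (Q z $ i $ j - Q w $ i $ j) / (z - w)) \<longlongrightarrow> cinner (G w ?x) (G (cnj w) ?y)) (at w within - \<real>)"
      by (rule Lim_transform_eventually)
    then show ?thesis
      unfolding field_differentiable_def has_field_derivative_iff by blast
  qed
  then show "(\<lambda>z. Q z $ i $ j) holomorphic_on - \<real>"
    by (simp add: holomorphic_on_def)
qed

section \<open>Gauge points and the invertibility of \<open>a12\<close>\<close>

lemma block12_frak_A_eq_0_iff:
  assumes z: "z \<in> \<rho>"
  shows "block12 (Q z) *v \<xi> = 0 \<longleftrightarrow> L \<xi> \<in> ext_ran A z"
proof -
  have "block12 (Q z) *v \<xi> = 0 \<longleftrightarrow> (\<forall>\<eta>. L \<xi> (\<gamma> (cnj z) \<eta>) = 0)"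
    unfolding cinner_block12_frak_A[OF z, symmetric]
    using cinner_eqI[of "block12 (Q z) *v \<xi>" 0] by auto
  then show ?thesis by (simp add: ext_ran_iff[OF z] L_in_H_minus)
qed

lemma gauge_points_imp_invertible:
  assumes "inj L" and z: "z \<in> \<rho>" and "z \<in> gauge_points A (range L)"
  shows "invertible (block12 (Q z))"
  unfolding invertible_iff_ker block12_frak_A_eq_0_iff[OF z]
proof (intro allI impI)
  fix \<xi> assume "L \<xi> \<in> ext_ran A z"
  then have "L \<xi> = 0" using assms(3) by (auto simp: gauge_points_def)
  moreover have "L 0 = 0" using L_scaleC[of 0 0] by simp
  ultimately show "\<xi> = 0" using injD[OF assms(1)] by metis
qed

text \<open>The converse direction identifies the nonreal gauge points with the points where det a12
  does not vanish, which yields openness of the domain of W in the upper half-plane.\<close>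

lemma nonreal_gauge_points_iff:
  assumes "inj L" and "Im z \<noteq> 0"
  shows "z \<in> gauge_points A (range L) \<longleftrightarrow> invertible (block12 (Q z))"
proof
  note z = nonreal_in_\<rho>[OF assms(2)]
  note z' = cnj_in_\<rho>[OF z]
  show "z \<in> gauge_points A (range L) \<Longrightarrow> invertible (block12 (Q z))"
    by (rule gauge_points_imp_invertible[OF assms(1) z])
  assume inv: "invertible (block12 (Q z))"
  have "z \<in> regular_points A"
    by (rule nonreal_in_regular_points[OF csubspace_A closed_A symmetric_A assms(2)])
  moreover have "H_minus A = {F + F' | F F'. F \<in> ext_ran A z \<and> F' \<in> range L}"
  proof (intro equalityI subsetI)
    fix F assume F: "F \<in> H_minus A"
    \<comment> \<open>\<open>L \<xi>\<close> is chosen to agree with F on the defect space at cnj z;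
      the difference annihilates that space and therefore lies in
      \<open>ext_ran A z\<close>.\<close>
    define \<xi> where "\<xi> = matrix_inv (block12 (Q z)) *v adj_minus (\<gamma> (cnj z)) F"
    have "L \<xi> (\<gamma> (cnj z) \<eta>) = F (\<gamma> (cnj z) \<eta>)" for \<eta>
      using cinner_block12_frak_A[OF z, of \<xi> \<eta>] cinner_adj_minus_gamma[OF z' F, of \<eta>]
      by (simp add: \<xi>_def matrix_inv_vector_right[OF inv])
    then have "F - L \<xi> \<in> ext_ran A z"
      by (simp add: ext_ran_iff[OF z] H_minus_diff[OF csubspace_A symmetric_A F L_in_H_minus])
    moreover have "F = (F - L \<xi>) + L \<xi>" by simp
    ultimately show "F \<in> {F + F' | F F'. F \<in> ext_ran A z \<and> F' \<in> range L}" by blast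
  next
    fix H assume "H \<in> {F + F' | F F'. F \<in> ext_ran A z \<and> F' \<in> range L}"
    then show "H \<in> H_minus A"
      using H_minus_add[OF csubspace_A symmetric_A] L_in_H_minus by (auto simp: ext_ran_iff[OF z])
  qed
  moreover have "ext_ran A z \<inter> range L = {0}"
  proof -
    have L0: "L 0 = 0" using L_scaleC[of 0 0] by simp
    then have "0 \<in> ext_ran A z" using L_in_H_minus[of 0] by (simp add: ext_ran_iff[OF z])
    moreover have "L \<xi> = 0" if "L \<xi> \<in> ext_ran A z" for \<xi>
      using that inv L0 unfolding invertible_iff_ker block12_frak_A_eq_0_iff[OF z] by blast
    ultimately show ?thesis using L0 by (auto intro: range_eqI[of _ L 0])
  qed
  ultimately show "z \<in> gauge_points A (range L)" by (simp add: gauge_points_def)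
qed

lemma class_W_resolvent_matrix:
  assumes "inj L"
  shows "class_W (gauge_points A (range L) \<inter> \<rho> \<inter> {z. Im z > 0}) (resolvent_matrix Q)"
proof -
  let ?\<Omega> = "gauge_points A (range L) \<inter> \<rho> \<inter> {z. Im z > 0}"
  have \<Omega>: "?\<Omega> = {z. Im z > 0} \<inter> (\<lambda>z. det (block12 (Q z))) -` (- {0})"
    using nonreal_gauge_points_iff[OF assms] nonreal_in_\<rho> by (auto simp: invertible_det_nz)
  have inv: "invertible (block12 (Q z))" if "z \<in> ?\<Omega>" for z
    using that gauge_points_imp_invertible[OF assms] by blast
  have sub: "{z. Im z > 0} \<subseteq> - \<real>" by (auto simp: complex_is_Real_iff)
  have op: "open {z. Im z > 0}" by (rule open_halfspace_Im_gt)
  have "(\<lambda>z. det (block12 (Q z))) holomorphic_on {z. Im z > 0}"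
    by (intro holomorphic_on_det holomorphic_matrix_on_subset[OF _ sub]
        holomorphic_matrix_on_block_components holomorphic_frak_A)
  then have "open ?\<Omega>"
    unfolding \<Omega> by (intro continuous_open_preimage holomorphic_on_imp_continuous_on op) auto
  moreover have "holomorphic_matrix_on (resolvent_matrix Q) ?\<Omega>"
  proof -
    have "?\<Omega> \<subseteq> - \<real>" using sub by blast
    then have "holomorphic_matrix_on Q ?\<Omega>" by (rule holomorphic_matrix_on_subset[OF holomorphic_frak_A])
    then show ?thesis
      unfolding resolvent_matrix_def[abs_def] Let_def using inv
      by (intro holomorphic_matrix_on_block holomorphic_matrix_on_mult holomorphic_matrix_on_diff
          holomorphic_matrix_on_inv holomorphic_matrix_on_block_components)
  qed
  moreover have "nonneg_kernel_on ?\<Omega> (K_kernel (resolvent_matrix Q))"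
    unfolding nonneg_kernel_on_def
  proof (intro allI impI)
    fix n :: nat and zs :: "nat \<Rightarrow> complex" and us :: "nat \<Rightarrow> complex ^ ('p + 'p)"
    assume zs: "\<forall>i<n. zs i \<in> ?\<Omega>"
    define X where "X z = block 0 (block12 (Q z)) (- mat 1) (block22 (Q z))" for z
    \<comment> \<open>The congruence factors are moved onto the vectors. The kernel values become
      the Gram matrix of the \<open>g i\<close>, whose double sum is the squared norm of their
      sum.\<close>
    define g where "g i = G (cnj (zs i)) (cadj (matrix_inv (X (zs i))) *v us i)" for i
    have "cinner (K_kernel (resolvent_matrix Q) (zs j) (zs i) *v us j) (us i) = cinner (g j) (g i)"
      if "i < n" "j < n" for i j
    proof -
      have i: "zs i \<in> ?\<Omega>" and j: "zs j \<in> ?\<Omega>" using zs that by auto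
      \<comment> \<open>Two points of the upper half-plane are never conjugate to each other, so no
        quotient in the sum has denominator 0.\<close>
      then have "zs i \<noteq> cnj (zs j)" by (auto simp: complex_eq_iff)
      then have "cinner (N_kernel Q (zs j) (zs i) *v x) y = cinner (G (cnj (zs j)) x) (G (cnj (zs i)) y)" for x y
        using i j by (intro N_kernel_frak_A) auto
      then show ?thesis
        unfolding K_kernel_resolvent_matrix[OF inv[OF i] inv[OF j]] g_def X_def
        by (simp add: cinner_matrix_left[of "matrix_inv _"] flip: matrix_vector_mul_assoc)
    qed
    then have "(\<Sum>i<n. \<Sum>j<n. cinner (K_kernel (resolvent_matrix Q) (zs j) (zs i) *v us j) (us i)) =
        (\<Sum>i<n. \<Sum>j<n. cinner (g j) (g i))" by simp
    also have "\<dots> = of_real ((norm (\<Sum>i<n. g i))\<^sup>2)"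
      by (simp only: cinner_sum_left[symmetric] cinner_sum_right[symmetric] cinner_self)
    finally have "(\<Sum>i<n. \<Sum>j<n. cinner (K_kernel (resolvent_matrix Q) (zs j) (zs i) *v us j) (us i)) = \<dots>" .
    then show "Im (\<Sum>i<n. \<Sum>j<n. cinner (K_kernel (resolvent_matrix Q) (zs j) (zs i) *v us j) (us i)) = 0 \<and>
       Re (\<Sum>i<n. \<Sum>j<n. cinner (K_kernel (resolvent_matrix Q) (zs j) (zs i) *v us j) (us i)) \<ge> 0"
      by simp
  qed
  ultimately show ?thesis by (simp add: class_W_def)
qed

end

theorem theorem4p12:
  fixes A :: "('h::chilbert_space \<times> 'h) set"
    and \<LL> :: "('h \<Rightarrow> complex) set"
    and L :: "complex ^ 'p \<Rightarrow> 'h \<Rightarrow> complex"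
    and \<Gamma>0 \<Gamma>1 :: "'h \<times> 'h \<Rightarrow> complex ^ 'p"
  assumes "closed_symmetric A"
    and "defect_numbers A CARD('p) CARD('p)"
    and "is_gauge A \<LL>"
    and "clinear_on UNIV L" and "bij_betw L UNIV \<LL>"
    and "boundary_triple A \<Gamma>0 \<Gamma>1"
  shows
    "let \<AA> = frak_A A \<Gamma>0 \<Gamma>1 L;
         a11 = (\<lambda>z. block11 (\<AA> z)); a12 = (\<lambda>z. block12 (\<AA> z));
         a21 = (\<lambda>z. block21 (\<AA> z)); a22 = (\<lambda>z. block22 (\<AA> z));
         W = resolvent_matrix \<AA>;
         D = gauge_points A \<LL> \<inter> resolvent_set (ker_ext A \<Gamma>0);
         X = (\<lambda>z. block 0 (a12 z) (- mat 1) (a22 z));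
         Y = (\<lambda>z. block (mat 1) (a11 z) 0 (a21 z))
     in
       (\<forall>z\<in>D. invertible (X z) \<and> W z = matrix_inv (X z) ** Y z) \<and>
       (\<forall>z\<in>D. \<forall>\<zeta>\<in>D. z \<noteq> cnj \<zeta> \<longrightarrow>
          K_kernel W \<zeta> z = matrix_inv (X z) ** N_kernel \<AA> \<zeta> z ** cadj (matrix_inv (X \<zeta>))) \<and>
       class_W (D \<inter> {z. Im z > 0}) W \<and>
       (\<forall>\<tau>. nevanlinna_family \<tau> \<longrightarrow>
          (\<exists>\<tau>'. nevanlinna_family \<tau>' \<and> (\<forall>z\<in>D - \<real>. lft (W z) (\<tau> z) = \<tau>' z)))"
proof -
  have \<LL>: "\<LL> = range L" and inj: "inj L" using assms(5) by (auto simp: bij_betw_def)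
  interpret boundary_triplet_operator A \<Gamma>0 \<Gamma>1 L
  proof
    show "L \<xi> \<in> H_minus A" for \<xi>
      using assms(3) \<LL> by (auto simp: is_gauge_def closed_subspace_minus_def)
  qed (use assms in \<open>simp_all add: closed_symmetric_def\<close>)
  define D where "D = gauge_points A \<LL> \<inter> \<rho>"
  have inv: "invertible (block12 (Q z))" if "z \<in> D" for z
    using that gauge_points_imp_invertible[OF inj] by (simp add: D_def \<LL>)
  have "\<exists>\<tau>'. nevanlinna_family \<tau>' \<and> (\<forall>z\<in>D - \<real>. lft (resolvent_matrix Q z) (\<tau> z) = \<tau>' z)"
    if \<tau>: "nevanlinna_family \<tau>" for \<tau>
  proof -
    \<comment> \<open>The transform is applied at all nonreal points, gauge points or not, since the
      resulting family must be holomorphic on all of them; only the comparison with W is restricted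
      to invertible \<open>a12\<close>.\<close>
    have "\<exists>\<tau>'. nevanlinna_family \<tau>' \<and>
      (\<forall>z. z \<notin> \<real> \<and> invertible (block12 (Q z)) \<longrightarrow> lft (resolvent_matrix Q z) (\<tau> z) = \<tau>' z)"
    proof (rule nevanlinna_family_transform[OF holomorphic_frak_A _ _ _ \<tau>])
      fix z :: complex assume "z \<notin> \<real>"
      then have z: "Im z \<noteq> 0" by (simp add: complex_is_Real_iff)
      show "cadj (Q (cnj z)) = Q z" by (rule frak_A_cnj[OF nonreal_in_\<rho>[OF z]])
      show "0 \<le> Im z * Im (cinner (Q z *v x) x)" for x
        by (simp add: Im_cinner_frak_A[OF nonreal_in_\<rho>[OF z]] flip: mult.assoc)
      show "u = 0" if "Im (cinner (block11 (Q z) *v u) u) = 0" for u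
        using Im_block11_frak_A_eq_0[OF z that] .
    qed
    then show ?thesis using inv by blast
  qed
  moreover have "class_W (D \<inter> {z. Im z > 0}) (resolvent_matrix Q)"
    using class_W_resolvent_matrix[OF inj] by (simp add: D_def \<LL>)
  ultimately show ?thesis
    unfolding Let_def D_def[symmetric]
    using resolvent_matrix_factorization[of Q, OF inv] K_kernel_resolvent_matrix[of Q, OF inv inv]
    by blast
qed

end
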